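(* Let $R$ be a standard graded polynomial ring over a field $k$ with graded maximal ideal $\mathfrak m$, and let $I\subseteq \mathfrak m^2$ be a homogeneous ideal. Assume that either $\operatorname{char} k=0$ or $I$ is a monomial ideal. Then for all integers $1\le t\le s$, the inclusion map $\mathfrak m^{s-t}I^t\to \mathfrak m^{s-t+1}I^{t-1}$ is Tor-vanishing.
   Context: A homomorphism $\phi:M\to N$ of finitely generated graded $R$-modules is called Tor-vanishing if $\operatorname{Tor}^R_i(k,\phi)=0$ for all $i\ge 0$, where $k=R/\mathfrak m$. By convention $\mathfrak m^0=I^0=R$. *)

theory Defs
  imports "HOL-Algebra.Algebra"
begin

section \<open>Modules over a commutative ring\<close>

text \<open>
  The fields \<^const>\<open>monoid.mult\<close> and \<^const>\<open>one\<close>, which a record of type \<open>module\<close> inherits from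
  \<open>ring\<close>, play no role for modules.
\<close>

definition mod_hom ::
    "('r, 'c) ring_scheme \<Rightarrow> ('r, 'a) module \<Rightarrow> ('r, 'b) module \<Rightarrow> ('a \<Rightarrow> 'b) set"
  where "mod_hom R M N =
    {h \<in> carrier M \<rightarrow> carrier N.
       (\<forall>x\<in>carrier M. \<forall>y\<in>carrier M. h (x \<oplus>\<^bsub>M\<^esub> y) = h x \<oplus>\<^bsub>N\<^esub> h y) \<and>
       (\<forall>r\<in>carrier R. \<forall>x\<in>carrier M. h (r \<odot>\<^bsub>M\<^esub> x) = r \<odot>\<^bsub>N\<^esub> h x)}"

definition ideal_module :: "('r, 'c) ring_scheme \<Rightarrow> 'r set \<Rightarrow> ('r, 'r) module"
  where "ideal_module R J =
    \<lparr>carrier = J, monoid.mult = (\<otimes>\<^bsub>R\<^esub>), one = \<one>\<^bsub>R\<^esub>, ring.zero = \<zero>\<^bsub>R\<^esub>, ring.add = (\<oplus>\<^bsub>R\<^esub>), smult = (\<otimes>\<^bsub>R\<^esub>)\<rparr>"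

definition quotient_module :: "('r, 'c) ring_scheme \<Rightarrow> 'r set \<Rightarrow> ('r, 'r set) module"
  where "quotient_module R J =
    \<lparr>carrier = carrier (R Quot J), monoid.mult = (\<otimes>\<^bsub>R Quot J\<^esub>), one = \<one>\<^bsub>R Quot J\<^esub>,
     ring.zero = \<zero>\<^bsub>R Quot J\<^esub>, ring.add = (\<oplus>\<^bsub>R Quot J\<^esub>),
     smult = (\<lambda>r A. (J +>\<^bsub>R\<^esub> r) \<otimes>\<^bsub>R Quot J\<^esub> A)\<rparr>"

definition module_basis :: "('r, 'c) ring_scheme \<Rightarrow> ('r, 'a) module \<Rightarrow> 'a set \<Rightarrow> bool"
  where "module_basis R M B \<longleftrightarrow> B \<subseteq> carrier M \<and>
    (\<forall>x\<in>carrier M. \<exists>!c. c \<in> (B \<rightarrow>\<^sub>E carrier R) \<and> finite {b \<in> B. c b \<noteq> \<zero>\<^bsub>R\<^esub>} \<and>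
       x = (\<Oplus>\<^bsub>M\<^esub>b\<in>{b \<in> B. c b \<noteq> \<zero>\<^bsub>R\<^esub>}. c b \<odot>\<^bsub>M\<^esub> b))"

definition free_module :: "('r, 'c) ring_scheme \<Rightarrow> ('r, 'a) module \<Rightarrow> bool"
  where "free_module R M \<longleftrightarrow> module R M \<and> (\<exists>B. module_basis R M B)"

text \<open>
  The augmented complex \<open>\<dots> \<rightarrow> F 2 \<rightarrow> F 1 \<rightarrow> F 0 \<rightarrow> K \<rightarrow> 0\<close>, with differentials
  \<open>d i : F (i + 1) \<rightarrow> F i\<close> and augmentation \<open>e : F 0 \<rightarrow> K\<close>, is exact.
\<close>

definition free_resolution ::
    "('r, 'c) ring_scheme \<Rightarrow> ('r, 'a) module \<Rightarrow>
     (nat \<Rightarrow> ('r, 'f) module) \<Rightarrow> (nat \<Rightarrow> 'f \<Rightarrow> 'f) \<Rightarrow> ('f \<Rightarrow> 'a) \<Rightarrow> bool"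
  where "free_resolution R K F d e \<longleftrightarrow>
    (\<forall>i. free_module R (F i)) \<and>
    (\<forall>i. d i \<in> mod_hom R (F (Suc i)) (F i)) \<and>
    e \<in> mod_hom R (F 0) K \<and>
    e ` carrier (F 0) = carrier K \<and>
    d 0 ` carrier (F 1) = a_kernel (F 0) K e \<and>
    (\<forall>i. d (Suc i) ` carrier (F (Suc (Suc i))) = a_kernel (F (Suc i)) (F i) (d i))"


section \<open>Tensor products\<close>

text \<open>
  The map \<open>G/H' \<rightarrow> G/H\<close> of coset spaces induced by \<open>f\<close>: the coset \<open>H' x\<close> is sent to
  the coset \<open>H (f x)\<close>, which is the product of \<open>H\<close> with the image of \<open>H' x\<close>
  as soon as \<open>f\<close> maps \<open>H'\<close> into \<open>H\<close>.
\<close>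

definition coset_map :: "('b, 'c) monoid_scheme \<Rightarrow> 'b set \<Rightarrow> ('a \<Rightarrow> 'b) \<Rightarrow> 'a set \<Rightarrow> 'b set"
  where "coset_map G H f A = H <#>\<^bsub>G\<^esub> (f ` A)"

definition tensor_relations ::
    "('r, 'c) ring_scheme \<Rightarrow> ('r, 'a) module \<Rightarrow> ('r, 'b) module \<Rightarrow> ('a \<times> 'b \<Rightarrow>\<^sub>0 int) set"
  where "tensor_relations R M N =
    {frag_of (x \<oplus>\<^bsub>M\<^esub> x', y) - frag_of (x, y) - frag_of (x', y) | x x' y.
       x \<in> carrier M \<and> x' \<in> carrier M \<and> y \<in> carrier N} \<union>
    {frag_of (x, y \<oplus>\<^bsub>N\<^esub> y') - frag_of (x, y) - frag_of (x, y') | x y y'.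
       x \<in> carrier M \<and> y \<in> carrier N \<and> y' \<in> carrier N} \<union>
    {frag_of (r \<odot>\<^bsub>M\<^esub> x, y) - frag_of (x, r \<odot>\<^bsub>N\<^esub> y) | r x y.
       r \<in> carrier R \<and> x \<in> carrier M \<and> y \<in> carrier N}"

definition tensor_kernel ::
    "('r, 'c) ring_scheme \<Rightarrow> ('r, 'a) module \<Rightarrow> ('r, 'b) module \<Rightarrow> ('a \<times> 'b \<Rightarrow>\<^sub>0 int) set"
  where "tensor_kernel R M N =
    generate (free_Abelian_group (carrier M \<times> carrier N)) (tensor_relations R M N)"

text \<open>
  The tensor product \<open>M \<otimes>\<^sub>R N\<close> is taken as an abelian group (in multiplicative notation).  Its
  \<open>R\<close>-module structure is not needed: whether a map is zero only depends on the group.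
\<close>

definition tensor ::
    "('r, 'c) ring_scheme \<Rightarrow> ('r, 'a) module \<Rightarrow> ('r, 'b) module \<Rightarrow> ('a \<times> 'b \<Rightarrow>\<^sub>0 int) set monoid"
  where "tensor R M N =
    free_Abelian_group (carrier M \<times> carrier N) Mod tensor_kernel R M N"

text \<open>\<open>tensor_map R M' N' f g\<close> is the map \<open>f \<otimes> g\<close> into \<open>M' \<otimes>\<^sub>R N'\<close>.\<close>

definition tensor_map ::
    "('r, 'c) ring_scheme \<Rightarrow> ('r, 'a') module \<Rightarrow> ('r, 'b') module \<Rightarrow> ('a \<Rightarrow> 'a') \<Rightarrow> ('b \<Rightarrow> 'b') \<Rightarrow>
     ('a \<times> 'b \<Rightarrow>\<^sub>0 int) set \<Rightarrow> ('a' \<times> 'b' \<Rightarrow>\<^sub>0 int) set"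
  where "tensor_map R M' N' f g =
    coset_map (free_Abelian_group (carrier M' \<times> carrier N')) (tensor_kernel R M' N')
      (frag_extend (\<lambda>(x, y). frag_of (f x, g y)))"


section \<open>Homology and Tor\<close>

text \<open>A complex of groups \<open>C i\<close> (\<open>i \<ge> 0\<close>) with differentials \<open>d i : C (i + 1) \<rightarrow> C i\<close>.\<close>

definition cycles :: "(nat \<Rightarrow> 'a monoid) \<Rightarrow> (nat \<Rightarrow> 'a \<Rightarrow> 'a) \<Rightarrow> nat \<Rightarrow> 'a monoid"
  where "cycles C d i =
    (C i)\<lparr>carrier := (case i of 0 \<Rightarrow> carrier (C 0) | Suc j \<Rightarrow> kernel (C (Suc j)) (C j) (d j))\<rparr>"

definition boundaries :: "(nat \<Rightarrow> 'a monoid) \<Rightarrow> (nat \<Rightarrow> 'a \<Rightarrow> 'a) \<Rightarrow> nat \<Rightarrow> 'a set"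
  where "boundaries C d i = d i ` carrier (C (Suc i))"

definition homology :: "(nat \<Rightarrow> 'a monoid) \<Rightarrow> (nat \<Rightarrow> 'a \<Rightarrow> 'a) \<Rightarrow> nat \<Rightarrow> 'a set monoid"
  where "homology C d i = cycles C d i Mod boundaries C d i"

text \<open>\<open>homology_map C' d' f i\<close> is the map into \<open>H\<^sub>i(C')\<close> induced by \<open>f\<close> in degree \<open>i\<close>.\<close>

definition homology_map ::
    "(nat \<Rightarrow> 'b monoid) \<Rightarrow> (nat \<Rightarrow> 'b \<Rightarrow> 'b) \<Rightarrow> (nat \<Rightarrow> 'a \<Rightarrow> 'b) \<Rightarrow> nat \<Rightarrow> 'a set \<Rightarrow> 'b set"
  where "homology_map C' d' f i = coset_map (cycles C' d' i) (boundaries C' d' i) (f i)"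

text \<open>
  If \<open>(F, d)\<close> is a free resolution of \<open>K\<close>, then \<open>tor R F d M i\<close> is \<open>Tor\<^sub>i(K, M)\<close>, that is,
  \<open>H\<^sub>i(F \<otimes>\<^sub>R M)\<close>, and \<open>tor_map R F N \<phi> i\<close> is \<open>Tor\<^sub>i(K, \<phi>)\<close> for \<open>\<phi> : M \<rightarrow> N\<close>.
\<close>

definition tor ::
    "('r, 'c) ring_scheme \<Rightarrow> (nat \<Rightarrow> ('r, 'f) module) \<Rightarrow> (nat \<Rightarrow> 'f \<Rightarrow> 'f) \<Rightarrow> ('r, 'a) module \<Rightarrow>
     nat \<Rightarrow> ('f \<times> 'a \<Rightarrow>\<^sub>0 int) set set monoid"
  where "tor R F d M =
    homology (\<lambda>i. tensor R (F i) M) (\<lambda>i. tensor_map R (F i) M (d i) (\<lambda>x. x))"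

definition tor_map ::
    "('r, 'c) ring_scheme \<Rightarrow> (nat \<Rightarrow> ('r, 'f) module) \<Rightarrow> (nat \<Rightarrow> 'f \<Rightarrow> 'f) \<Rightarrow> ('r, 'b) module \<Rightarrow>
     ('a \<Rightarrow> 'b) \<Rightarrow> nat \<Rightarrow> ('f \<times> 'a \<Rightarrow>\<^sub>0 int) set set \<Rightarrow> ('f \<times> 'b \<Rightarrow>\<^sub>0 int) set set"
  where "tor_map R F d N \<phi> =
    homology_map (\<lambda>i. tensor R (F i) N) (\<lambda>i. tensor_map R (F i) N (d i) (\<lambda>x. x))
      (\<lambda>i. tensor_map R (F i) N (\<lambda>x. x) \<phi>)"

text \<open>
  A homomorphism \<open>\<phi> : M \<rightarrow> N\<close> is Tor-vanishing if \<open>Tor\<^sub>i(R/\<mm>, \<phi>) = 0\<close> for all \<open>i\<close>.  As Tor does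
  not depend on the chosen resolution, this is required for every free resolution of \<open>R/\<mm>\<close>.  A
  definition cannot quantify over types, so the type \<open>'f\<close> of the elements of the resolution is an
  argument; a statement proved with a type variable \<open>'f\<close> covers free resolutions on all types.
  For small types there may be no resolution; over a polynomial ring \<open>R\<close> the Koszul complex, whose
  terms are the modules \<open>R\<^sup>r\<close>, lives on the type \<open>nat \<Rightarrow> 'r\<close>.
\<close>

definition tor_vanishing ::
    "'f itself \<Rightarrow> ('r, 'c) ring_scheme \<Rightarrow> 'r set \<Rightarrow> ('r, 'a) module \<Rightarrow> ('r, 'b) module \<Rightarrow>
     ('a \<Rightarrow> 'b) \<Rightarrow> bool"
  where "tor_vanishing _ R \<mm> M N \<phi> \<longleftrightarrow> \<phi> \<in> mod_hom R M N \<and>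
    (\<forall>(F :: nat \<Rightarrow> ('r, 'f) module) d e. free_resolution R (quotient_module R \<mm>) F d e \<longrightarrow>
       (\<forall>i. trivial_homomorphism (tor R F d M i) (tor R F d N i) (tor_map R F d N \<phi> i)))"


section \<open>The standard graded polynomial ring\<close>

text \<open>
  Monomials are exponent vectors \<open>nat \<Rightarrow>\<^sub>0 nat\<close>, and a polynomial maps each monomial to its
  coefficient.  The ring \<open>k[x\<^sub>0, \<dots>, x\<^sub>n\<^sub>-\<^sub>1]\<close> consists of the polynomials in which only variables
  with index below \<open>n\<close> occur.
\<close>

definition mpoly_ring :: "nat \<Rightarrow> ((nat \<Rightarrow>\<^sub>0 nat) \<Rightarrow>\<^sub>0 'k::field) ring"
  where "mpoly_ring n =
    \<lparr>carrier = {f. \<forall>m\<in>Poly_Mapping.keys f. Poly_Mapping.keys m \<subseteq> {..<n}},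
     monoid.mult = (*), one = 1, ring.zero = 0, ring.add = (+)\<rparr>"

definition monom_poly :: "(nat \<Rightarrow>\<^sub>0 nat) \<Rightarrow> (nat \<Rightarrow>\<^sub>0 nat) \<Rightarrow>\<^sub>0 'k::field"
  where "monom_poly m = Poly_Mapping.single m 1"

definition total_degree :: "(nat \<Rightarrow>\<^sub>0 nat) \<Rightarrow> nat"
  where "total_degree m = (\<Sum>i\<in>Poly_Mapping.keys m. Poly_Mapping.lookup m i)"

definition homogeneous_poly :: "((nat \<Rightarrow>\<^sub>0 nat) \<Rightarrow>\<^sub>0 'k::field) \<Rightarrow> bool"
  where "homogeneous_poly f \<longleftrightarrow> (\<exists>d. \<forall>m\<in>Poly_Mapping.keys f. total_degree m = d)"

definition homogeneous_ideal :: "nat \<Rightarrow> ((nat \<Rightarrow>\<^sub>0 nat) \<Rightarrow>\<^sub>0 'k::field) set \<Rightarrow> bool"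
  where "homogeneous_ideal n I \<longleftrightarrow>
    (\<exists>S \<subseteq> carrier (mpoly_ring n). (\<forall>f\<in>S. homogeneous_poly f) \<and> I = Idl\<^bsub>mpoly_ring n\<^esub> S)"

definition monomial_ideal :: "nat \<Rightarrow> ((nat \<Rightarrow>\<^sub>0 nat) \<Rightarrow>\<^sub>0 'k::field) set \<Rightarrow> bool"
  where "monomial_ideal n I \<longleftrightarrow>
    (\<exists>S \<subseteq> carrier (mpoly_ring n). S \<subseteq> range monom_poly \<and> I = Idl\<^bsub>mpoly_ring n\<^esub> S)"

definition graded_max_ideal :: "nat \<Rightarrow> ((nat \<Rightarrow>\<^sub>0 nat) \<Rightarrow>\<^sub>0 'k::field) set"
  where "graded_max_ideal n =
    Idl\<^bsub>mpoly_ring n\<^esub> ((\<lambda>i. monom_poly (Poly_Mapping.single i 1)) ` {..<n})"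

text \<open>The unit of the monoid of ideals of \<open>R\<close> is \<open>R\<close> itself, so \<open>ideal_pow R J 0 = carrier R\<close>.\<close>

abbreviation ideal_pow :: "('r, 'c) ring_scheme \<Rightarrow> 'r set \<Rightarrow> nat \<Rightarrow> 'r set"
  where "ideal_pow R J a \<equiv> J [^]\<^bsub>ideals_set R\<^esub> a"

end

theory Submission
  imports Defs
begin

text \<open>
  Let \<open>A = \<mm>\<^bsup>s-t\<^esup> I\<^sup>t\<close> and \<open>B = \<mm>\<^bsup>s-t+1\<^esup> I\<^bsup>t-1\<^esup>\<close>.  On the Koszul complex of the variables,
  Koszul cycles with coefficients in \<open>A\<close> bound with coefficients in \<open>B\<close>, because there is an explicit
  contracting homotopy that differentiates the coefficients once, and one derivative of an element of
  \<open>A\<close> lies in \<open>B\<close>.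

  The homotopy is the following.  The Koszul complex is graded by multidegrees: \<open>x\<^sup>m e\<^sub>J\<close> has the
  multidegree \<open>\<alpha> = m + 1\<^sub>J\<close>, and the differential preserves it.  For one variable \<open>x\<^sub>j\<close> with \<open>\<alpha>\<^sub>j > 0\<close>,
  the map that sends \<open>x\<^sup>m e\<^sub>J\<close> to \<open>(x\<^sup>m / x\<^sub>j) e\<^sub>j \<and> e\<^sub>J\<close> if \<open>j \<notin> J\<close>, and to \<open>0\<close> if \<open>j \<in> J\<close>, is a
  contracting homotopy in multidegree \<open>\<alpha>\<close>.  So is every combination of these maps with weights
  \<open>w\<^sub>j(\<alpha>)\<close> of sum \<open>1\<close> (\<open>koszul_homotopy_identity\<close>).  Two choices of weights are used.
  In characteristic \<open>0\<close>, the weights \<open>\<alpha>\<^sub>j / |\<alpha>|\<close> give the de Rham differential, divided by the total degree: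
  on a homogeneous coefficient it is a scalar multiple of \<open>\<partial>/\<partial>x\<^sub>j\<close>.  For monomial ideals the
  weight is concentrated on the least variable of \<open>\<alpha>\<close>, and each monomial is divided by
  that variable; this works over every field and also shows that the Koszul complex is exact
  (\<open>koszul_resolution\<close>).

  Both partial derivatives and division of monomials by a variable obey enough of the Leibniz rule to
  map a product \<open>J\<^sub>1 J\<^sub>2\<close> of suitable ideals into \<open>D(J\<^sub>1) J\<^sub>2 + J\<^sub>1 D(J\<^sub>2)\<close>.  As \<open>I \<subseteq> \<mm>\<^sup>2\<close>, they map \<open>I\<close> into \<open>\<mm>\<close>, and
  induction on the exponents gives \<open>D(\<mm>\<^sup>a I\<^bsup>t+1\<^esup>) \<subseteq> \<mm>\<^bsup>a+1\<^esup> I\<^sup>t\<close> (\<open>D_mixed_pow\<close>).  The elements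
  on which \<open>D\<close> is controlled are homogeneous polynomials in the first case and monomials in the second;
  powers and products of \<open>I\<close> and \<open>\<mm>\<close> are spanned by them.

  It remains to pass from the Koszul complex to an arbitrary free resolution \<open>F\<close>.  Chain maps
  \<open>u\<close> from \<open>F\<close> to the Koszul complex and \<open>v\<close> back satisfy \<open>id = v u + d s + s d\<close>, and this identity survives
  tensoring with a module.  A cycle of \<open>F \<otimes> A\<close> therefore becomes a boundary in \<open>F \<otimes> B\<close> as soon as its
  image under \<open>u\<close> becomes a boundary in the Koszul complex with coefficients in \<open>B\<close>
  (\<open>kills_cycles_transfer\<close>).
\<close>

section \<open>Projective modules\<close>

lemma mod_homI:
  assumes "\<And>x. x \<in> carrier M \<Longrightarrow> h x \<in> carrier N"
    and "\<And>x y. x \<in> carrier M \<Longrightarrow> y \<in> carrier M \<Longrightarrow> h (x \<oplus>\<^bsub>M\<^esub> y) = h x \<oplus>\<^bsub>N\<^esub> h y"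
    and "\<And>r x. r \<in> carrier R \<Longrightarrow> x \<in> carrier M \<Longrightarrow> h (r \<odot>\<^bsub>M\<^esub> x) = r \<odot>\<^bsub>N\<^esub> h x"
  shows "h \<in> mod_hom R M N"
  using assms unfolding mod_hom_def by auto

lemma mod_homD:
  assumes "h \<in> mod_hom R M N"
  shows "\<And>x. x \<in> carrier M \<Longrightarrow> h x \<in> carrier N"
    and "\<And>x y. x \<in> carrier M \<Longrightarrow> y \<in> carrier M \<Longrightarrow> h (x \<oplus>\<^bsub>M\<^esub> y) = h x \<oplus>\<^bsub>N\<^esub> h y"
    and "\<And>r x. r \<in> carrier R \<Longrightarrow> x \<in> carrier M \<Longrightarrow> h (r \<odot>\<^bsub>M\<^esub> x) = r \<odot>\<^bsub>N\<^esub> h x"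
  using assms unfolding mod_hom_def by auto

lemma mod_hom_id: "(\<lambda>x. x) \<in> mod_hom R M M"
  by (rule mod_homI) auto

lemma mod_hom_comp:
  assumes "f \<in> mod_hom R M N" "g \<in> mod_hom R N P"
  shows "(\<lambda>x. g (f x)) \<in> mod_hom R M P"
  by (rule mod_homI) (simp_all add: mod_homD[OF assms(1)] mod_homD[OF assms(2)])

lemma mod_hom_cong:
  assumes "module R M" "f \<in> mod_hom R M N" "\<And>x. x \<in> carrier M \<Longrightarrow> f x = g x"
  shows "g \<in> mod_hom R M N"
proof -
  interpret M: module R M by fact
  note f = mod_homD[OF assms(2)]
  show ?thesis
    by (rule mod_homI) (simp_all add: f assms(3)[symmetric])
qed

lemma mod_hom_diff:
  assumes "module R N" "f \<in> mod_hom R M N" "g \<in> mod_hom R M N"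
  shows "(\<lambda>x. f x \<ominus>\<^bsub>N\<^esub> g x) \<in> mod_hom R M N"
proof -
  interpret N: module R N by fact
  show ?thesis
    by (rule mod_homI)
      (simp_all add: mod_homD[OF assms(2)] mod_homD[OF assms(3)] N.a_ac N.smult_r_distr
        a_minus_def N.smult_r_minus N.minus_add)
qed

lemma mod_hom_zero_minus:
  assumes "module R M" "module R N" "f \<in> mod_hom R M N"
  shows "f \<zero>\<^bsub>M\<^esub> = \<zero>\<^bsub>N\<^esub>"
    and "\<And>x. x \<in> carrier M \<Longrightarrow> f (\<ominus>\<^bsub>M\<^esub> x) = \<ominus>\<^bsub>N\<^esub> (f x)"
proof -
  interpret M: module R M by fact
  interpret N: module R N by fact
  note f = mod_homD[OF assms(3)]
  show "f \<zero>\<^bsub>M\<^esub> = \<zero>\<^bsub>N\<^esub>"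
    using f(3)[of "\<zero>\<^bsub>R\<^esub>" "\<zero>\<^bsub>M\<^esub>"] f(1) by simp
  show "f (\<ominus>\<^bsub>M\<^esub> x) = \<ominus>\<^bsub>N\<^esub> (f x)" if "x \<in> carrier M" for x
    using f(3)[of "\<ominus>\<^bsub>R\<^esub> \<one>\<^bsub>R\<^esub>" x] f(1) that
    by (simp add: M.smult_l_minus N.smult_l_minus)
qed

lemma mod_hom_minus_arg:
  assumes "module R M" "module R N" "f \<in> mod_hom R M N" "x \<in> carrier M" "y \<in> carrier M"
  shows "f (x \<ominus>\<^bsub>M\<^esub> y) = f x \<ominus>\<^bsub>N\<^esub> f y"
proof -
  interpret M: module R M by fact
  interpret N: module R N by fact
  show ?thesis
    using assms(4,5) mod_homD[OF assms(3)] mod_hom_zero_minus[OF assms(1-3)]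
    by (simp add: a_minus_def)
qed

definition lincomb :: "('r, 'c) ring_scheme \<Rightarrow> ('r, 'a, 'm) module_scheme \<Rightarrow> 'i set \<Rightarrow> ('i \<Rightarrow> 'a) \<Rightarrow> ('i \<Rightarrow> 'r) \<Rightarrow> 'a"
  where "lincomb R M B b k = (\<Oplus>\<^bsub>M\<^esub>i\<in>{i \<in> B. k i \<noteq> \<zero>\<^bsub>R\<^esub>}. k i \<odot>\<^bsub>M\<^esub> b i)"

context module
begin

lemma lincomb_superset:
  assumes "finite S" "{i \<in> B. k i \<noteq> \<zero>} \<subseteq> S" "S \<subseteq> B" "k \<in> B \<rightarrow> carrier R" "b \<in> B \<rightarrow> carrier M"
  shows "lincomb R M B b k = (\<Oplus>\<^bsub>M\<^esub>i\<in>S. k i \<odot>\<^bsub>M\<^esub> b i)"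
  unfolding lincomb_def
proof (rule M.add.finprod_mono_neutral_cong_left)
  show "k i \<odot>\<^bsub>M\<^esub> b i = \<zero>\<^bsub>M\<^esub>" if "i \<in> S - {i \<in> B. k i \<noteq> \<zero>}" for i
    using that assms by (auto simp: Pi_def subset_iff)
qed (use assms in \<open>auto simp: Pi_def subset_iff\<close>)

lemma lincomb_closed:
  assumes "k \<in> B \<rightarrow> carrier R" "b \<in> B \<rightarrow> carrier M"
  shows "lincomb R M B b k \<in> carrier M"
  unfolding lincomb_def using assms by (auto intro!: M.finsum_closed)

lemma lincomb_add:
  assumes "k \<in> B \<rightarrow> carrier R" "k' \<in> B \<rightarrow> carrier R" "b \<in> B \<rightarrow> carrier M"
    and fin: "finite {i \<in> B. k i \<noteq> \<zero>}" "finite {i \<in> B. k' i \<noteq> \<zero>}"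
    and eq: "\<And>i. i \<in> B \<Longrightarrow> l i = k i \<oplus> k' i"
  shows "lincomb R M B b l = lincomb R M B b k \<oplus>\<^bsub>M\<^esub> lincomb R M B b k'"
proof -
  define S where "S = {i \<in> B. k i \<noteq> \<zero>} \<union> {i \<in> B. k' i \<noteq> \<zero>}"
  have S: "finite S" "S \<subseteq> B" "{i \<in> B. k i \<noteq> \<zero>} \<subseteq> S" "{i \<in> B. k' i \<noteq> \<zero>} \<subseteq> S"
    using fin by (auto simp: S_def)
  have mem: "k i \<in> carrier R" "k' i \<in> carrier R" "b i \<in> carrier M" "l i = k i \<oplus> k' i" if "i \<in> S" for i
    using that S(2) assms(1-3) eq by blast+
  have "{i \<in> B. l i \<noteq> \<zero>} \<subseteq> S"
    using eq by (auto simp: S_def)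
  moreover have "l \<in> B \<rightarrow> carrier R"
    using assms by (auto simp: Pi_def)
  ultimately have "lincomb R M B b l = (\<Oplus>\<^bsub>M\<^esub>i\<in>S. l i \<odot>\<^bsub>M\<^esub> b i)"
    using S assms by (intro lincomb_superset)
  also have "\<dots> = (\<Oplus>\<^bsub>M\<^esub>i\<in>S. k i \<odot>\<^bsub>M\<^esub> b i \<oplus>\<^bsub>M\<^esub> k' i \<odot>\<^bsub>M\<^esub> b i)"
    by (rule M.finsum_cong') (simp_all add: mem smult_l_distr)
  also have "\<dots> = (\<Oplus>\<^bsub>M\<^esub>i\<in>S. k i \<odot>\<^bsub>M\<^esub> b i) \<oplus>\<^bsub>M\<^esub> (\<Oplus>\<^bsub>M\<^esub>i\<in>S. k' i \<odot>\<^bsub>M\<^esub> b i)"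
    by (rule M.finsum_addf) (simp_all add: mem)
  also have "(\<Oplus>\<^bsub>M\<^esub>i\<in>S. k i \<odot>\<^bsub>M\<^esub> b i) = lincomb R M B b k"
    using S assms by (intro lincomb_superset[symmetric])
  also have "(\<Oplus>\<^bsub>M\<^esub>i\<in>S. k' i \<odot>\<^bsub>M\<^esub> b i) = lincomb R M B b k'"
    using S assms by (intro lincomb_superset[symmetric])
  finally show ?thesis .
qed

lemma lincomb_smult:
  assumes "k \<in> B \<rightarrow> carrier R" "b \<in> B \<rightarrow> carrier M" "r \<in> carrier R"
    and fin: "finite {i \<in> B. k i \<noteq> \<zero>}"
    and eq: "\<And>i. i \<in> B \<Longrightarrow> l i = r \<otimes> k i"
  shows "lincomb R M B b l = r \<odot>\<^bsub>M\<^esub> lincomb R M B b k"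
proof -
  define S where "S = {i \<in> B. k i \<noteq> \<zero>}"
  have S: "finite S" "S \<subseteq> B" "{i \<in> B. k i \<noteq> \<zero>} \<subseteq> S"
    using fin by (auto simp: S_def)
  have mem: "k i \<in> carrier R" "b i \<in> carrier M" "l i = r \<otimes> k i" if "i \<in> S" for i
    using that S(2) assms(1-2) eq by blast+
  note [simp] = assms(3)
  have "{i \<in> B. l i \<noteq> \<zero>} \<subseteq> S"
    using eq assms(3) by (auto simp: S_def)
  moreover have "l \<in> B \<rightarrow> carrier R"
    using assms by (auto simp: Pi_def)
  ultimately have "lincomb R M B b l = (\<Oplus>\<^bsub>M\<^esub>i\<in>S. l i \<odot>\<^bsub>M\<^esub> b i)"
    using S assms by (intro lincomb_superset)
  also have "\<dots> = (\<Oplus>\<^bsub>M\<^esub>i\<in>S. r \<odot>\<^bsub>M\<^esub> (k i \<odot>\<^bsub>M\<^esub> b i))"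
    by (rule M.finsum_cong') (simp_all add: mem smult_assoc1)
  also have "\<dots> = r \<odot>\<^bsub>M\<^esub> (\<Oplus>\<^bsub>M\<^esub>i\<in>S. k i \<odot>\<^bsub>M\<^esub> b i)"
    by (rule finsum_smult_ldistr[symmetric]) (simp_all add: mem S(1))
  also have "(\<Oplus>\<^bsub>M\<^esub>i\<in>S. k i \<odot>\<^bsub>M\<^esub> b i) = lincomb R M B b k"
    using S assms by (intro lincomb_superset[symmetric])
  finally show ?thesis .
qed

end

lemma mod_hom_lincomb:
  assumes "module R M" "module R N" "f \<in> mod_hom R M N"
    and "k \<in> B \<rightarrow> carrier R" "b \<in> B \<rightarrow> carrier M" "finite {i \<in> B. k i \<noteq> \<zero>\<^bsub>R\<^esub>}"
  shows "f (lincomb R M B b k) = lincomb R N B (\<lambda>i. f (b i)) k"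
proof -
  interpret M: module R M by fact
  interpret N: module R N by fact
  note f = mod_homD[OF assms(3)]
  have "f (\<Oplus>\<^bsub>M\<^esub>i\<in>S. k i \<odot>\<^bsub>M\<^esub> b i) = (\<Oplus>\<^bsub>N\<^esub>i\<in>S. k i \<odot>\<^bsub>N\<^esub> f (b i))"
    if "finite S" "S \<subseteq> B" for S
    using that
  proof (induction S)
    case empty
    then show ?case by (simp add: mod_hom_zero_minus[OF assms(1-3)])
  next
    case (insert i S)
    have kb: "\<And>i. i \<in> B \<Longrightarrow> k i \<in> carrier R" "\<And>i. i \<in> B \<Longrightarrow> b i \<in> carrier M"
      using assms by auto
    with insert.prems have *: "i \<in> B" "\<And>j. j \<in> S \<Longrightarrow> j \<in> B" by auto
    show ?case
      using insert * kb
      by (simp add: f Pi_def)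
  qed
  then show ?thesis
    using assms(6) unfolding lincomb_def by auto
qed

text \<open>
  The dual basis criterion for projectivity: \<open>c x i\<close> is the \<open>i\<close>-th coordinate of \<open>x\<close>, linear in \<open>x\<close>, and
  \<open>x\<close> is the finite combination of the \<open>b i\<close> with these coefficients.  Coordinates may be
  non-unique.  Lifting a map through a surjection needs no more than this, and both an abstract free
  module and the Koszul terms supply it.
\<close>

definition dual_basis ::
    "('r, 'c) ring_scheme \<Rightarrow> ('r, 'a) module \<Rightarrow> 'i set \<Rightarrow> ('i \<Rightarrow> 'a) \<Rightarrow> ('a \<Rightarrow> 'i \<Rightarrow> 'r) \<Rightarrow> bool"
  where "dual_basis R P B b c \<longleftrightarrow> b \<in> B \<rightarrow> carrier P \<and>
    (\<forall>x\<in>carrier P. c x \<in> B \<rightarrow> carrier R \<and> finite {i \<in> B. c x i \<noteq> \<zero>\<^bsub>R\<^esub>} \<and>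
       lincomb R P B b (c x) = x) \<and>
    (\<forall>x\<in>carrier P. \<forall>y\<in>carrier P. \<forall>i\<in>B. c (x \<oplus>\<^bsub>P\<^esub> y) i = c x i \<oplus>\<^bsub>R\<^esub> c y i) \<and>
    (\<forall>r\<in>carrier R. \<forall>x\<in>carrier P. \<forall>i\<in>B. c (r \<odot>\<^bsub>P\<^esub> x) i = r \<otimes>\<^bsub>R\<^esub> c x i)"

text \<open>
  The type of the index set is an argument, as a definition cannot quantify over types.
\<close>

definition projective_module :: "'i itself \<Rightarrow> ('r, 'c) ring_scheme \<Rightarrow> ('r, 'a) module \<Rightarrow> bool"
  where "projective_module _ R P \<longleftrightarrow> module R P \<and> (\<exists>(B :: 'i set) b c. dual_basis R P B b c)"

text \<open>
  Lift the images of the \<open>b i\<close>, and extend by the linear coordinates.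
\<close>

lemma projective_lift:
  assumes P: "projective_module TYPE('i) R P" and A: "module R A" and Q: "module R Q"
    and p: "p \<in> mod_hom R A Q" and g: "g \<in> mod_hom R P Q"
    and im: "\<And>x. x \<in> carrier P \<Longrightarrow> g x \<in> p ` carrier A"
  shows "\<exists>h\<in>mod_hom R P A. \<forall>x\<in>carrier P. p (h x) = g x"
proof -
  obtain B :: "'i set" and b c where db: "dual_basis R P B b c" and P: "module R P"
    using P unfolding projective_module_def by blast
  have b: "b \<in> B \<rightarrow> carrier P"
    and c: "\<And>x. x \<in> carrier P \<Longrightarrow> c x \<in> B \<rightarrow> carrier R"
      "\<And>x. x \<in> carrier P \<Longrightarrow> finite {i \<in> B. c x i \<noteq> \<zero>\<^bsub>R\<^esub>}"
      "\<And>x. x \<in> carrier P \<Longrightarrow> lincomb R P B b (c x) = x"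
    and cadd: "\<And>x y i. x \<in> carrier P \<Longrightarrow> y \<in> carrier P \<Longrightarrow> i \<in> B \<Longrightarrow> c (x \<oplus>\<^bsub>P\<^esub> y) i = c x i \<oplus>\<^bsub>R\<^esub> c y i"
    and csm: "\<And>r x i. r \<in> carrier R \<Longrightarrow> x \<in> carrier P \<Longrightarrow> i \<in> B \<Longrightarrow> c (r \<odot>\<^bsub>P\<^esub> x) i = r \<otimes>\<^bsub>R\<^esub> c x i"
    using db unfolding dual_basis_def by auto
  have "\<exists>a\<in>carrier A. p a = g (b i)" if "i \<in> B" for i
    using im[of "b i"] b that by (auto simp: Pi_def image_iff)
  then obtain w where w: "\<And>i. i \<in> B \<Longrightarrow> w i \<in> carrier A" "\<And>i. i \<in> B \<Longrightarrow> p (w i) = g (b i)"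
    by metis
  then have w': "w \<in> B \<rightarrow> carrier A" by auto
  interpret A: module R A by fact
  define h where "h x = lincomb R A B w (c x)" for x
  have "h \<in> mod_hom R P A"
  proof (rule mod_homI)
    show "h x \<in> carrier A" if "x \<in> carrier P" for x
      unfolding h_def using A.lincomb_closed[OF c(1)[OF that] w'] .
    show "h (x \<oplus>\<^bsub>P\<^esub> y) = h x \<oplus>\<^bsub>A\<^esub> h y" if "x \<in> carrier P" "y \<in> carrier P" for x y
      unfolding h_def using that c cadd w' by (intro A.lincomb_add) auto
    show "h (r \<odot>\<^bsub>P\<^esub> x) = r \<odot>\<^bsub>A\<^esub> h x" if "r \<in> carrier R" "x \<in> carrier P" for r x
      unfolding h_def using that c csm w' by (intro A.lincomb_smult) auto
  qed
  moreover have "p (h x) = g x" if x: "x \<in> carrier P" for x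
  proof -
    have "p (h x) = lincomb R Q B (\<lambda>i. p (w i)) (c x)"
      unfolding h_def using c[OF x] w' by (intro mod_hom_lincomb[OF A Q p]) auto
    also have "\<dots> = lincomb R Q B (\<lambda>i. g (b i)) (c x)"
    proof -
      interpret Q: module R Q by fact
      show ?thesis
        unfolding lincomb_def using c[OF x] b w mod_homD(1)[OF g]
        by (intro Q.M.finsum_cong') (auto simp: Pi_def)
    qed
    also have "\<dots> = g (lincomb R P B b (c x))"
      using c[OF x] b by (intro mod_hom_lincomb[OF P Q g, symmetric]) auto
    finally show ?thesis using c(3)[OF x] by simp
  qed
  ultimately show ?thesis by blast
qed

text \<open>
  Uniqueness of the coefficients in a basis makes them additive and homogeneous in \<open>x\<close>.
\<close>

lemma free_imp_projective:
  fixes P :: "('r, 'a) module"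
  assumes "free_module R P"
  shows "projective_module TYPE('a) R P"
proof -
  obtain B where P: "module R P" and B: "module_basis R P B"
    using assms unfolding free_module_def by blast
  interpret P: module R P by fact
  have sub: "B \<subseteq> carrier P" using B unfolding module_basis_def by blast
  then have id: "id \<in> B \<rightarrow> carrier P" by auto
  define good where "good x c \<longleftrightarrow> c \<in> (B \<rightarrow>\<^sub>E carrier R) \<and> finite {b \<in> B. c b \<noteq> \<zero>\<^bsub>R\<^esub>} \<and>
       lincomb R P B id c = x" for x c
  have ex1: "\<exists>!c. good x c" if "x \<in> carrier P" for x
    using B that unfolding module_basis_def good_def lincomb_def by (simp add: eq_commute)
  define c where "c x = (THE c. good x c)" for x
  have c: "good x (c x)" if "x \<in> carrier P" for x
    using theI'[OF ex1[OF that]] by (simp add: c_def)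
  have uniq: "c x = k" if "x \<in> carrier P" "good x k" for x k
    using ex1 c that by metis
  have "dual_basis R P B id c"
    unfolding dual_basis_def
  proof (intro conjI ballI)
    show "id \<in> B \<rightarrow> carrier P" by fact
  next
    fix x assume "x \<in> carrier P"
    from c[OF this] show "c x \<in> B \<rightarrow> carrier R" "finite {i \<in> B. c x i \<noteq> \<zero>\<^bsub>R\<^esub>}"
      "lincomb R P B id (c x) = x"
      unfolding good_def by auto
  next
    fix x y i assume xy: "x \<in> carrier P" "y \<in> carrier P" and i: "i \<in> B"
    let ?k = "\<lambda>i\<in>B. c x i \<oplus>\<^bsub>R\<^esub> c y i"
    have cx: "c x \<in> B \<rightarrow> carrier R" "finite {i \<in> B. c x i \<noteq> \<zero>\<^bsub>R\<^esub>}" "lincomb R P B id (c x) = x"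
      and cy: "c y \<in> B \<rightarrow> carrier R" "finite {i \<in> B. c y i \<noteq> \<zero>\<^bsub>R\<^esub>}" "lincomb R P B id (c y) = y"
      using c xy unfolding good_def by auto
    have "good (x \<oplus>\<^bsub>P\<^esub> y) ?k"
      unfolding good_def
    proof (intro conjI)
      show "?k \<in> B \<rightarrow>\<^sub>E carrier R" using cx cy by auto
      have "{i \<in> B. ?k i \<noteq> \<zero>\<^bsub>R\<^esub>} \<subseteq> {i \<in> B. c x i \<noteq> \<zero>\<^bsub>R\<^esub>} \<union> {i \<in> B. c y i \<noteq> \<zero>\<^bsub>R\<^esub>}"
        by auto
      then show "finite {i \<in> B. ?k i \<noteq> \<zero>\<^bsub>R\<^esub>}"
        using cx cy by (meson finite_UnI finite_subset)
      have "lincomb R P B id ?k = lincomb R P B id (c x) \<oplus>\<^bsub>P\<^esub> lincomb R P B id (c y)"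
        using cx cy id by (intro P.lincomb_add) auto
      then show "lincomb R P B id ?k = x \<oplus>\<^bsub>P\<^esub> y" using cx(3) cy(3) by simp
    qed
    then have "c (x \<oplus>\<^bsub>P\<^esub> y) = ?k" using uniq xy by simp
    then show "c (x \<oplus>\<^bsub>P\<^esub> y) i = c x i \<oplus>\<^bsub>R\<^esub> c y i" using i by simp
  next
    fix r x i assume r: "r \<in> carrier R" and x: "x \<in> carrier P" and i: "i \<in> B"
    let ?k = "\<lambda>i\<in>B. r \<otimes>\<^bsub>R\<^esub> c x i"
    have cx: "c x \<in> B \<rightarrow> carrier R" "finite {i \<in> B. c x i \<noteq> \<zero>\<^bsub>R\<^esub>}" "lincomb R P B id (c x) = x"
      using c x unfolding good_def by auto
    have "good (r \<odot>\<^bsub>P\<^esub> x) ?k"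
      unfolding good_def
    proof (intro conjI)
      show "?k \<in> B \<rightarrow>\<^sub>E carrier R" using cx r by auto
      have "{i \<in> B. ?k i \<noteq> \<zero>\<^bsub>R\<^esub>} \<subseteq> {i \<in> B. c x i \<noteq> \<zero>\<^bsub>R\<^esub>}"
        using r by auto
      then show "finite {i \<in> B. ?k i \<noteq> \<zero>\<^bsub>R\<^esub>}"
        using cx by (meson finite_subset)
      have "lincomb R P B id ?k = r \<odot>\<^bsub>P\<^esub> lincomb R P B id (c x)"
        using cx id r by (intro P.lincomb_smult) auto
      then show "lincomb R P B id ?k = r \<odot>\<^bsub>P\<^esub> x" using cx(3) by simp
    qed
    then have "c (r \<odot>\<^bsub>P\<^esub> x) = ?k" using uniq x r by simp
    then show "c (r \<odot>\<^bsub>P\<^esub> x) i = r \<otimes>\<^bsub>R\<^esub> c x i" using i by simp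
  qed
  then show ?thesis
    using P unfolding projective_module_def by blast
qed

section \<open>Comparison of resolutions\<close>

text \<open>
  The augmentation plays the role of a differential in degree \<open>-1\<close>, so that exactness reads the same
  in all degrees.
\<close>

definition augmented_cycles ::
    "('r, 'a) module \<Rightarrow> (nat \<Rightarrow> ('r, 'f) module) \<Rightarrow> (nat \<Rightarrow> 'f \<Rightarrow> 'f) \<Rightarrow> ('f \<Rightarrow> 'a) \<Rightarrow> nat \<Rightarrow> 'f set"
  where "augmented_cycles K F d e i =
    (case i of 0 \<Rightarrow> a_kernel (F 0) K e | Suc j \<Rightarrow> a_kernel (F (Suc j)) (F j) (d j))"

locale augmented_complex =
  fixes R :: "('r, 'c) ring_scheme" and K :: "('r, 'a) module"
    and F :: "nat \<Rightarrow> ('r, 'f) module" and d :: "nat \<Rightarrow> 'f \<Rightarrow> 'f" and e :: "'f \<Rightarrow> 'a"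
  assumes module_target: "module R K"
    and module_term: "\<And>i. module R (F i)"
    and diff_hom: "\<And>i. d i \<in> mod_hom R (F (Suc i)) (F i)"
    and aug_hom: "e \<in> mod_hom R (F 0) K"
    and diff_cycle: "\<And>i x. x \<in> carrier (F (Suc i)) \<Longrightarrow> d i x \<in> augmented_cycles K F d e i"
begin

lemma cycles_0: "augmented_cycles K F d e 0 = {x \<in> carrier (F 0). e x = \<zero>\<^bsub>K\<^esub>}"
  by (simp add: augmented_cycles_def a_kernel_def')

lemma cycles_Suc:
  "augmented_cycles K F d e (Suc i) = {x \<in> carrier (F (Suc i)). d i x = \<zero>\<^bsub>F i\<^esub>}"
  by (simp add: augmented_cycles_def a_kernel_def')

lemma cycles_carrier: "x \<in> augmented_cycles K F d e i \<Longrightarrow> x \<in> carrier (F i)"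
  by (cases i) (auto simp: cycles_0 cycles_Suc)

lemma diff_diff: "x \<in> carrier (F (Suc (Suc i))) \<Longrightarrow> d i (d (Suc i) x) = \<zero>\<^bsub>F i\<^esub>"
  using diff_cycle[of x "Suc i"] by (simp add: cycles_Suc)

end

locale resolution = augmented_complex +
  assumes aug_surj: "carrier K \<subseteq> e ` carrier (F 0)"
    and exact: "\<And>i. augmented_cycles K F d e i \<subseteq> d i ` carrier (F (Suc i))"

lemma free_resolution_imp_resolution:
  assumes "free_resolution R K F d e" "module R K"
  shows "resolution R K F d e"
proof -
  have cyc: "d i ` carrier (F (Suc i)) = augmented_cycles K F d e i" for i
    using assms(1) unfolding free_resolution_def augmented_cycles_def by (cases i) auto
  show ?thesis
  proof (intro resolution.intro augmented_complex.intro resolution_axioms.intro)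
    show "module R (F i)" for i
      using assms(1) unfolding free_resolution_def free_module_def by blast
    show "d i \<in> mod_hom R (F (Suc i)) (F i)" for i
      using assms(1) unfolding free_resolution_def by blast
    show "e \<in> mod_hom R (F 0) K"
      using assms(1) unfolding free_resolution_def by blast
    show "carrier K \<subseteq> e ` carrier (F 0)"
      using assms(1) unfolding free_resolution_def by blast
    show "d i x \<in> augmented_cycles K F d e i" if "x \<in> carrier (F (Suc i))" for i x
      using cyc that by blast
    show "augmented_cycles K F d e i \<subseteq> d i ` carrier (F (Suc i))" for i
      using cyc by blast
  qed fact
qed

text \<open>
  The maps are lifted degree by degree.  The induction carries along that \<open>u i\<close> maps cycles to cycles,
  which places \<open>u i \<circ> d\<close> inside the image of the next differential.
\<close>

lemma comparison_map:
  fixes P :: "nat \<Rightarrow> ('r, 'p) module" and Q :: "nat \<Rightarrow> ('r, 'q) module"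
  assumes "augmented_complex R K P dP eP" "resolution R K Q dQ eQ"
    and proj: "\<And>i. projective_module TYPE('i) R (P i)"
  shows "\<exists>u. (\<forall>i. u i \<in> mod_hom R (P i) (Q i)) \<and> (\<forall>x\<in>carrier (P 0). eQ (u 0 x) = eP x) \<and>
    (\<forall>i. \<forall>x\<in>carrier (P (Suc i)). dQ i (u (Suc i) x) = u i (dP i x))"
proof -
  interpret P: augmented_complex R K P dP eP by fact
  interpret Q: resolution R K Q dQ eQ by fact
  let ?ZP = "augmented_cycles K P dP eP" and ?ZQ = "augmented_cycles K Q dQ eQ"
  define good where "good n f \<longleftrightarrow> f \<in> mod_hom R (P n) (Q n) \<and> (\<forall>x\<in>?ZP n. f x \<in> ?ZQ n) \<and>
    (n = 0 \<longrightarrow> (\<forall>x\<in>carrier (P 0). eQ (f x) = eP x))" for n f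
  have "\<exists>u. \<forall>n. good n (u n) \<and> (\<forall>x\<in>carrier (P (Suc n)). dQ n (u (Suc n) x) = u n (dP n x))"
  proof (rule dependent_nat_choice)
    have "\<exists>h\<in>mod_hom R (P 0) (Q 0). \<forall>x\<in>carrier (P 0). eQ (h x) = eP x"
      by (rule projective_lift[OF proj Q.module_term Q.module_target Q.aug_hom P.aug_hom])
        (use Q.aug_surj mod_homD(1)[OF P.aug_hom] in auto)
    then obtain h where h: "h \<in> mod_hom R (P 0) (Q 0)" "\<And>x. x \<in> carrier (P 0) \<Longrightarrow> eQ (h x) = eP x"
      by blast
    then have "good 0 h"
      using mod_homD(1)[OF h(1)] by (auto simp: good_def P.cycles_0 Q.cycles_0)
    then show "\<exists>f. good 0 f" by blast
  next
    fix f n assume "good n f"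
    then have f: "f \<in> mod_hom R (P n) (Q n)" and fZ: "\<And>x. x \<in> ?ZP n \<Longrightarrow> f x \<in> ?ZQ n"
      by (auto simp: good_def)
    have "\<exists>h\<in>mod_hom R (P (Suc n)) (Q (Suc n)). \<forall>x\<in>carrier (P (Suc n)). dQ n (h x) = f (dP n x)"
      by (rule projective_lift[OF proj Q.module_term Q.module_term Q.diff_hom mod_hom_comp[OF P.diff_hom f]])
        (use Q.exact P.diff_cycle fZ in blast)
    then obtain h where h: "h \<in> mod_hom R (P (Suc n)) (Q (Suc n))"
      "\<And>x. x \<in> carrier (P (Suc n)) \<Longrightarrow> dQ n (h x) = f (dP n x)"
      by blast
    have "f \<zero>\<^bsub>P n\<^esub> = \<zero>\<^bsub>Q n\<^esub>"
      by (rule mod_hom_zero_minus[OF P.module_term Q.module_term f])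
    then have "good (Suc n) h"
      using h mod_homD(1)[OF h(1)] by (auto simp: good_def P.cycles_Suc Q.cycles_Suc)
    with h show "\<exists>g. good (Suc n) g \<and> (\<forall>x\<in>carrier (P (Suc n)). dQ n (g x) = f (dP n x))"
      by blast
  qed
  then obtain u where u: "\<And>n. good n (u n)"
    "\<And>n. \<forall>x\<in>carrier (P (Suc n)). dQ n (u (Suc n) x) = u n (dP n x)"
    by metis
  from u(1) u(1)[of 0] have "\<And>n. u n \<in> mod_hom R (P n) (Q n)" "\<forall>x\<in>carrier (P 0). eQ (u 0 x) = eP x"
    unfolding good_def by simp_all
  with u(2) show ?thesis by (intro exI[of _ u]) simp
qed

text \<open>
  A chain endomorphism over the zero map of \<open>K\<close> is homotopic to zero.  The induction carries along that
  \<open>d \<circ> s i\<close> agrees with \<open>g i\<close> on cycles; this makes \<open>g - s \<circ> d\<close> take values in cycles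
  one degree higher.
\<close>

lemma null_homotopy:
  fixes F :: "nat \<Rightarrow> ('r, 'f) module"
  assumes "resolution R K F d e"
    and proj: "\<And>i. projective_module TYPE('i) R (F i)"
    and g: "\<And>i. g i \<in> mod_hom R (F i) (F i)"
    and g0: "\<And>x. x \<in> carrier (F 0) \<Longrightarrow> e (g 0 x) = \<zero>\<^bsub>K\<^esub>"
    and gd: "\<And>i x. x \<in> carrier (F (Suc i)) \<Longrightarrow> d i (g (Suc i) x) = g i (d i x)"
  shows "\<exists>s. (\<forall>i. s i \<in> mod_hom R (F i) (F (Suc i))) \<and> (\<forall>x\<in>carrier (F 0). d 0 (s 0 x) = g 0 x) \<and>
    (\<forall>i. \<forall>x\<in>carrier (F (Suc i)). d (Suc i) (s (Suc i) x) \<oplus>\<^bsub>F (Suc i)\<^esub> s i (d i x) = g (Suc i) x)"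
proof -
  interpret F: resolution R K F d e by fact
  let ?Z = "augmented_cycles K F d e"
  define good where "good n f \<longleftrightarrow> f \<in> mod_hom R (F n) (F (Suc n)) \<and> (\<forall>x\<in>?Z n. d n (f x) = g n x) \<and>
    (n = 0 \<longrightarrow> (\<forall>x\<in>carrier (F 0). d 0 (f x) = g 0 x))" for n f
  have "\<exists>s. \<forall>n. good n (s n) \<and>
    (\<forall>x\<in>carrier (F (Suc n)). d (Suc n) (s (Suc n) x) \<oplus>\<^bsub>F (Suc n)\<^esub> s n (d n x) = g (Suc n) x)"
  proof (rule dependent_nat_choice)
    have "\<exists>h\<in>mod_hom R (F 0) (F (Suc 0)). \<forall>x\<in>carrier (F 0). d 0 (h x) = g 0 x"
    proof (rule projective_lift[OF proj F.module_term F.module_term F.diff_hom g])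
      fix x assume "x \<in> carrier (F 0)"
      then have "g 0 x \<in> ?Z 0" using g0 mod_homD(1)[OF g] by (simp add: F.cycles_0)
      then show "g 0 x \<in> d 0 ` carrier (F (Suc 0))" using F.exact by blast
    qed
    then obtain h where h: "h \<in> mod_hom R (F 0) (F (Suc 0))" "\<And>x. x \<in> carrier (F 0) \<Longrightarrow> d 0 (h x) = g 0 x"
      by blast
    then have "good 0 h"
      by (auto simp: good_def F.cycles_0)
    then show "\<exists>f. good 0 f" by blast
  next
    fix f n assume "good n f"
    then have f: "f \<in> mod_hom R (F n) (F (Suc n))" and fZ: "\<And>x. x \<in> ?Z n \<Longrightarrow> d n (f x) = g n x"
      by (auto simp: good_def)
    interpret F0: module R "F n" by (rule F.module_term)
    interpret F1: module R "F (Suc n)" by (rule F.module_term)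
    let ?k = "\<lambda>x. g (Suc n) x \<ominus>\<^bsub>F (Suc n)\<^esub> f (d n x)"
    have fd: "(\<lambda>x. f (d n x)) \<in> mod_hom R (F (Suc n)) (F (Suc n))"
      by (rule mod_hom_comp[OF F.diff_hom f])
    have k: "?k \<in> mod_hom R (F (Suc n)) (F (Suc n))"
      by (rule mod_hom_diff[OF F.module_term g fd])
    have "\<exists>h\<in>mod_hom R (F (Suc n)) (F (Suc (Suc n))). \<forall>x\<in>carrier (F (Suc n)). d (Suc n) (h x) = ?k x"
    proof (rule projective_lift[OF proj F.module_term F.module_term F.diff_hom k])
      fix x assume x: "x \<in> carrier (F (Suc n))"
      have "d n (?k x) = d n (g (Suc n) x) \<ominus>\<^bsub>F n\<^esub> d n (f (d n x))"
        using mod_homD(1)[OF g x] mod_homD(1)[OF fd x]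
        by (rule mod_hom_minus_arg[OF F.module_term F.module_term F.diff_hom])
      also have "\<dots> = \<zero>\<^bsub>F n\<^esub>"
        using x fZ[OF F.diff_cycle[OF x]] gd[OF x] mod_homD(1)[OF g] mod_homD(1)[OF F.diff_hom x]
        by (simp add: a_minus_def F0.r_neg)
      finally have "?k x \<in> ?Z (Suc n)"
        using mod_homD(1)[OF k x] by (simp add: F.cycles_Suc)
      then show "?k x \<in> d (Suc n) ` carrier (F (Suc (Suc n)))" using F.exact by blast
    qed
    then obtain h where h: "h \<in> mod_hom R (F (Suc n)) (F (Suc (Suc n)))"
      "\<And>x. x \<in> carrier (F (Suc n)) \<Longrightarrow> d (Suc n) (h x) = ?k x"
      by blast
    have f0: "f \<zero>\<^bsub>F n\<^esub> = \<zero>\<^bsub>F (Suc n)\<^esub>"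
      by (rule mod_hom_zero_minus[OF F.module_term F.module_term f])
    have "good (Suc n) h"
      using h mod_homD(1)[OF g] by (auto simp: good_def F.cycles_Suc f0 a_minus_def)
    moreover have "d (Suc n) (h x) \<oplus>\<^bsub>F (Suc n)\<^esub> f (d n x) = g (Suc n) x"
      if x: "x \<in> carrier (F (Suc n))" for x
      using h(2)[OF x] mod_homD(1)[OF g x] mod_homD(1)[OF fd x]
      by (simp add: a_minus_def F1.a_assoc F1.l_neg)
    ultimately show "\<exists>h. good (Suc n) h \<and>
      (\<forall>x\<in>carrier (F (Suc n)). d (Suc n) (h x) \<oplus>\<^bsub>F (Suc n)\<^esub> f (d n x) = g (Suc n) x)"
      by blast
  qed
  then obtain s where s: "\<And>n. good n (s n)"
    "\<And>n. \<forall>x\<in>carrier (F (Suc n)). d (Suc n) (s (Suc n) x) \<oplus>\<^bsub>F (Suc n)\<^esub> s n (d n x) = g (Suc n) x"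
    by metis
  from s(1) s(1)[of 0] have "\<And>n. s n \<in> mod_hom R (F n) (F (Suc n))" "\<forall>x\<in>carrier (F 0). d 0 (s 0 x) = g 0 x"
    unfolding good_def by simp_all
  with s(2) show ?thesis by (intro exI[of _ s]) simp
qed

section \<open>Tensor products and their functoriality\<close>

text \<open>
  On cosets, \<open>coset_map\<close> is the usual induced map of quotient groups.
\<close>

lemma coset_map_rcoset:
  assumes "group G" "group G'" "subgroup H G" "subgroup H' G'"
    and f: "f \<in> hom G G'" and fH: "f ` H \<subseteq> H'" and c: "c \<in> carrier G"
  shows "coset_map G' H' f (H #>\<^bsub>G\<^esub> c) = H' #>\<^bsub>G'\<^esub> f c"
proof -
  interpret G: group G by fact
  interpret G': group G' by fact
  interpret H: subgroup H G by fact
  interpret H': subgroup H' G' by fact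
  have mult: "f (h \<otimes>\<^bsub>G\<^esub> c) = f h \<otimes>\<^bsub>G'\<^esub> f c" if "h \<in> H" for h
    using f c that by (simp add: hom_mult)
  have fc: "f c \<in> carrier G'" using f c by (rule hom_in_carrier)
  show ?thesis
  proof (intro equalityI subsetI)
    fix z assume "z \<in> coset_map G' H' f (H #>\<^bsub>G\<^esub> c)"
    then obtain h' h where h: "h' \<in> H'" "h \<in> H" "z = h' \<otimes>\<^bsub>G'\<^esub> f (h \<otimes>\<^bsub>G\<^esub> c)"
      unfolding coset_map_def set_mult_def r_coset_def by blast
    have "f h \<in> H'" using fH h by blast
    then have "z = (h' \<otimes>\<^bsub>G'\<^esub> f h) \<otimes>\<^bsub>G'\<^esub> f c" "h' \<otimes>\<^bsub>G'\<^esub> f h \<in> H'"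
      using h fc mult by (simp_all add: G'.m_assoc)
    then show "z \<in> H' #>\<^bsub>G'\<^esub> f c" unfolding r_coset_def by blast
  next
    fix z assume "z \<in> H' #>\<^bsub>G'\<^esub> f c"
    then obtain h' where h: "h' \<in> H'" "z = h' \<otimes>\<^bsub>G'\<^esub> f c"
      unfolding r_coset_def by blast
    have "z = h' \<otimes>\<^bsub>G'\<^esub> f (\<one>\<^bsub>G\<^esub> \<otimes>\<^bsub>G\<^esub> c)" using h c by simp
    then show "z \<in> coset_map G' H' f (H #>\<^bsub>G\<^esub> c)"
      using h(1) H.one_closed unfolding coset_map_def set_mult_def r_coset_def by blast
  qed
qed

text \<open>
  The bilinear maps into an abelian group that factor through the tensor product over \<open>R\<close>.
\<close>

definition balanced_map ::
    "('r, 'c) ring_scheme \<Rightarrow> ('r, 'a) module \<Rightarrow> ('r, 'b) module \<Rightarrow> ('g, 'm) monoid_scheme \<Rightarrow>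
     ('a \<Rightarrow> 'b \<Rightarrow> 'g) \<Rightarrow> bool"
  where "balanced_map R M N G \<beta> \<longleftrightarrow>
    (\<forall>x\<in>carrier M. \<forall>y\<in>carrier N. \<beta> x y \<in> carrier G) \<and>
    (\<forall>x\<in>carrier M. \<forall>x'\<in>carrier M. \<forall>y\<in>carrier N. \<beta> (x \<oplus>\<^bsub>M\<^esub> x') y = \<beta> x y \<otimes>\<^bsub>G\<^esub> \<beta> x' y) \<and>
    (\<forall>x\<in>carrier M. \<forall>y\<in>carrier N. \<forall>y'\<in>carrier N. \<beta> x (y \<oplus>\<^bsub>N\<^esub> y') = \<beta> x y \<otimes>\<^bsub>G\<^esub> \<beta> x y') \<and>
    (\<forall>r\<in>carrier R. \<forall>x\<in>carrier M. \<forall>y\<in>carrier N. \<beta> (r \<odot>\<^bsub>M\<^esub> x) y = \<beta> x (r \<odot>\<^bsub>N\<^esub> y))"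

lemma balanced_mapI:
  assumes "\<And>x y. x \<in> carrier M \<Longrightarrow> y \<in> carrier N \<Longrightarrow> \<beta> x y \<in> carrier G"
    and "\<And>x x' y. x \<in> carrier M \<Longrightarrow> x' \<in> carrier M \<Longrightarrow> y \<in> carrier N \<Longrightarrow>
      \<beta> (x \<oplus>\<^bsub>M\<^esub> x') y = \<beta> x y \<otimes>\<^bsub>G\<^esub> \<beta> x' y"
    and "\<And>x y y'. x \<in> carrier M \<Longrightarrow> y \<in> carrier N \<Longrightarrow> y' \<in> carrier N \<Longrightarrow>
      \<beta> x (y \<oplus>\<^bsub>N\<^esub> y') = \<beta> x y \<otimes>\<^bsub>G\<^esub> \<beta> x y'"
    and "\<And>r x y. r \<in> carrier R \<Longrightarrow> x \<in> carrier M \<Longrightarrow> y \<in> carrier N \<Longrightarrow>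
      \<beta> (r \<odot>\<^bsub>M\<^esub> x) y = \<beta> x (r \<odot>\<^bsub>N\<^esub> y)"
  shows "balanced_map R M N G \<beta>"
  using assms unfolding balanced_map_def by blast

lemma balanced_mapD:
  assumes "balanced_map R M N G \<beta>"
  shows "\<And>x y. x \<in> carrier M \<Longrightarrow> y \<in> carrier N \<Longrightarrow> \<beta> x y \<in> carrier G"
    and "\<And>x x' y. x \<in> carrier M \<Longrightarrow> x' \<in> carrier M \<Longrightarrow> y \<in> carrier N \<Longrightarrow>
      \<beta> (x \<oplus>\<^bsub>M\<^esub> x') y = \<beta> x y \<otimes>\<^bsub>G\<^esub> \<beta> x' y"
    and "\<And>x y y'. x \<in> carrier M \<Longrightarrow> y \<in> carrier N \<Longrightarrow> y' \<in> carrier N \<Longrightarrow>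
      \<beta> x (y \<oplus>\<^bsub>N\<^esub> y') = \<beta> x y \<otimes>\<^bsub>G\<^esub> \<beta> x y'"
    and "\<And>r x y. r \<in> carrier R \<Longrightarrow> x \<in> carrier M \<Longrightarrow> y \<in> carrier N \<Longrightarrow>
      \<beta> (r \<odot>\<^bsub>M\<^esub> x) y = \<beta> x (r \<odot>\<^bsub>N\<^esub> y)"
  using assms unfolding balanced_map_def by blast+

definition pure_tensor ::
    "('r, 'c) ring_scheme \<Rightarrow> ('r, 'a) module \<Rightarrow> ('r, 'b) module \<Rightarrow> 'a \<Rightarrow> 'b \<Rightarrow> ('a \<times> 'b \<Rightarrow>\<^sub>0 int) set"
  where "pure_tensor R M N x y =
    tensor_kernel R M N #>\<^bsub>free_Abelian_group (carrier M \<times> carrier N)\<^esub> frag_of (x, y)"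

locale module_pair =
  fixes R :: "('r, 'c) ring_scheme" and M :: "('r, 'a) module" and N :: "('r, 'b) module"
  assumes module_left: "module R M" and module_right: "module R N"
begin

abbreviation "FA \<equiv> free_Abelian_group (carrier M \<times> carrier N)"
abbreviation "TK \<equiv> tensor_kernel R M N"

sublocale FA: comm_group FA by (rule abelian_free_Abelian_group)
sublocale M: module R M by (rule module_left)
sublocale N: module R N by (rule module_right)

lemma frag_diff_closed: "a \<in> carrier FA \<Longrightarrow> b \<in> carrier FA \<Longrightarrow> a - b \<in> carrier FA"
  using keys_diff[of a b] by auto

lemma relations_carrier: "tensor_relations R M N \<subseteq> carrier FA"
  unfolding tensor_relations_def
  by (auto intro!: frag_diff_closed simp del: carrier_free_Abelian_group_iff)

lemma subgroup_TK: "subgroup TK FA"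
  unfolding tensor_kernel_def by (rule FA.generate_is_subgroup[OF relations_carrier])

lemma normal_TK: "TK \<lhd> FA"
  by (rule FA.subgroup_imp_normal[OF subgroup_TK])

lemma comm_group_tensor: "comm_group (tensor R M N)"
  unfolding tensor_def by (rule FA.abelian_FactGroup[OF subgroup_TK])

lemma coset_hom: "(\<lambda>c. TK #>\<^bsub>FA\<^esub> c) \<in> hom FA (tensor R M N)"
  unfolding tensor_def by (rule normal.r_coset_hom_Mod[OF normal_TK])

lemma coset_eq_one_iff: "c \<in> carrier FA \<Longrightarrow> TK #>\<^bsub>FA\<^esub> c = \<one>\<^bsub>tensor R M N\<^esub> \<longleftrightarrow> c \<in> TK"
  unfolding tensor_def
  using FA.coset_join1[OF _ _ subgroup_TK] FA.coset_join2[OF _ subgroup_TK] subgroup.subset[OF subgroup_TK]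
  by auto

lemma tensor_cases:
  assumes "x \<in> carrier (tensor R M N)"
  obtains c where "c \<in> carrier FA" "x = TK #>\<^bsub>FA\<^esub> c"
  using assms unfolding tensor_def carrier_FactGroup by blast

lemma balanced_pure: "balanced_map R M N (tensor R M N) (pure_tensor R M N)"
proof -
  interpret T: comm_group "tensor R M N" by (rule comm_group_tensor)
  let ?q = "\<lambda>c. TK #>\<^bsub>FA\<^esub> c"
  interpret q: group_hom FA "tensor R M N" ?q
    by (rule group_hom.intro[OF FA.is_group T.is_group]) (simp add: group_hom_axioms_def coset_hom)
  have rel: "?q r = \<one>\<^bsub>tensor R M N\<^esub>" if "r \<in> tensor_relations R M N" for r
    using that coset_eq_one_iff relations_carrier generate.incl[of r _ FA]
    unfolding tensor_kernel_def by blast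
  have cl: "frag_of (x, y) \<in> carrier FA" if "x \<in> carrier M" "y \<in> carrier N" for x y
    using that by simp
  have eq: "?q a = ?q b" if "a - b \<in> tensor_relations R M N" "b \<in> carrier FA" for a b
    using q.hom_mult[of "a - b" b] q.hom_closed[of b] rel[OF that(1)] relations_carrier that by auto
  have sum: "?q a = ?q b \<otimes>\<^bsub>tensor R M N\<^esub> ?q c"
    if "a - b - c \<in> tensor_relations R M N" "b \<in> carrier FA" "c \<in> carrier FA" for a b c
    using eq[of a "b + c"] q.hom_mult[OF that(2,3)] FA.m_closed[OF that(2,3)] that(1)
    by (simp add: diff_diff_eq del: carrier_free_Abelian_group_iff)
  show ?thesis
    unfolding pure_tensor_def
  proof (rule balanced_mapI)
    show "?q (frag_of (x, y)) \<in> carrier (tensor R M N)" if "x \<in> carrier M" "y \<in> carrier N" for x y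
      using q.hom_closed[OF cl[OF that]] .
    show "?q (frag_of (x \<oplus>\<^bsub>M\<^esub> x', y)) = ?q (frag_of (x, y)) \<otimes>\<^bsub>tensor R M N\<^esub> ?q (frag_of (x', y))"
      if "x \<in> carrier M" "x' \<in> carrier M" "y \<in> carrier N" for x x' y
      using that by (intro sum cl) (auto simp: tensor_relations_def)
    show "?q (frag_of (x, y \<oplus>\<^bsub>N\<^esub> y')) = ?q (frag_of (x, y)) \<otimes>\<^bsub>tensor R M N\<^esub> ?q (frag_of (x, y'))"
      if "x \<in> carrier M" "y \<in> carrier N" "y' \<in> carrier N" for x y y'
      using that by (intro sum cl) (auto simp: tensor_relations_def)
    show "?q (frag_of (r \<odot>\<^bsub>M\<^esub> x, y)) = ?q (frag_of (x, r \<odot>\<^bsub>N\<^esub> y))"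
      if "r \<in> carrier R" "x \<in> carrier M" "y \<in> carrier N" for r x y
      using that by (intro eq cl) (auto simp: tensor_relations_def)
  qed
qed

text \<open>
  Pure tensors generate the tensor product, hence homomorphisms are determined on them.  Most identities
  between maps of tensor products below are checked in this way.
\<close>

lemma tensor_ext:
  assumes "group G" and f: "f \<in> hom (tensor R M N) G" and g: "g \<in> hom (tensor R M N) G"
    and eq: "\<And>x y. x \<in> carrier M \<Longrightarrow> y \<in> carrier N \<Longrightarrow> f (pure_tensor R M N x y) = g (pure_tensor R M N x y)"
    and z: "z \<in> carrier (tensor R M N)"
  shows "f z = g z"
proof -
  interpret G: group G by fact
  let ?q = "\<lambda>c. TK #>\<^bsub>FA\<^esub> c"
  have "f \<circ> ?q \<in> hom FA G" "g \<circ> ?q \<in> hom FA G"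
    using hom_compose[OF coset_hom f] hom_compose[OF coset_hom g] .
  then interpret f: group_hom FA G "f \<circ> ?q" + g: group_hom FA G "g \<circ> ?q"
    by (simp_all add: group_hom_def group_hom_axioms_def G.is_group FA.is_group)
  obtain c where c: "c \<in> carrier FA" "z = ?q c" using z by (rule tensor_cases)
  from c(1) have "Poly_Mapping.keys c \<subseteq> carrier M \<times> carrier N" by simp
  then have "(f \<circ> ?q) c = (g \<circ> ?q) c"
  proof (induction c rule: free_Abelian_group_induct[consumes 1])
    case 1
    show ?case using f.hom_one g.hom_one by simp
  next
    case (2 a b)
    have "a - b = a \<otimes>\<^bsub>FA\<^esub> inv\<^bsub>FA\<^esub> b" using 2 by simp
    then show ?case
      using 2 f.hom_mult[of a "inv\<^bsub>FA\<^esub> b"] g.hom_mult[of a "inv\<^bsub>FA\<^esub> b"] f.hom_inv[of b] g.hom_inv[of b]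
        FA.inv_closed[of b]
      by simp
  next
    case (3 p)
    then show ?case using eq[of "fst p" "snd p"] by (auto simp: pure_tensor_def)
  qed
  then show ?thesis using c by simp
qed

text \<open>
  The kernel of \<open>h\<close> is a subgroup that contains the defining relations.
\<close>

lemma balanced_kills_relations:
  assumes "comm_group G" and \<beta>: "balanced_map R M N G \<beta>"
    and h: "h \<in> hom FA G" and hp: "\<And>x y. x \<in> carrier M \<Longrightarrow> y \<in> carrier N \<Longrightarrow> h (frag_of (x, y)) = \<beta> x y"
    and c: "c \<in> TK"
  shows "h c = \<one>\<^bsub>G\<^esub>"
proof -
  interpret G: comm_group G by fact
  interpret h: group_hom FA G h
    using h by (simp add: group_hom_def group_hom_axioms_def G.is_group FA.is_group)
  note \<beta> = balanced_mapD[OF \<beta>]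
  have diff: "h (a - b) = h a \<otimes>\<^bsub>G\<^esub> inv\<^bsub>G\<^esub> h b" if "a \<in> carrier FA" "b \<in> carrier FA" for a b
    using h.hom_mult[OF that(1) FA.inv_closed[OF that(2)]] h.hom_inv[OF that(2)] that by simp
  have cl: "frag_of (x, y) \<in> carrier FA" if "x \<in> carrier M" "y \<in> carrier N" for x y
    using that by simp
  have canc: "a \<otimes>\<^bsub>G\<^esub> b \<otimes>\<^bsub>G\<^esub> inv\<^bsub>G\<^esub> a \<otimes>\<^bsub>G\<^esub> inv\<^bsub>G\<^esub> b = \<one>\<^bsub>G\<^esub>"
    if "a \<in> carrier G" "b \<in> carrier G" for a b
    using that by (simp add: G.m_comm[of a b] G.m_assoc)
  have "tensor_relations R M N \<subseteq> kernel FA G h"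
  proof
    fix r assume r: "r \<in> tensor_relations R M N"
    have "h r = \<one>\<^bsub>G\<^esub>"
      using r unfolding tensor_relations_def
      by (auto simp: diff cl frag_diff_closed hp \<beta> canc
          simp del: carrier_free_Abelian_group_iff)
    then show "r \<in> kernel FA G h"
      using r relations_carrier by (auto simp: kernel_def simp del: carrier_free_Abelian_group_iff)
  qed
  then have "TK \<subseteq> kernel FA G h"
    unfolding tensor_kernel_def by (rule FA.generate_subgroup_incl[OF _ h.subgroup_kernel])
  then show ?thesis using c by (auto simp: kernel_def)
qed

lemma tensor_universal:
  assumes "comm_group G" and \<beta>: "balanced_map R M N G \<beta>"
  obtains f where "f \<in> hom (tensor R M N) G"
    "\<And>x y. x \<in> carrier M \<Longrightarrow> y \<in> carrier N \<Longrightarrow> f (pure_tensor R M N x y) = \<beta> x y"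
proof -
  interpret G: comm_group G by fact
  obtain h where h: "h \<in> hom FA G" "\<And>p. p \<in> carrier M \<times> carrier N \<Longrightarrow> h (frag_of p) = (case p of (x, y) \<Rightarrow> \<beta> x y)"
    by (rule G.free_Abelian_group_universal[of "\<lambda>(x, y). \<beta> x y" "carrier M \<times> carrier N"])
      (use balanced_mapD(1)[OF \<beta>] in auto)
  interpret h: group_hom FA G h
    using h by (simp add: group_hom_def group_hom_axioms_def G.is_group FA.is_group)
  have kill: "h c = \<one>\<^bsub>G\<^esub>" if "c \<in> TK" for c
    by (rule balanced_kills_relations[OF assms h(1) _ that]) (use h(2) in auto)
  obtain f where "f \<in> hom (FA Mod TK) G" "\<And>c. c \<in> carrier FA \<Longrightarrow> f (TK #>\<^bsub>FA\<^esub> c) = h c"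
  proof (rule FactGroup_universal[OF h(1) normal_TK])
    fix x y assume x: "x \<in> carrier FA" and y: "y \<in> carrier FA" and eq: "TK #>\<^bsub>FA\<^esub> x = TK #>\<^bsub>FA\<^esub> y"
    have "x \<in> TK #>\<^bsub>FA\<^esub> y"
      using FA.rcos_self[OF x subgroup_TK] eq by simp
    then obtain t where t: "t \<in> TK" "x = t \<otimes>\<^bsub>FA\<^esub> y" unfolding r_coset_def by blast
    then show "h x = h y"
      using h.hom_mult[of t y] kill[OF t(1)] subgroup.mem_carrier[OF subgroup_TK t(1)] y h.hom_closed[OF y]
      by simp
  qed blast
  then show ?thesis
    using that[of f] h(2) unfolding tensor_def pure_tensor_def by simp
qed

end

lemma balanced_comp:
  assumes "balanced_map R M' N' G \<beta>" "f \<in> mod_hom R M M'" "g \<in> mod_hom R N N'"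
  shows "balanced_map R M N G (\<lambda>x y. \<beta> (f x) (g y))"
  by (rule balanced_mapI)
    (simp_all add: mod_homD[OF assms(2)] mod_homD[OF assms(3)] balanced_mapD[OF assms(1)])

locale tensor_maps = A: module_pair R M N + B: module_pair R M' N'
  for R :: "('r, 'c) ring_scheme" and M :: "('r, 'a) module" and N :: "('r, 'b) module"
    and M' :: "('r, 'x) module" and N' :: "('r, 'y) module" +
  fixes f :: "'a \<Rightarrow> 'x" and g :: "'b \<Rightarrow> 'y"
  assumes f: "f \<in> mod_hom R M M'" and g: "g \<in> mod_hom R N N'"
begin

lemma frag_map_carrier:
  assumes c: "c \<in> carrier A.FA"
  shows "frag_extend (\<lambda>(x, y). frag_of (f x, g y)) c \<in> carrier B.FA"
proof -
  let ?b = "\<lambda>(x, y). frag_of (f x, g y)"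
  have "Poly_Mapping.keys (?b p) \<subseteq> carrier M' \<times> carrier N'" if "p \<in> Poly_Mapping.keys c" for p
    using that c mod_homD(1)[OF f] mod_homD(1)[OF g] by (cases p) (auto simp: keys_frag_of)
  then show ?thesis
    using keys_frag_extend[of ?b c] by auto
qed

lemma tensor_map_coset:
  assumes c: "c \<in> carrier A.FA"
  shows "tensor_map R M' N' f g (A.TK #>\<^bsub>A.FA\<^esub> c) = B.TK #>\<^bsub>B.FA\<^esub> frag_extend (\<lambda>(x, y). frag_of (f x, g y)) c"
proof -
  let ?F = "frag_extend (\<lambda>(x, y). frag_of (f x, g y)) :: ('a \<times> 'b \<Rightarrow>\<^sub>0 int) \<Rightarrow> ('x \<times> 'y \<Rightarrow>\<^sub>0 int)"
  have F: "?F \<in> hom A.FA B.FA"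
  proof (rule homI)
    show "?F c \<in> carrier B.FA" if "c \<in> carrier A.FA" for c
      by (rule frag_map_carrier[OF that])
  qed (simp add: frag_extend_add)
  have qF: "(\<lambda>c. B.TK #>\<^bsub>B.FA\<^esub> c) \<circ> ?F \<in> hom A.FA (tensor R M' N')"
    by (rule hom_compose[OF F B.coset_hom])
  have "?F c \<in> B.TK" if "c \<in> A.TK" for c
  proof -
    have "((\<lambda>c. B.TK #>\<^bsub>B.FA\<^esub> c) \<circ> ?F) c = \<one>\<^bsub>tensor R M' N'\<^esub>"
      by (rule A.balanced_kills_relations[OF B.comm_group_tensor balanced_comp[OF B.balanced_pure f g] qF _ that])
        (simp add: pure_tensor_def)
    then show ?thesis
      using B.coset_eq_one_iff[OF hom_in_carrier[OF F]] subgroup.mem_carrier[OF A.subgroup_TK that] by simp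
  qed
  then show ?thesis
    unfolding tensor_map_def
    by (intro coset_map_rcoset[OF A.FA.is_group B.FA.is_group A.subgroup_TK B.subgroup_TK F _ c]) auto
qed

lemma tensor_map_pure:
  assumes "x \<in> carrier M" "y \<in> carrier N"
  shows "tensor_map R M' N' f g (pure_tensor R M N x y) = pure_tensor R M' N' (f x) (g y)"
  unfolding pure_tensor_def using assms by (subst tensor_map_coset) simp_all

lemma tensor_map_hom: "tensor_map R M' N' f g \<in> hom (tensor R M N) (tensor R M' N')"
proof -
  let ?F = "frag_extend (\<lambda>(x, y). frag_of (f x, g y)) :: ('a \<times> 'b \<Rightarrow>\<^sub>0 int) \<Rightarrow> ('x \<times> 'y \<Rightarrow>\<^sub>0 int)"
  note F = frag_map_carrier
  show ?thesis
  proof (rule homI)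
    fix z assume "z \<in> carrier (tensor R M N)"
    then obtain c where c: "c \<in> carrier A.FA" "z = A.TK #>\<^bsub>A.FA\<^esub> c" by (rule A.tensor_cases)
    then show "tensor_map R M' N' f g z \<in> carrier (tensor R M' N')"
      using hom_in_carrier[OF B.coset_hom F] by (simp add: tensor_map_coset)
  next
    fix z w assume "z \<in> carrier (tensor R M N)" "w \<in> carrier (tensor R M N)"
    then obtain c c' where c: "c \<in> carrier A.FA" "z = A.TK #>\<^bsub>A.FA\<^esub> c"
      and c': "c' \<in> carrier A.FA" "w = A.TK #>\<^bsub>A.FA\<^esub> c'"
      by (metis A.tensor_cases)
    have "z \<otimes>\<^bsub>tensor R M N\<^esub> w = A.TK #>\<^bsub>A.FA\<^esub> (c \<otimes>\<^bsub>A.FA\<^esub> c')"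
      using hom_mult[OF A.coset_hom c(1) c'(1)] c c' by simp
    then show "tensor_map R M' N' f g (z \<otimes>\<^bsub>tensor R M N\<^esub> w) =
        tensor_map R M' N' f g z \<otimes>\<^bsub>tensor R M' N'\<^esub> tensor_map R M' N' f g w"
      using hom_mult[OF B.coset_hom F[OF c(1)] F[OF c'(1)]] A.FA.m_closed[OF c(1) c'(1)] c c'
      by (simp add: tensor_map_coset frag_extend_add)
  qed
qed

end

lemmas tensor_mapsI = tensor_maps.intro[OF module_pair.intro module_pair.intro tensor_maps_axioms.intro]

lemma tensor_map_comp:
  assumes mods: "module R M" "module R N" "module R M'" "module R N'" "module R M''" "module R N''"
    and f: "f \<in> mod_hom R M M'" "f' \<in> mod_hom R M' M''"
    and g: "g \<in> mod_hom R N N'" "g' \<in> mod_hom R N' N''"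
    and h: "\<And>x. x \<in> carrier M \<Longrightarrow> f' (f x) = h x" and k: "\<And>y. y \<in> carrier N \<Longrightarrow> g' (g y) = k y"
    and z: "z \<in> carrier (tensor R M N)"
  shows "tensor_map R M'' N'' f' g' (tensor_map R M' N' f g z) = tensor_map R M'' N'' h k z"
proof -
  have h_hom: "h \<in> mod_hom R M M''"
    by (rule mod_hom_cong[OF mods(1) mod_hom_comp[OF f]]) (rule h)
  have k_hom: "k \<in> mod_hom R N N''"
    by (rule mod_hom_cong[OF mods(2) mod_hom_comp[OF g]]) (rule k)
  interpret A: tensor_maps R M N M' N' f g
    by (intro tensor_mapsI mods f g)
  interpret B: tensor_maps R M' N' M'' N'' f' g'
    by (intro tensor_mapsI mods f g)
  interpret C: tensor_maps R M N M'' N'' h k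
    by (intro tensor_mapsI mods h_hom k_hom)
  have "(tensor_map R M'' N'' f' g' \<circ> tensor_map R M' N' f g) z = tensor_map R M'' N'' h k z"
    by (rule A.A.tensor_ext[OF _ hom_compose[OF A.tensor_map_hom B.tensor_map_hom] C.tensor_map_hom _ z])
      (use mod_homD(1)[OF f(1)] mod_homD(1)[OF g(1)] B.B.comm_group_tensor in
        \<open>auto simp: A.tensor_map_pure B.tensor_map_pure C.tensor_map_pure h k comm_group_def\<close>)
  then show ?thesis by simp
qed

lemma tensor_map_comp_left:
  assumes "module R N" "module R M" "module R M'" "module R M''"
    and "f \<in> mod_hom R M M'" "f' \<in> mod_hom R M' M''"
    and "\<And>x. x \<in> carrier M \<Longrightarrow> f' (f x) = h x" "z \<in> carrier (tensor R M N)"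
  shows "tensor_map R M'' N f' (\<lambda>y. y) (tensor_map R M' N f (\<lambda>y. y) z) = tensor_map R M'' N h (\<lambda>y. y) z"
  by (rule tensor_map_comp[OF assms(2,1,3,1,4,1,5,6) mod_hom_id mod_hom_id assms(7) refl assms(8)])

lemma tensor_map_add_left:
  assumes mods: "module R M" "module R N" "module R M'"
    and f: "f \<in> mod_hom R M M'" "f' \<in> mod_hom R M M'" "h \<in> mod_hom R M M'"
    and h: "\<And>x. x \<in> carrier M \<Longrightarrow> h x = f x \<oplus>\<^bsub>M'\<^esub> f' x"
    and z: "z \<in> carrier (tensor R M N)"
  shows "tensor_map R M' N h (\<lambda>y. y) z =
    tensor_map R M' N f (\<lambda>y. y) z \<otimes>\<^bsub>tensor R M' N\<^esub> tensor_map R M' N f' (\<lambda>y. y) z"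
proof -
  interpret A: tensor_maps R M N M' N f "\<lambda>y. y"
    by (intro tensor_mapsI mods f mod_hom_id)
  interpret B: tensor_maps R M N M' N f' "\<lambda>y. y"
    by (intro tensor_mapsI mods f mod_hom_id)
  interpret C: tensor_maps R M N M' N h "\<lambda>y. y"
    by (intro tensor_mapsI mods f mod_hom_id)
  interpret T: comm_group "tensor R M' N" by (rule A.B.comm_group_tensor)
  interpret S: comm_group "tensor R M N" by (rule A.A.comm_group_tensor)
  have hom: "(\<lambda>z. tensor_map R M' N f (\<lambda>y. y) z \<otimes>\<^bsub>tensor R M' N\<^esub> tensor_map R M' N f' (\<lambda>y. y) z)
      \<in> hom (tensor R M N) (tensor R M' N)"
    using hom_in_carrier[OF A.tensor_map_hom]
      hom_in_carrier[OF B.tensor_map_hom] hom_mult[OF A.tensor_map_hom] hom_mult[OF B.tensor_map_hom]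
    by (intro homI) (simp_all add: T.m_ac)
  show ?thesis
    by (rule A.A.tensor_ext[OF T.is_group C.tensor_map_hom hom _ z])
      (simp add: A.tensor_map_pure B.tensor_map_pure C.tensor_map_pure h
        balanced_mapD(2)[OF A.B.balanced_pure] mod_homD(1)[OF f(1)] mod_homD(1)[OF f(2)])
qed

lemma tensor_map_zero_left:
  assumes mods: "module R M" "module R N" "module R M'"
    and f: "\<And>x. x \<in> carrier M \<Longrightarrow> f x = \<zero>\<^bsub>M'\<^esub>"
    and z: "z \<in> carrier (tensor R M N)"
  shows "tensor_map R M' N f (\<lambda>y. y) z = \<one>\<^bsub>tensor R M' N\<^esub>"
proof -
  interpret M: module R M by fact
  interpret M': module R M' by fact
  have fh: "f \<in> mod_hom R M M'"
    by (rule mod_homI) (simp_all add: f)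
  interpret A: tensor_maps R M N M' N f "\<lambda>y. y"
    by (intro tensor_mapsI mods fh mod_hom_id)
  interpret T: comm_group "tensor R M' N" by (rule A.B.comm_group_tensor)
  have "tensor_map R M' N f (\<lambda>y. y) z \<otimes>\<^bsub>tensor R M' N\<^esub> tensor_map R M' N f (\<lambda>y. y) z =
      tensor_map R M' N f (\<lambda>y. y) z"
    by (rule tensor_map_add_left[OF mods fh fh fh _ z, symmetric]) (simp add: f)
  moreover have "tensor_map R M' N f (\<lambda>y. y) z \<in> carrier (tensor R M' N)"
    by (rule hom_in_carrier[OF A.tensor_map_hom z])
  ultimately show ?thesis by simp
qed

lemma tensor_map_ident:
  assumes mods: "module R M" "module R N" and z: "z \<in> carrier (tensor R M N)"
  shows "tensor_map R M N (\<lambda>x. x) (\<lambda>y. y) z = z"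
proof -
  interpret A: tensor_maps R M N M N "\<lambda>x. x" "\<lambda>y. y"
    by (intro tensor_mapsI mods mod_hom_id)
  interpret T: comm_group "tensor R M N" by (rule A.A.comm_group_tensor)
  have id: "(\<lambda>z. z) \<in> hom (tensor R M N) (tensor R M N)" by (rule homI) simp_all
  show ?thesis
    by (rule A.A.tensor_ext[OF T.is_group A.tensor_map_hom id _ z])
      (simp add: A.tensor_map_pure)
qed

lemma tensor_map_cong:
  assumes mods: "module R M" "module R N" "module R M'"
    and f: "f \<in> mod_hom R M M'" and eq: "\<And>x. x \<in> carrier M \<Longrightarrow> f x = h x"
    and z: "z \<in> carrier (tensor R M N)"
  shows "tensor_map R M' N f (\<lambda>y. y) z = tensor_map R M' N h (\<lambda>y. y) z"
  using tensor_map_comp_left[OF mods(2,1,1,3) mod_hom_id f eq z] tensor_map_ident[OF mods(1,2) z] by simp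

section \<open>Tor-vanishing tested on one resolution\<close>

text \<open>
  The map \<open>id \<otimes> \<phi>\<close> turns cycles of \<open>F \<otimes> M\<close> into boundaries of \<open>F \<otimes> N\<close>: the vanishing of the
  induced maps on Tor, free of the coset formalism.
\<close>

definition kills_cycles ::
    "('r, 'c) ring_scheme \<Rightarrow> (nat \<Rightarrow> ('r, 'f) module) \<Rightarrow> (nat \<Rightarrow> 'f \<Rightarrow> 'f) \<Rightarrow>
     ('r, 'a) module \<Rightarrow> ('r, 'b) module \<Rightarrow> ('a \<Rightarrow> 'b) \<Rightarrow> bool"
  where "kills_cycles R F d M N \<phi> \<longleftrightarrow>
    (\<forall>i. \<forall>z\<in>carrier (cycles (\<lambda>i. tensor R (F i) M) (\<lambda>i. tensor_map R (F i) M (d i) (\<lambda>x. x)) i).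
       tensor_map R (F i) N (\<lambda>x. x) \<phi> z \<in>
         boundaries (\<lambda>i. tensor R (F i) N) (\<lambda>i. tensor_map R (F i) N (d i) (\<lambda>x. x)) i)"

lemma carrier_cycles_0: "carrier (cycles C d 0) = carrier (C 0)"
  by (simp add: cycles_def)

lemma carrier_cycles_Suc:
  "carrier (cycles C d (Suc i)) = {z \<in> carrier (C (Suc i)). d i z = \<one>\<^bsub>C i\<^esub>}"
  by (simp add: cycles_def kernel_def)

lemma carrier_cycles_subset: "z \<in> carrier (cycles C d i) \<Longrightarrow> z \<in> carrier (C i)"
  by (cases i) (auto simp: carrier_cycles_0 carrier_cycles_Suc)

lemma boundaries_iff: "z \<in> boundaries C d i \<longleftrightarrow> (\<exists>w\<in>carrier (C (Suc i)). z = d i w)"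
  by (auto simp: boundaries_def)

lemma
  assumes C: "\<And>i. comm_group (C i)" and d: "\<And>i. d i \<in> hom (C (Suc i)) (C i)"
    and dd: "\<And>i z. z \<in> carrier (C (Suc (Suc i))) \<Longrightarrow> d i (d (Suc i) z) = \<one>\<^bsub>C i\<^esub>"
  shows comm_group_cycles: "comm_group (cycles C d i)"
    and subgroup_boundaries: "subgroup (boundaries C d i) (cycles C d i)"
proof -
  interpret C0: comm_group "C i" by (rule C)
  have sub: "subgroup (carrier (cycles C d i)) (C i)"
  proof (cases i)
    case 0
    then show ?thesis using C0.subgroup_self by (simp add: carrier_cycles_0)
  next
    case (Suc j)
    interpret group_hom "C (Suc j)" "C j" "d j"
      using C d by (simp add: group_hom_def group_hom_axioms_def comm_group_def)
    show ?thesis using Suc subgroup_kernel by (simp add: cycles_def)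
  qed
  have eq: "cycles C d i = (C i)\<lparr>carrier := carrier (cycles C d i)\<rparr>"
    by (simp add: cycles_def)
  show "comm_group (cycles C d i)"
  proof (subst eq, rule group.group_comm_groupI)
    show "group ((C i)\<lparr>carrier := carrier (cycles C d i)\<rparr>)"
      by (rule subgroup.subgroup_is_group[OF sub C0.is_group])
  qed (use subgroup.mem_carrier[OF sub] in \<open>auto intro: C0.m_comm\<close>)
  interpret h: group_hom "C (Suc i)" "C i" "d i"
    using C d by (simp add: group_hom_def group_hom_axioms_def comm_group_def)
  have "boundaries C d i \<subseteq> carrier (cycles C d i)"
    using dd hom_in_carrier[OF d]
    by (cases i) (auto simp: boundaries_def carrier_cycles_0 carrier_cycles_Suc)
  moreover have "subgroup (boundaries C d i) (C i)"
    using h.img_is_subgroup by (simp add: boundaries_def)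
  ultimately show "subgroup (boundaries C d i) (cycles C d i)"
    by (subst eq) (intro C0.subgroup_incl sub)
qed

text \<open>
  If \<open>f\<close> maps all cycles into \<open>B'\<close>, then every coset is sent to the zero class \<open>B'\<close>; in particular
  the induced map is a homomorphism.
\<close>

lemma trivial_coset_map:
  assumes "comm_group Z" "comm_group Z'" and B: "subgroup B Z" and B': "subgroup B' Z'"
    and f: "\<And>z. z \<in> carrier Z \<Longrightarrow> f z \<in> B'"
  shows "trivial_homomorphism (Z Mod B) (Z' Mod B') (coset_map Z' B' f)"
proof -
  interpret Z: comm_group Z by fact
  interpret Z': comm_group Z' by fact
  have norm: "B \<lhd> Z" "B' \<lhd> Z'" using Z.subgroup_imp_normal[OF B] Z'.subgroup_imp_normal[OF B'] .
  have B'_coset: "B' \<in> rcosets\<^bsub>Z'\<^esub> B'" by (rule subgroup.subgroup_in_rcosets[OF B' Z'.is_group])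
  have BB: "B' <#>\<^bsub>Z'\<^esub> B' = B'" by (rule normal.rcosets_mult_eq[OF norm(2) B'_coset])
  interpret Q: group "Z Mod B" by (rule normal.factorgroup_is_group[OF norm(1)])
  have zero: "coset_map Z' B' f A = B'" if A: "A \<in> carrier (Z Mod B)" for A
  proof -
    obtain c where c: "c \<in> carrier Z" "A = B #>\<^bsub>Z\<^esub> c"
      using A unfolding carrier_FactGroup by blast
    have sub: "f ` A \<subseteq> B'"
      using f Z.r_coset_subset_G[OF subgroup.subset[OF B] c(1)] c(2) by blast
    have "f c \<in> f ` A" using Z.rcos_self[OF c(1) B] c(2) by blast
    then have fc: "f c \<in> f ` A" "f c \<in> B'" using sub by blast+
    show ?thesis unfolding coset_map_def
    proof (rule equalityI)
      show "B' <#>\<^bsub>Z'\<^esub> (f ` A) \<subseteq> B'"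
        using mono_set_mult[OF subset_refl[of B'] sub, where G = Z'] unfolding BB .
      have "B' #>\<^bsub>Z'\<^esub> f c = B'"
        using Z'.coset_join2[OF _ B' fc(2)] subgroup.mem_carrier[OF B' fc(2)] by blast
      moreover have "B' #>\<^bsub>Z'\<^esub> f c \<subseteq> B' <#>\<^bsub>Z'\<^esub> (f ` A)"
        using fc(1) unfolding r_coset_def set_mult_def by blast
      ultimately show "B' \<subseteq> B' <#>\<^bsub>Z'\<^esub> (f ` A)" by simp
    qed
  qed
  have "coset_map Z' B' f \<in> hom (Z Mod B) (Z' Mod B')"
  proof (rule homI)
    show "coset_map Z' B' f A \<in> carrier (Z' Mod B')" if "A \<in> carrier (Z Mod B)" for A
      using zero[OF that] B'_coset by (simp add: FactGroup_def)
    show "coset_map Z' B' f (A \<otimes>\<^bsub>Z Mod B\<^esub> A') =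
        coset_map Z' B' f A \<otimes>\<^bsub>Z' Mod B'\<^esub> coset_map Z' B' f A'"
      if "A \<in> carrier (Z Mod B)" "A' \<in> carrier (Z Mod B)" for A A'
      using zero[OF Q.m_closed[OF that]] zero[OF that(1)] zero[OF that(2)] BB
      by (simp only: mult_FactGroup)
  qed
  then show ?thesis
    unfolding trivial_homomorphism_def using zero by simp
qed

context augmented_complex
begin

lemma tensor_diff_hom:
  assumes "module R M"
  shows "tensor_map R (F i) M (d i) (\<lambda>x. x) \<in> hom (tensor R (F (Suc i)) M) (tensor R (F i) M)"
  by (intro tensor_maps.tensor_map_hom tensor_mapsI
      module_term assms diff_hom mod_hom_id)

lemma comm_group_tensor: "module R M \<Longrightarrow> comm_group (tensor R (F i) M)"
  by (intro module_pair.comm_group_tensor module_pair.intro module_term)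

lemma tensor_diff_diff:
  assumes M: "module R M" and z: "z \<in> carrier (tensor R (F (Suc (Suc i))) M)"
  shows "tensor_map R (F i) M (d i) (\<lambda>x. x) (tensor_map R (F (Suc i)) M (d (Suc i)) (\<lambda>x. x) z) =
    \<one>\<^bsub>tensor R (F i) M\<^esub>"
proof -
  have "tensor_map R (F i) M (d i) (\<lambda>x. x) (tensor_map R (F (Suc i)) M (d (Suc i)) (\<lambda>x. x) z) =
      tensor_map R (F i) M (\<lambda>x. d i (d (Suc i) x)) (\<lambda>x. x) z"
    by (rule tensor_map_comp_left[OF M module_term module_term module_term diff_hom diff_hom _ z]) simp
  also have "\<dots> = \<one>\<^bsub>tensor R (F i) M\<^esub>"
    by (rule tensor_map_zero_left[OF module_term M module_term _ z]) (rule diff_diff)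
  finally show ?thesis .
qed

lemma trivial_tor_map:
  assumes M: "module R M" and N: "module R N"
    and kills: "kills_cycles R F d M N \<phi>"
  shows "trivial_homomorphism (tor R F d M i) (tor R F d N i) (tor_map R F d N \<phi> i)"
  unfolding tor_def tor_map_def homology_def homology_map_def
proof (rule trivial_coset_map)
  show "tensor_map R (F i) N (\<lambda>x. x) \<phi> z \<in>
      boundaries (\<lambda>i. tensor R (F i) N) (\<lambda>i. tensor_map R (F i) N (d i) (\<lambda>x. x)) i"
    if "z \<in> carrier (cycles (\<lambda>i. tensor R (F i) M) (\<lambda>i. tensor_map R (F i) M (d i) (\<lambda>x. x)) i)" for z
    using kills that unfolding kills_cycles_def by blast
qed (intro comm_group_cycles subgroup_boundaries comm_group_tensor tensor_diff_hom tensor_diff_diff M N; assumption)+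

end

text \<open>
  Independence of the chosen resolution.  With comparison maps \<open>u : F \<rightarrow> P\<close>, \<open>v : P \<rightarrow> F\<close> and a homotopy
  \<open>s\<close> from \<open>v u\<close> to the identity, a cycle \<open>z\<close> of \<open>F \<otimes> M\<close> equals \<open>v (u z) + d (s z)\<close>.  The element
  \<open>u z\<close> is a cycle of \<open>P \<otimes> M\<close>, so it becomes a boundary \<open>d w\<close> in \<open>P \<otimes> N\<close>, and \<open>z\<close> becomes
  \<open>d (v w + s z)\<close>.
\<close>

lemma kills_cycles_transfer:
  fixes P :: "nat \<Rightarrow> ('r, 'p) module" and F :: "nat \<Rightarrow> ('r, 'f) module"
  assumes resP: "resolution R K P dP eP" and projP: "\<And>i. projective_module TYPE('i) R (P i)"
    and resF: "resolution R K F dF eF" and projF: "\<And>i. projective_module TYPE('j) R (F i)"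
    and M: "module R M" and N: "module R N" and \<phi>: "\<phi> \<in> mod_hom R M N"
    and kills: "kills_cycles R P dP M N \<phi>"
  shows "kills_cycles R F dF M N \<phi>"
proof -
  interpret P: resolution R K P dP eP by fact
  interpret F: resolution R K F dF eF by fact
  obtain u where u: "\<And>i. u i \<in> mod_hom R (F i) (P i)" "\<And>x. x \<in> carrier (F 0) \<Longrightarrow> eP (u 0 x) = eF x"
    "\<And>i x. x \<in> carrier (F (Suc i)) \<Longrightarrow> dP i (u (Suc i) x) = u i (dF i x)"
    using comparison_map[OF F.augmented_complex_axioms resP projF] by metis
  obtain v where v: "\<And>i. v i \<in> mod_hom R (P i) (F i)" "\<And>x. x \<in> carrier (P 0) \<Longrightarrow> eF (v 0 x) = eP x"
    "\<And>i x. x \<in> carrier (P (Suc i)) \<Longrightarrow> dF i (v (Suc i) x) = v i (dP i x)"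
    using comparison_map[OF P.augmented_complex_axioms resF projP] by metis
  have vu: "(\<lambda>x. v i (u i x)) \<in> mod_hom R (F i) (F i)" for i
    by (rule mod_hom_comp[OF u(1) v(1)])
  \<comment> \<open>The endomorphism \<open>id - v u\<close> lies over the zero map of \<open>K\<close>, so it is homotopic to zero.\<close>
  let ?g = "\<lambda>i x. x \<ominus>\<^bsub>F i\<^esub> v i (u i x)"
  have g: "?g i \<in> mod_hom R (F i) (F i)" for i
    by (rule mod_hom_diff[OF F.module_term mod_hom_id vu])
  have g_aug: "eF (?g 0 x) = \<zero>\<^bsub>K\<^esub>" if x: "x \<in> carrier (F 0)" for x
  proof -
    interpret K: module R K by (rule F.module_target)
    have "eF (?g 0 x) = eF x \<ominus>\<^bsub>K\<^esub> eF (v 0 (u 0 x))"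
      by (rule mod_hom_minus_arg[OF F.module_term F.module_target F.aug_hom x mod_homD(1)[OF vu x]])
    also have "\<dots> = \<zero>\<^bsub>K\<^esub>"
      using v(2)[OF mod_homD(1)[OF u(1) x]] u(2)[OF x] mod_homD(1)[OF F.aug_hom x]
      by (simp add: a_minus_def K.r_neg)
    finally show ?thesis .
  qed
  have g_diff: "dF i (?g (Suc i) x) = ?g i (dF i x)" if x: "x \<in> carrier (F (Suc i))" for i x
    using mod_hom_minus_arg[OF F.module_term F.module_term F.diff_hom x mod_homD(1)[OF vu x]]
      v(3)[OF mod_homD(1)[OF u(1) x]] u(3)[OF x]
    by simp
  obtain s where s: "\<And>i. s i \<in> mod_hom R (F i) (F (Suc i))"
    and s0: "\<And>x. x \<in> carrier (F 0) \<Longrightarrow> dF 0 (s 0 x) = ?g 0 x"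
    and sS: "\<And>i x. x \<in> carrier (F (Suc i)) \<Longrightarrow>
      dF (Suc i) (s (Suc i) x) \<oplus>\<^bsub>F (Suc i)\<^esub> s i (dF i x) = ?g (Suc i) x"
  proof -
    have "\<exists>s. (\<forall>i. s i \<in> mod_hom R (F i) (F (Suc i))) \<and> (\<forall>x\<in>carrier (F 0). dF 0 (s 0 x) = ?g 0 x) \<and>
        (\<forall>i. \<forall>x\<in>carrier (F (Suc i)). dF (Suc i) (s (Suc i) x) \<oplus>\<^bsub>F (Suc i)\<^esub> s i (dF i x) = ?g (Suc i) x)"
      by (rule null_homotopy[OF resF projF]) (fact g, fact g_aug, fact g_diff)
    then show ?thesis using that by blast
  qed
  let ?T = "\<lambda>L f. tensor_map R L M f (\<lambda>x. x)" and ?U = "\<lambda>L f. tensor_map R L N f (\<lambda>x. x)"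
  let ?p = "\<lambda>L. tensor_map R L N (\<lambda>x. x) \<phi>"
  note mods = F.module_term P.module_term M N
  have natural: "?p L' (?T L' f z) = ?U L' f (?p L z)"
    if "module R L" "module R L'" "f \<in> mod_hom R L L'" "z \<in> carrier (tensor R L M)"
    for L :: "('r, 'x) module" and L' :: "('r, 'y) module" and f z
  proof -
    have "?p L' (?T L' f z) = tensor_map R L' N f \<phi> z"
      by (rule tensor_map_comp[OF that(1) M that(2) M that(2) N that(3) mod_hom_id mod_hom_id \<phi> _ _ that(4)]) simp_all
    also have "\<dots> = ?U L' f (?p L z)"
      by (rule tensor_map_comp[OF that(1) M that(1) N that(2) N mod_hom_id that(3) \<phi> mod_hom_id _ _ that(4), symmetric]) simp_all
    finally show ?thesis .
  qed
  have Thom: "?T L' f z \<in> carrier (tensor R L' M)"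
    if "module R L" "module R L'" "f \<in> mod_hom R L L'" "z \<in> carrier (tensor R L M)"
    for L :: "('r, 'x) module" and L' :: "('r, 'y) module" and f z
    by (rule hom_in_carrier[OF tensor_maps.tensor_map_hom that(4)])
      (intro tensor_mapsI that M mod_hom_id)
  have Uhom: "?U L' f \<in> hom (tensor R L N) (tensor R L' N)"
    if "module R L" "module R L'" "f \<in> mod_hom R L L'"
    for L :: "('r, 'x) module" and L' :: "('r, 'y) module" and f
    by (intro tensor_maps.tensor_map_hom tensor_mapsI that N mod_hom_id)
  have phom: "?p L \<in> hom (tensor R L M) (tensor R L N)" if "module R L" for L :: "('r, 'x) module"
    by (intro tensor_maps.tensor_map_hom tensor_mapsI that M N mod_hom_id \<phi>)
  show ?thesis
    unfolding kills_cycles_def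
  proof (intro allI ballI)
    fix i z
    assume z: "z \<in> carrier (cycles (\<lambda>i. tensor R (F i) M) (\<lambda>i. ?T (F i) (dF i)) i)"
    then have zc: "z \<in> carrier (tensor R (F i) M)" by (rule carrier_cycles_subset)
    interpret TF: comm_group "tensor R (F i) M" by (rule F.comm_group_tensor[OF M])
    interpret TN: comm_group "tensor R (F i) N" by (rule F.comm_group_tensor[OF N])
    have uz: "?T (P i) (u i) z \<in> carrier (cycles (\<lambda>i. tensor R (P i) M) (\<lambda>i. ?T (P i) (dP i)) i)"
    proof (cases i)
      case 0
      then show ?thesis
        using Thom[OF mods(1,2) u(1) zc] by (simp add: carrier_cycles_0)
    next
      case (Suc j)
      have zc': "z \<in> carrier (tensor R (F (Suc j)) M)" using zc Suc by simp
      have "?T (P j) (dP j) (?T (P (Suc j)) (u (Suc j)) z) = ?T (P j) (\<lambda>x. u j (dF j x)) z"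
        by (rule tensor_map_comp_left[OF M mods(1) mods(2) mods(2) u(1) P.diff_hom _ zc'])
          (simp_all add: u(3))
      also have "\<dots> = ?T (P j) (u j) (?T (F j) (dF j) z)"
        by (rule tensor_map_comp_left[OF M mods(1) mods(1) mods(2) F.diff_hom u(1) _ zc', symmetric])
          simp_all
      also have "?T (F j) (dF j) z = \<one>\<^bsub>tensor R (F j) M\<^esub>"
        using z Suc by (simp add: carrier_cycles_Suc)
      also have "?T (P j) (u j) \<one>\<^bsub>tensor R (F j) M\<^esub> = \<one>\<^bsub>tensor R (P j) M\<^esub>"
        by (rule hom_one[OF tensor_maps.tensor_map_hom])
          (intro tensor_mapsI mods u(1) mod_hom_id
            comm_group.axioms(2)[OF F.comm_group_tensor[OF M]] comm_group.axioms(2)[OF P.comm_group_tensor[OF M]])+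
      finally show ?thesis
        using Suc Thom[OF mods(1,2) u(1) zc'] by (simp add: carrier_cycles_Suc)
    qed
    obtain w where w: "w \<in> carrier (tensor R (P (Suc i)) N)"
      "?p (P i) (?T (P i) (u i) z) = ?U (P i) (dP i) w"
      using kills uz unfolding kills_cycles_def boundaries_iff by blast
    let ?vw = "?U (F (Suc i)) (v (Suc i)) w"
    have vw: "?vw \<in> carrier (tensor R (F (Suc i)) N)"
      by (rule hom_in_carrier[OF Uhom[OF mods(2) mods(1) v(1)] w(1)])
    have vuz: "?p (F i) (?T (F i) (\<lambda>x. v i (u i x)) z) = ?U (F i) (dF i) ?vw"
    proof -
      have "?T (F i) (\<lambda>x. v i (u i x)) z = ?T (F i) (v i) (?T (P i) (u i) z)"
        by (rule tensor_map_comp_left[OF M mods(1) mods(2) mods(1) u(1) v(1) _ zc, symmetric])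
          simp_all
      then have "?p (F i) (?T (F i) (\<lambda>x. v i (u i x)) z) = ?U (F i) (v i) (?U (P i) (dP i) w)"
        using natural[OF mods(2) mods(1) v(1) Thom[OF mods(1,2) u(1) zc]] w(2) by simp
      also have "\<dots> = ?U (F i) (\<lambda>x. v i (dP i x)) w"
        by (rule tensor_map_comp_left[OF N mods(2) mods(2) mods(1) P.diff_hom v(1) _ w(1)])
          simp_all
      also have "\<dots> = ?U (F i) (dF i) ?vw"
        by (rule tensor_map_comp_left[OF N mods(2) mods(1) mods(1) v(1) F.diff_hom _ w(1), symmetric])
          (simp_all add: v(3))
      finally show ?thesis .
    qed
    let ?sz = "?T (F (Suc i)) (s i) z"
    have sz: "?sz \<in> carrier (tensor R (F (Suc i)) M)"
      by (rule Thom[OF mods(1,1) s zc])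
    have ds: "(\<lambda>x. dF i (s i x)) \<in> mod_hom R (F i) (F i)"
      by (rule mod_hom_comp[OF s F.diff_hom])
    have dsz: "?T (F i) (\<lambda>x. dF i (s i x)) z = ?T (F i) (dF i) ?sz"
      by (rule tensor_map_comp_left[OF M mods(1) mods(1) mods(1) s F.diff_hom _ zc, symmetric])
        simp_all
    have g_eq: "?T (F i) (?g i) z = ?T (F i) (dF i) ?sz"
    proof (cases i)
      case 0
      have "?T (F i) (?g i) z = ?T (F i) (\<lambda>x. dF i (s i x)) z"
        by (rule tensor_map_cong[OF mods(1) M mods(1) g _ zc]) (simp add: 0 s0)
      then show ?thesis using dsz by simp
    next
      case (Suc j)
      have zc': "z \<in> carrier (tensor R (F (Suc j)) M)" using zc Suc by simp
      have sd: "(\<lambda>x. s j (dF j x)) \<in> mod_hom R (F i) (F i)"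
        using mod_hom_comp[OF F.diff_hom s] Suc by simp
      have "?T (F i) (?g i) z = ?T (F i) (\<lambda>x. dF i (s i x)) z \<otimes>\<^bsub>tensor R (F i) M\<^esub> ?T (F i) (\<lambda>x. s j (dF j x)) z"
        by (rule tensor_map_add_left[OF mods(1) M mods(1) ds sd g _ zc]) (simp add: Suc sS)
      also have "?T (F i) (\<lambda>x. s j (dF j x)) z = ?T (F i) (s j) (?T (F j) (dF j) z)"
        unfolding Suc
        by (rule tensor_map_comp_left[OF M mods(1) mods(1) mods(1) F.diff_hom s _ zc', symmetric])
          simp_all
      also have "?T (F j) (dF j) z = \<one>\<^bsub>tensor R (F j) M\<^esub>"
        using z Suc by (simp add: carrier_cycles_Suc)
      also have "?T (F i) (s j) \<one>\<^bsub>tensor R (F j) M\<^esub> = \<one>\<^bsub>tensor R (F i) M\<^esub>"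
        unfolding Suc
        by (rule hom_one[OF tensor_maps.tensor_map_hom])
          (intro tensor_mapsI mods s mod_hom_id
            comm_group.axioms(2)[OF F.comm_group_tensor[OF M]])+
      finally show ?thesis
        using dsz Thom[OF mods(1,1) ds zc] by simp
    qed
    have "z = ?T (F i) (\<lambda>x. x) z"
      by (rule tensor_map_ident[OF mods(1) M zc, symmetric])
    also have "\<dots> = ?T (F i) (\<lambda>x. v i (u i x)) z \<otimes>\<^bsub>tensor R (F i) M\<^esub> ?T (F i) (?g i) z"
    proof (rule tensor_map_add_left[OF mods(1) M mods(1) vu g mod_hom_id _ zc])
      fix x assume x: "x \<in> carrier (F i)"
      interpret Fi: module R "F i" by (rule F.module_term)
      show "x = v i (u i x) \<oplus>\<^bsub>F i\<^esub> ?g i x"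
        using x mod_homD(1)[OF vu x] by (simp add: a_minus_def Fi.a_ac Fi.r_neg)
    qed
    finally have "z = ?T (F i) (\<lambda>x. v i (u i x)) z \<otimes>\<^bsub>tensor R (F i) M\<^esub> ?T (F i) (dF i) ?sz"
      using g_eq by simp
    then have "?p (F i) z = ?p (F i) (?T (F i) (\<lambda>x. v i (u i x)) z) \<otimes>\<^bsub>tensor R (F i) N\<^esub> ?p (F i) (?T (F i) (dF i) ?sz)"
      using hom_mult[OF phom[OF mods(1)] Thom[OF mods(1,1) vu zc] Thom[OF mods(1,1) F.diff_hom sz]] by simp
    also have "\<dots> = ?U (F i) (dF i) ?vw \<otimes>\<^bsub>tensor R (F i) N\<^esub> ?U (F i) (dF i) (?p (F (Suc i)) ?sz)"
      using vuz natural[OF mods(1,1) F.diff_hom sz] by simp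
    also have "\<dots> = ?U (F i) (dF i) (?vw \<otimes>\<^bsub>tensor R (F (Suc i)) N\<^esub> ?p (F (Suc i)) ?sz)"
      by (rule hom_mult[OF Uhom[OF mods(1,1) F.diff_hom] vw hom_in_carrier[OF phom[OF mods(1)] sz], symmetric])
    finally show "?p (F i) z \<in> boundaries (\<lambda>i. tensor R (F i) N) (\<lambda>i. ?U (F i) (dF i)) i"
      using monoid.m_closed[OF group.is_monoid[OF comm_group.axioms(2)[OF F.comm_group_tensor[OF N]]] vw hom_in_carrier[OF phom[OF mods(1)] sz]]
      unfolding boundaries_iff by (intro bexI)
  qed
qed

theorem tor_vanishing_by_resolution:
  fixes P :: "nat \<Rightarrow> ('r, 'p) module"
  assumes res: "resolution R (quotient_module R m) P dP eP"
    and proj: "\<And>i. projective_module TYPE('i) R (P i)"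
    and M: "module R M" and N: "module R N" and \<phi>: "\<phi> \<in> mod_hom R M N"
    and kills: "kills_cycles R P dP M N \<phi>"
  shows "tor_vanishing TYPE('f) R m M N \<phi>"
  unfolding tor_vanishing_def
proof (intro conjI allI impI)
  fix F :: "nat \<Rightarrow> ('r, 'f) module" and d e i
  assume free: "free_resolution R (quotient_module R m) F d e"
  interpret P: resolution R "quotient_module R m" P dP eP by fact
  have resF: "resolution R (quotient_module R m) F d e"
    by (rule free_resolution_imp_resolution[OF free P.module_target])
  have projF: "projective_module TYPE('f) R (F i)" for i
    by (rule free_imp_projective) (use free in \<open>simp add: free_resolution_def\<close>)
  interpret F: resolution R "quotient_module R m" F d e by fact
  show "trivial_homomorphism (tor R F d M i) (tor R F d N i) (tor_map R F d N \<phi> i)"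
    by (rule F.trivial_tor_map[OF M N kills_cycles_transfer[OF res proj resF projF M N \<phi> kills]])
qed fact

section \<open>The polynomial ring and its ideals\<close>

type_synonym 'k mpoly = "(nat \<Rightarrow>\<^sub>0 nat) \<Rightarrow>\<^sub>0 'k"

lemma mpoly_ring_simps [simp]:
  "monoid.mult (mpoly_ring n) = (*)" "one (mpoly_ring n) = 1"
  "ring.zero (mpoly_ring n) = 0" "ring.add (mpoly_ring n) = (+)"
  by (simp_all add: mpoly_ring_def)

lemma mem_mpoly_ring:
  "f \<in> carrier (mpoly_ring n) \<longleftrightarrow> (\<forall>m. Poly_Mapping.lookup f m \<noteq> 0 \<longrightarrow> Poly_Mapping.keys m \<subseteq> {..<n})"
  by (auto simp: mpoly_ring_def in_keys_iff)

lemma keys_add_nat: "Poly_Mapping.keys (a + b) = Poly_Mapping.keys a \<union> Poly_Mapping.keys (b :: 'a \<Rightarrow>\<^sub>0 nat)"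
  by (auto simp: in_keys_iff lookup_add)

lemma mpoly_ring_closed:
  "0 \<in> carrier (mpoly_ring n)" "1 \<in> carrier (mpoly_ring n)"
  "f \<in> carrier (mpoly_ring n) \<Longrightarrow> g \<in> carrier (mpoly_ring n) \<Longrightarrow> f + g \<in> carrier (mpoly_ring n)"
  "f \<in> carrier (mpoly_ring n) \<Longrightarrow> - f \<in> carrier (mpoly_ring n)"
  "f \<in> carrier (mpoly_ring n) \<Longrightarrow> g \<in> carrier (mpoly_ring n) \<Longrightarrow> f * g \<in> carrier (mpoly_ring n)"
proof -
  show "0 \<in> carrier (mpoly_ring n)" "1 \<in> carrier (mpoly_ring n)" by (simp_all add: mpoly_ring_def)
  show "f + g \<in> carrier (mpoly_ring n)" if "f \<in> carrier (mpoly_ring n)" "g \<in> carrier (mpoly_ring n)"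
    using that keys_add[of f g] by (auto simp: mpoly_ring_def)
  show "- f \<in> carrier (mpoly_ring n)" if "f \<in> carrier (mpoly_ring n)"
    using that by (simp add: mem_mpoly_ring)
  show "f * g \<in> carrier (mpoly_ring n)" if "f \<in> carrier (mpoly_ring n)" "g \<in> carrier (mpoly_ring n)"
    using that keys_mult[of f g] by (force simp: mpoly_ring_def keys_add_nat)
qed

lemma cring_mpoly_ring: "cring (mpoly_ring n)"
proof (rule cringI)
  show "abelian_group (mpoly_ring n)"
    by (rule abelian_groupI) (auto simp: mpoly_ring_closed algebra_simps intro: mpoly_ring_closed exI[of _ "- _"] bexI[of _ "- _"])
  show "comm_monoid (mpoly_ring n)"
    by (rule comm_monoidI) (auto simp: mpoly_ring_closed algebra_simps)
qed (auto simp: algebra_simps)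

lemma mpoly_ring_minus:
  assumes "f \<in> carrier (mpoly_ring n)"
  shows "\<ominus>\<^bsub>mpoly_ring n\<^esub> f = - f"
proof -
  interpret cring "mpoly_ring n" by (rule cring_mpoly_ring)
  show ?thesis by (rule minus_equality) (use assms mpoly_ring_closed in auto)
qed

lemma poly_mapping_sum_single: "f = (\<Sum>k\<in>Poly_Mapping.keys f. Poly_Mapping.single k (Poly_Mapping.lookup f k))"
  by (rule poly_mapping_eqI) (simp add: lookup_sum lookup_single when_def in_keys_iff)

lemma lookup_single_times:
  fixes f :: "('a :: cancel_comm_monoid_add) \<Rightarrow>\<^sub>0 ('b :: semiring_0)"
  shows "Poly_Mapping.lookup (Poly_Mapping.single a c * f) m =
    (\<Sum>k\<in>Poly_Mapping.keys f. c * Poly_Mapping.lookup f k when a + k = m)"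
proof -
  have "Poly_Mapping.single a c * f =
      (\<Sum>k\<in>Poly_Mapping.keys f. Poly_Mapping.single (a + k) (c * Poly_Mapping.lookup f k))"
    by (subst poly_mapping_sum_single[of f]) (simp add: sum_distrib_left mult_single)
  then show ?thesis by (simp add: lookup_sum lookup_single)
qed

lemma lookup_single_times_add:
  fixes f :: "('a :: cancel_comm_monoid_add) \<Rightarrow>\<^sub>0 ('b :: semiring_0)"
  shows "Poly_Mapping.lookup (Poly_Mapping.single a c * f) (a + m) = c * Poly_Mapping.lookup f m"
  by (simp add: lookup_single_times when_def in_keys_iff)

text \<open>
  The exponent vector of the variable \<open>x\<^sub>j\<close>.
\<close>

abbreviation unit_exp :: "nat \<Rightarrow> (nat \<Rightarrow>\<^sub>0 nat)"
  where "unit_exp j \<equiv> Poly_Mapping.single j 1"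

lemma unit_exp_split: "0 < Poly_Mapping.lookup m j \<Longrightarrow> unit_exp j + (m - unit_exp j) = m"
  by (rule poly_mapping_eqI) (auto simp: lookup_add lookup_minus lookup_single when_def)

lemma lookup_var_times:
  "Poly_Mapping.lookup (monom_poly (unit_exp j) * f) m =
    (if 0 < Poly_Mapping.lookup m j then Poly_Mapping.lookup f (m - unit_exp j) else 0)"
proof (cases "0 < Poly_Mapping.lookup m j")
  case True
  then show ?thesis
    using lookup_single_times_add[of "unit_exp j" 1 f "m - unit_exp j"] unit_exp_split[OF True]
    by (simp add: monom_poly_def)
next
  case False
  then have "unit_exp j + k \<noteq> m" for k
    by (auto simp: lookup_add)
  then show ?thesis using False by (simp add: monom_poly_def lookup_single_times)
qed

lemma monom_poly_carrier: "Poly_Mapping.keys m \<subseteq> {..<n} \<Longrightarrow> monom_poly m \<in> carrier (mpoly_ring n)"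
  by (simp add: mpoly_ring_def monom_poly_def)

text \<open>
  The linear map \<open>x\<^sup>m \<mapsto> c(m) x\<^sup>m / x\<^sub>j\<close>, where monomials that are not divisible by \<open>x\<^sub>j\<close> are sent to \<open>0\<close>.
  Partial derivatives and the components of the Koszul homotopy have this form.
\<close>

definition divide_var :: "((nat \<Rightarrow>\<^sub>0 nat) \<Rightarrow> 'k) \<Rightarrow> nat \<Rightarrow> ((nat \<Rightarrow>\<^sub>0 nat) \<Rightarrow>\<^sub>0 'k::field) \<Rightarrow> (nat \<Rightarrow>\<^sub>0 nat) \<Rightarrow>\<^sub>0 'k"
  where "divide_var c j f =
    Abs_poly_mapping (\<lambda>m. c (m + unit_exp j) * Poly_Mapping.lookup f (m + unit_exp j))"

lemma lookup_divide_var: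
  "Poly_Mapping.lookup (divide_var c j f) m = c (m + unit_exp j) * Poly_Mapping.lookup f (m + unit_exp j)"
proof -
  have "{m. c (m + unit_exp j) * Poly_Mapping.lookup f (m + unit_exp j) \<noteq> 0} \<subseteq>
      (\<lambda>m. m - unit_exp j) ` Poly_Mapping.keys f"
    by (force simp: in_keys_iff intro!: rev_image_eqI)
  then have "finite {m. c (m + unit_exp j) * Poly_Mapping.lookup f (m + unit_exp j) \<noteq> 0}"
    using finite_surj[OF finite_keys] by blast
  then show ?thesis unfolding divide_var_def by simp
qed

lemma divide_var_add: "divide_var c j (f + g) = divide_var c j f + divide_var c j g"
  by (rule poly_mapping_eqI) (simp add: lookup_divide_var lookup_add algebra_simps)

lemma divide_var_zero: "divide_var c j 0 = 0"
  by (rule poly_mapping_eqI) (simp add: lookup_divide_var)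

lemma divide_var_carrier:
  assumes "f \<in> carrier (mpoly_ring n)"
  shows "divide_var c j f \<in> carrier (mpoly_ring n)"
  unfolding mem_mpoly_ring
proof (intro allI impI)
  fix m assume "Poly_Mapping.lookup (divide_var c j f) m \<noteq> 0"
  then have "Poly_Mapping.keys (m + unit_exp j) \<subseteq> {..<n}"
    using assms by (simp add: mem_mpoly_ring lookup_divide_var)
  then show "Poly_Mapping.keys m \<subseteq> {..<n}" by (simp add: keys_add_nat)
qed

text \<open>
  The exponent vector of \<open>\<Prod>\<^sub>j\<^sub>\<in>\<^sub>J x\<^sub>j\<close>, that is, the multidegree of the basis element \<open>e\<^sub>J\<close> of the Koszul
  complex.
\<close>

definition subset_exp :: "nat set \<Rightarrow> (nat \<Rightarrow>\<^sub>0 nat)"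
  where "subset_exp J = (\<Sum>j\<in>J. unit_exp j)"

lemma subset_exp_insert: "finite J \<Longrightarrow> j \<notin> J \<Longrightarrow> subset_exp (insert j J) = unit_exp j + subset_exp J"
  by (simp add: subset_exp_def)

lemma subset_exp_remove: "finite J \<Longrightarrow> j \<in> J \<Longrightarrow> unit_exp j + subset_exp (J - {j}) = subset_exp J"
  by (simp add: subset_exp_def sum.remove)

lemma lookup_subset_exp: "finite J \<Longrightarrow> Poly_Mapping.lookup (subset_exp J) i = (if i \<in> J then 1 else 0)"
  by (simp add: subset_exp_def lookup_sum lookup_single when_def)

lemma keys_subset_exp: "finite J \<Longrightarrow> Poly_Mapping.keys (subset_exp J) = J"
  by (simp add: set_eq_iff in_keys_iff lookup_subset_exp del: lookup_not_eq_zero_eq_in_keys)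

lemma ideal_mpolyD:
  assumes "ideal A (mpoly_ring n)"
  shows "\<And>f. f \<in> A \<Longrightarrow> f \<in> carrier (mpoly_ring n)" "0 \<in> A"
    "\<And>f g. f \<in> A \<Longrightarrow> g \<in> A \<Longrightarrow> f + g \<in> A" "\<And>f. f \<in> A \<Longrightarrow> - f \<in> A"
    "\<And>f g. f \<in> carrier (mpoly_ring n) \<Longrightarrow> g \<in> A \<Longrightarrow> f * g \<in> A"
proof -
  interpret ideal A "mpoly_ring n" by fact
  show carr: "f \<in> carrier (mpoly_ring n)" if "f \<in> A" for f using that by (rule a_Hcarr)
  show "0 \<in> A" using additive_subgroup.zero_closed[OF additive_subgroup_axioms] by simp
  show "f + g \<in> A" if "f \<in> A" "g \<in> A" for f g using additive_subgroup.a_closed[OF additive_subgroup_axioms that] by simp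
  show "- f \<in> A" if "f \<in> A" for f using additive_subgroup.a_inv_closed[OF additive_subgroup_axioms that] mpoly_ring_minus[OF carr[OF that]] by simp
  show "f * g \<in> A" if "f \<in> carrier (mpoly_ring n)" "g \<in> A" for f g using I_l_closed[OF that(2,1)] by simp
qed

lemma ideal_mpolyI:
  assumes "A \<subseteq> carrier (mpoly_ring n)" "0 \<in> A" "\<And>f g. f \<in> A \<Longrightarrow> g \<in> A \<Longrightarrow> f + g \<in> A"
    and mult: "\<And>f g. f \<in> carrier (mpoly_ring n) \<Longrightarrow> g \<in> A \<Longrightarrow> f * g \<in> A"
  shows "ideal A (mpoly_ring n)"
proof -
  interpret cring "mpoly_ring n" by (rule cring_mpoly_ring)
  have minus: "- f \<in> A" if "f \<in> A" for f
    using mult[of "- 1" f] that by (simp add: mpoly_ring_closed)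
  have inv: "inv\<^bsub>add_monoid (mpoly_ring n)\<^esub> f \<in> A" if "f \<in> A" for f
    using minus[OF that] mpoly_ring_minus[of f n] that assms(1) unfolding a_inv_def by auto
  have "subgroup A (add_monoid (mpoly_ring n))"
    using assms inv by (intro subgroup.intro) auto
  moreover have "g * f \<in> A" if "f \<in> carrier (mpoly_ring n)" "g \<in> A" for f g
    using mult[OF that] by (simp add: mult.commute)
  ultimately show ?thesis
    using mult by (intro idealI ring_axioms) auto
qed

lemma ideal_sum_closed:
  assumes "ideal A (mpoly_ring n)" "\<And>x. x \<in> S \<Longrightarrow> f x \<in> A"
  shows "sum f S \<in> A"
  using assms(2) by (induction S rule: infinite_finite_induct) (auto simp: ideal_mpolyD[OF assms(1)])

lemma ideal_carrier_mpoly: "ideal (carrier (mpoly_ring n)) (mpoly_ring n)"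
  by (rule ideal_mpolyI) (auto intro: mpoly_ring_closed)

lemma unit_exp_nonzero: "Poly_Mapping.single i (Suc 0) \<noteq> 0"
  by (metis lookup_single_eq lookup_zero nat.distinct(1))

lemma var_in_graded_max_ideal:
  assumes "i < n"
  shows "monom_poly (unit_exp i) \<in> graded_max_ideal n"
proof -
  interpret cring "mpoly_ring n" by (rule cring_mpoly_ring)
  have "(\<lambda>i. monom_poly (unit_exp i)) ` {..<n} \<subseteq> carrier (mpoly_ring n)"
    by (auto intro!: monom_poly_carrier)
  from genideal_self[OF this] show ?thesis
    unfolding graded_max_ideal_def using assms by blast
qed

lemma
  shows graded_max_ideal_ideal: "ideal (graded_max_ideal n :: 'a::field mpoly set) (mpoly_ring n)"
    and graded_max_ideal_eq: "(graded_max_ideal n :: 'a mpoly set) = {f \<in> carrier (mpoly_ring n). Poly_Mapping.lookup f 0 = 0}"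
proof -
  interpret cring "mpoly_ring n" by (rule cring_mpoly_ring)
  let ?X = "(\<lambda>i. monom_poly (unit_exp i)) ` {..<n} :: 'a mpoly set"
  let ?m = "{f \<in> carrier (mpoly_ring n). Poly_Mapping.lookup f 0 = 0} :: 'a mpoly set"
  have X: "?X \<subseteq> carrier (mpoly_ring n)"
    by (auto intro!: monom_poly_carrier)
  show ideal: "ideal (graded_max_ideal n :: 'a mpoly set) (mpoly_ring n)"
    unfolding graded_max_ideal_def by (rule genideal_ideal[OF X])
  have mult0: "Poly_Mapping.lookup (f * g) 0 = 0" if "Poly_Mapping.lookup g 0 = 0" for f g :: "'a mpoly"
  proof -
    have "0 \<notin> Poly_Mapping.keys (f * g)"
    proof
      assume "0 \<in> Poly_Mapping.keys (f * g)"
      then obtain a b where "0 = a + b" "b \<in> Poly_Mapping.keys g" using keys_mult[of f g] by auto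
      moreover have "b = 0"
      proof (rule poly_mapping_eqI)
        fix i show "Poly_Mapping.lookup b i = Poly_Mapping.lookup 0 i"
          using arg_cong[OF \<open>0 = a + b\<close>, of "\<lambda>x. Poly_Mapping.lookup x i"] by (simp add: lookup_add)
      qed
      ultimately show False using that by (simp add: in_keys_iff)
    qed
    then show ?thesis by (simp add: in_keys_iff)
  qed
  have ideal_m: "ideal ?m (mpoly_ring n)"
    by (rule ideal_mpolyI) (auto simp: mpoly_ring_closed lookup_add mult0)
  have "?X \<subseteq> ?m"
    using X by (auto simp: unit_exp_nonzero monom_poly_def lookup_single when_def)
  then have sub: "(graded_max_ideal n :: 'a mpoly set) \<subseteq> ?m"
    unfolding graded_max_ideal_def by (rule genideal_minimal[OF ideal_m])
  have "f \<in> graded_max_ideal n" if f: "f \<in> ?m" for f :: "'a mpoly"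
  proof -
    have "Poly_Mapping.single k (Poly_Mapping.lookup f k) \<in> graded_max_ideal n" if k: "k \<in> Poly_Mapping.keys f" for k
    proof -
      have kn: "Poly_Mapping.keys k \<subseteq> {..<n}" "k \<noteq> 0" using f k by (auto simp: mem_mpoly_ring in_keys_iff)
      then obtain j where j: "j \<in> Poly_Mapping.keys k" by (metis all_not_in_conv keys_eq_empty)
      then have pos: "0 < Poly_Mapping.lookup k j" by (simp add: in_keys_iff)
      have "Poly_Mapping.single (k - unit_exp j) (Poly_Mapping.lookup f k) \<in> carrier (mpoly_ring n)"
        using kn unit_exp_split[OF pos] keys_add_nat[of "unit_exp j" "k - unit_exp j"]
        by (auto simp: mpoly_ring_def)
      moreover have "Poly_Mapping.single (k - unit_exp j) (Poly_Mapping.lookup f k) * monom_poly (unit_exp j) =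
          Poly_Mapping.single k (Poly_Mapping.lookup f k)"
        using unit_exp_split[OF pos] by (simp add: monom_poly_def mult_single add.commute)
      ultimately show ?thesis
        using ideal_mpolyD(5)[OF ideal _ var_in_graded_max_ideal[of j n]] j kn(1) by force
    qed
    then have "(\<Sum>k\<in>Poly_Mapping.keys f. Poly_Mapping.single k (Poly_Mapping.lookup f k)) \<in> graded_max_ideal n"
      by (rule ideal_sum_closed[OF ideal])
    then show ?thesis using poly_mapping_sum_single[of f] by simp
  qed
  then show "(graded_max_ideal n :: 'a mpoly set) = ?m" using sub by blast
qed

lemma module_quotient_module:
  assumes J: "ideal J R" and R: "cring R"
  shows "module R (quotient_module R J)"
proof -
  interpret J: ideal J R by (rule J)
  interpret Q: cring "R Quot J" by (rule J.quotient_is_cring[OF R])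
  interpret h: ring_hom_ring R "R Quot J" "(+>\<^bsub>R\<^esub>) J" by (rule J.rcos_ring_hom_ring)
  have simps: "carrier (quotient_module R J) = carrier (R Quot J)"
    "ring.add (quotient_module R J) = ring.add (R Quot J)"
    "ring.zero (quotient_module R J) = ring.zero (R Quot J)"
    "smult (quotient_module R J) = (\<lambda>r A. (J +>\<^bsub>R\<^esub> r) \<otimes>\<^bsub>R Quot J\<^esub> A)"
    by (simp_all add: quotient_module_def)
  show ?thesis
  proof (rule moduleI)
    show "abelian_group (quotient_module R J)"
      by (rule abelian_groupI) (auto simp: simps Q.a_ac intro: Q.l_neg bexI[of _ "\<ominus>\<^bsub>R Quot J\<^esub> _"])
  qed (auto simp: simps R Q.l_distr Q.r_distr Q.m_assoc h.hom_add h.hom_mult h.hom_one)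
qed

lemma ideal_module_simps [simp]:
  "carrier (ideal_module R J) = J" "ring.zero (ideal_module R J) = \<zero>\<^bsub>R\<^esub>"
  "ring.add (ideal_module R J) = ring.add R" "smult (ideal_module R J) = monoid.mult R"
  by (simp_all add: ideal_module_def)

lemma module_ideal_module:
  assumes A: "ideal A (mpoly_ring n)"
  shows "module (mpoly_ring n) (ideal_module (mpoly_ring n) A)"
proof (rule moduleI)
  note A = ideal_mpolyD[OF A]
  show "abelian_group (ideal_module (mpoly_ring n) A)"
  proof (rule abelian_groupI)
    show "\<exists>y\<in>carrier (ideal_module (mpoly_ring n) A).
        y \<oplus>\<^bsub>ideal_module (mpoly_ring n) A\<^esub> x = \<zero>\<^bsub>ideal_module (mpoly_ring n) A\<^esub>"
      if "x \<in> carrier (ideal_module (mpoly_ring n) A)" for x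
      using that A by (intro bexI[of _ "- x"]) auto
  qed (auto simp: A ac_simps)
qed (auto simp: ideal_mpolyD[OF A] cring_mpoly_ring algebra_simps)

section \<open>The weighted Koszul homotopy\<close>

text \<open>
  The sign in \<open>e\<^sub>j \<and> e\<^sub>J = \<plusminus> e\<^bsub>J \<union> {j}\<^esub>\<close>: the number of factors that \<open>e\<^sub>j\<close> has to pass.
\<close>

definition koszul_sign :: "nat \<Rightarrow> nat set \<Rightarrow> 'a::comm_ring_1"
  where "koszul_sign j J = (-1) ^ card {i \<in> J. i < j}"

lemma koszul_sign_square: "koszul_sign j J * (koszul_sign j J * x) = (x :: 'a :: comm_ring_1)"
  by (simp add: koszul_sign_def mult.assoc[symmetric] flip: power_add)

lemma koszul_sign_insert:
  assumes "finite J" "j \<notin> J"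
  shows "koszul_sign i (insert j J) = (if j < i then - koszul_sign i J else koszul_sign i J)"
proof -
  have "{l \<in> insert j J. l < i} = (if j < i then insert j {l \<in> J. l < i} else {l \<in> J. l < i})"
    by auto
  then show ?thesis using assms by (simp add: koszul_sign_def)
qed

lemma koszul_sign_swap:
  assumes "finite J" "i \<notin> J" "j \<notin> J" "i \<noteq> j"
  shows "koszul_sign j J * koszul_sign i (insert j J) =
    - (koszul_sign i J * koszul_sign j (insert i J) :: 'a :: comm_ring_1)"
  using assms by (simp add: koszul_sign_insert mult.commute)

lemma koszul_sign_cross:
  assumes "finite J" "i \<notin> J" "j \<notin> J" "i \<noteq> j"
  shows "koszul_sign j (insert i J) * koszul_sign i (insert j J) =
    - (koszul_sign i J * koszul_sign j J :: 'a :: comm_ring_1)"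
  using assms by (simp add: koszul_sign_insert mult.commute)

lemma lookup_koszul_sign:
  "Poly_Mapping.lookup (koszul_sign j J * p) m = koszul_sign j J * Poly_Mapping.lookup p m"
proof -
  have "Poly_Mapping.lookup ((-1) ^ k * p) m = (-1) ^ k * Poly_Mapping.lookup p m" for k
    by (induction k) (simp_all add: mult.assoc)
  then show ?thesis by (simp add: koszul_sign_def)
qed

text \<open>
  A chain \<open>\<Sum>\<^sub>J a\<^sub>J e\<^sub>J\<close> is represented by the function \<open>J \<mapsto> a\<^sub>J\<close>.  The coefficient of the
  differential at \<open>e\<^sub>J\<close> collects contributions from the sets \<open>J \<union> {j}\<close>.
\<close>

definition koszul_diff :: "nat \<Rightarrow> (nat set \<Rightarrow> 'k::field mpoly) \<Rightarrow> nat set \<Rightarrow> 'k mpoly"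
  where "koszul_diff n a J =
    (\<Sum>j\<in>{..<n} - J. koszul_sign j J * (monom_poly (unit_exp j) * a (insert j J)))"

text \<open>
  The map \<open>x\<^sup>m e\<^sub>J \<mapsto> \<Sum>\<^sub>j\<^sub>\<notin>\<^sub>J w\<^sub>j(\<alpha>) (x\<^sup>m / x\<^sub>j) e\<^sub>j \<and> e\<^sub>J\<close>, where \<open>\<alpha> = m + 1\<^sub>J\<close> is the multidegree.
\<close>

definition koszul_homotopy ::
    "nat \<Rightarrow> (nat \<Rightarrow> (nat \<Rightarrow>\<^sub>0 nat) \<Rightarrow> 'k) \<Rightarrow> (nat set \<Rightarrow> 'k::field mpoly) \<Rightarrow> nat set \<Rightarrow> 'k mpoly"
  where "koszul_homotopy n w a J =
    (if J \<subseteq> {..<n}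
     then \<Sum>j\<in>J. koszul_sign j (J - {j}) * divide_var (\<lambda>m. w j (m + subset_exp (J - {j}))) j (a (J - {j}))
     else 0)"

lemma lookup_koszul_diff:
  "Poly_Mapping.lookup (koszul_diff n a J) m =
    (\<Sum>j\<in>{..<n} - J. koszul_sign j J *
      (if 0 < Poly_Mapping.lookup m j then Poly_Mapping.lookup (a (insert j J)) (m - unit_exp j) else 0))"
  by (simp only: koszul_diff_def lookup_sum lookup_koszul_sign lookup_var_times)

lemma lookup_koszul_homotopy:
  "J \<subseteq> {..<n} \<Longrightarrow> Poly_Mapping.lookup (koszul_homotopy n w a J) m =
    (\<Sum>j\<in>J. koszul_sign j (J - {j}) * (w j (m + unit_exp j + subset_exp (J - {j})) *
       Poly_Mapping.lookup (a (J - {j})) (m + unit_exp j)))"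
  by (simp only: koszul_homotopy_def if_True lookup_sum lookup_koszul_sign lookup_divide_var)

text \<open>
  In the coefficient of \<open>x\<^sup>m e\<^sub>J\<close>, the terms that add \<open>e\<^sub>j\<close> and remove \<open>e\<^sub>i\<close> for \<open>i \<noteq> j\<close> occur in both
  compositions with opposite signs.  The terms with \<open>i = j\<close> give \<open>w\<^sub>j(\<alpha>)\<close> times the coefficient:
  they come from \<open>\<partial> h\<close> if \<open>j \<notin> J\<close> and from \<open>h \<partial>\<close> if \<open>j \<in> J\<close>.  If \<open>j \<notin> J\<close> and \<open>x\<^sub>j\<close> does not
  divide \<open>x\<^sup>m\<close>, the term is missing, but then \<open>\<alpha>\<^sub>j = 0\<close> and the weight is zero.
\<close>

lemma koszul_homotopy_identity:
  fixes a :: "nat set \<Rightarrow> 'k::field mpoly"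
  assumes J: "J \<subseteq> {..<n}" and w: "\<And>j \<alpha>. Poly_Mapping.lookup \<alpha> j = 0 \<Longrightarrow> w j \<alpha> = 0"
  shows "Poly_Mapping.lookup (koszul_diff n (koszul_homotopy n w a) J) m +
      Poly_Mapping.lookup (koszul_homotopy n w (koszul_diff n a) J) m =
    (\<Sum>j<n. w j (m + subset_exp J)) * Poly_Mapping.lookup (a J) m"
proof -
  define \<alpha> where "\<alpha> = m + subset_exp J"
  define D where "D = {..<n} - J"
  define s where "s = (koszul_sign :: nat \<Rightarrow> nat set \<Rightarrow> 'k)"
  define c where "c j i = (if 0 < Poly_Mapping.lookup m j
    then Poly_Mapping.lookup (a (insert j (J - {i}))) (m + unit_exp i - unit_exp j) else 0)" for j i
  have fin: "finite J" "finite D" using J finite_subset by (auto simp: D_def)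
  have remove: "m + unit_exp i + subset_exp (J - {i}) = \<alpha>" if "i \<in> J" for i
    using subset_exp_remove[OF fin(1) that] by (simp add: \<alpha>_def add.assoc)
  have diag: "Poly_Mapping.lookup \<alpha> j = Poly_Mapping.lookup m j" if "j \<in> D" for j
    using that fin by (simp add: \<alpha>_def D_def lookup_add lookup_subset_exp)
  have first: "Poly_Mapping.lookup (koszul_diff n (koszul_homotopy n w a) J) m =
      (\<Sum>j\<in>D. w j \<alpha> * Poly_Mapping.lookup (a J) m +
        (\<Sum>i\<in>J. s j J * s i (insert j (J - {i})) * (w i \<alpha> * c j i)))"
    unfolding lookup_koszul_diff D_def[symmetric] s_def[symmetric]
  proof (rule sum.cong[OF refl])
    fix j assume j: "j \<in> D"
    then have jJ: "j \<notin> J" and insert_J: "insert j J \<subseteq> {..<n}" using J by (auto simp: D_def)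
    show "s j J * (if 0 < Poly_Mapping.lookup m j
          then Poly_Mapping.lookup (koszul_homotopy n w a (insert j J)) (m - unit_exp j) else 0) =
        w j \<alpha> * Poly_Mapping.lookup (a J) m +
        (\<Sum>i\<in>J. s j J * s i (insert j (J - {i})) * (w i \<alpha> * c j i))"
    proof (cases "0 < Poly_Mapping.lookup m j")
      case False
      then show ?thesis using w[of \<alpha> j] diag[OF j] by (simp add: c_def)
    next
      case True
      then have m: "m - unit_exp j + unit_exp j = m"
        using unit_exp_split by (simp add: add.commute)
      have jpart: "insert j J - {j} = J" using jJ by auto
      have ipart: "s i (insert j J - {i}) * (w i (m - unit_exp j + unit_exp i + subset_exp (insert j J - {i})) *
           Poly_Mapping.lookup (a (insert j J - {i})) (m - unit_exp j + unit_exp i)) =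
           s i (insert j (J - {i})) * (w i \<alpha> * c j i)" if i: "i \<in> J" for i
      proof -
        have ij: "i \<noteq> j" using i jJ by blast
        have set: "insert j J - {i} = insert j (J - {i})" using ij by auto
        have "m - unit_exp j + unit_exp i + subset_exp (insert j (J - {i})) =
            m - unit_exp j + unit_exp j + (unit_exp i + subset_exp (J - {i}))"
          using fin jJ by (simp add: subset_exp_insert ac_simps)
        also have "\<dots> = \<alpha>"
          using m subset_exp_remove[OF fin(1) i] by (simp add: \<alpha>_def)
        finally have exps: "m - unit_exp j + unit_exp i + subset_exp (insert j (J - {i})) = \<alpha>" .
        have shift: "m - unit_exp j + unit_exp i = m + unit_exp i - unit_exp j"
          using True ij by (intro poly_mapping_eqI) (simp add: lookup_add lookup_minus lookup_single when_def)
        then show ?thesis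
          using True by (simp add: set c_def exps[unfolded shift] shift del: One_nat_def)
      qed
      have "Poly_Mapping.lookup (koszul_homotopy n w a (insert j J)) (m - unit_exp j) =
          s j J * (w j \<alpha> * Poly_Mapping.lookup (a J) m) +
          (\<Sum>i\<in>J. s i (insert j (J - {i})) * (w i \<alpha> * c j i))"
        unfolding lookup_koszul_homotopy[OF insert_J] s_def[symmetric]
        using fin jJ by (simp add: jpart m \<alpha>_def[symmetric] ipart del: One_nat_def)
      then show ?thesis
        using True koszul_sign_square[of j J] koszul_sign_square[of j J "1 :: 'k"] by (simp add: s_def distrib_left sum_distrib_left mult.assoc)
    qed
  qed
  have second: "Poly_Mapping.lookup (koszul_homotopy n w (koszul_diff n a) J) m =
      (\<Sum>i\<in>J. w i \<alpha> * Poly_Mapping.lookup (a J) m +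
        (\<Sum>j\<in>D. s i (J - {i}) * s j (J - {i}) * (w i \<alpha> * c j i)))"
    unfolding lookup_koszul_homotopy[OF J] s_def[symmetric]
  proof (rule sum.cong[OF refl])
    fix i assume i: "i \<in> J"
    have D_i: "{..<n} - (J - {i}) = insert i D" "i \<notin> D" using i J by (auto simp: D_def)
    have jpart: "(if 0 < Poly_Mapping.lookup (m + unit_exp i) j
        then Poly_Mapping.lookup (a (insert j (J - {i}))) (m + unit_exp i - unit_exp j) else 0) = c j i"
      if "j \<in> D" for j
      using that D_i(2) by (auto simp: c_def lookup_add lookup_single when_def)
    have ipart: "0 < Poly_Mapping.lookup (m + unit_exp i) i"
      by (simp add: lookup_add)
    have "Poly_Mapping.lookup (koszul_diff n a (J - {i})) (m + unit_exp i) =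
        s i (J - {i}) * Poly_Mapping.lookup (a J) m + (\<Sum>j\<in>D. s j (J - {i}) * c j i)"
      unfolding lookup_koszul_diff s_def[symmetric] D_i(1)
      using fin(2) D_i(2) i ipart by (simp add: jpart insert_absorb del: One_nat_def)
    then have "s i (J - {i}) * (w i \<alpha> * Poly_Mapping.lookup (koszul_diff n a (J - {i})) (m + unit_exp i)) =
        s i (J - {i}) * s i (J - {i}) * (w i \<alpha> * Poly_Mapping.lookup (a J) m) +
        s i (J - {i}) * (w i \<alpha> * (\<Sum>j\<in>D. s j (J - {i}) * c j i))"
      by (simp only: distrib_left mult.left_commute mult.assoc)
    also have "s i (J - {i}) * s i (J - {i}) = 1"
      using koszul_sign_square[of i "J - {i}" "1 :: 'k"] by (simp add: s_def)
    also have "s i (J - {i}) * (w i \<alpha> * (\<Sum>j\<in>D. s j (J - {i}) * c j i)) =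
        (\<Sum>j\<in>D. s i (J - {i}) * s j (J - {i}) * (w i \<alpha> * c j i))"
      by (simp only: sum_distrib_left ac_simps)
    finally show "s i (J - {i}) * (w i (m + unit_exp i + subset_exp (J - {i})) *
          Poly_Mapping.lookup (koszul_diff n a (J - {i})) (m + unit_exp i)) =
        w i \<alpha> * Poly_Mapping.lookup (a J) m +
        (\<Sum>j\<in>D. s i (J - {i}) * s j (J - {i}) * (w i \<alpha> * c j i))"
      unfolding remove[OF i] by simp
  qed
  \<comment> \<open>The off-diagonal terms of the two compositions.\<close>
  have cancel: "(\<Sum>j\<in>D. \<Sum>i\<in>J. s j J * s i (insert j (J - {i})) * (w i \<alpha> * c j i)) +
      (\<Sum>i\<in>J. \<Sum>j\<in>D. s i (J - {i}) * s j (J - {i}) * (w i \<alpha> * c j i)) = 0"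
  proof -
    have "s j J * s i (insert j (J - {i})) = - (s i (J - {i}) * s j (J - {i}))" if "i \<in> J" "j \<in> D" for i j
      using koszul_sign_cross[of "J - {i}" i j] fin that
      by (auto simp: s_def D_def insert_absorb)
    then have "(\<Sum>j\<in>D. \<Sum>i\<in>J. s j J * s i (insert j (J - {i})) * (w i \<alpha> * c j i)) =
        (\<Sum>j\<in>D. \<Sum>i\<in>J. - (s i (J - {i}) * s j (J - {i}) * (w i \<alpha> * c j i)))"
      by (intro sum.cong refl) simp
    also have "\<dots> = - (\<Sum>i\<in>J. \<Sum>j\<in>D. s i (J - {i}) * s j (J - {i}) * (w i \<alpha> * c j i))"
      by (subst sum.swap) (simp add: sum_negf)
    finally show ?thesis by simp
  qed
  have weights: "(\<Sum>j\<in>D. w j \<alpha>) + (\<Sum>i\<in>J. w i \<alpha>) = (\<Sum>j<n. w j \<alpha>)"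
    using sum.subset_diff[OF J, of "\<lambda>j. w j \<alpha>"] by (simp add: D_def)
  have "Poly_Mapping.lookup (koszul_diff n (koszul_homotopy n w a) J) m +
      Poly_Mapping.lookup (koszul_homotopy n w (koszul_diff n a) J) m =
    ((\<Sum>j\<in>D. w j \<alpha> * Poly_Mapping.lookup (a J) m) + (\<Sum>i\<in>J. w i \<alpha> * Poly_Mapping.lookup (a J) m)) +
    ((\<Sum>j\<in>D. \<Sum>i\<in>J. s j J * s i (insert j (J - {i})) * (w i \<alpha> * c j i)) +
      (\<Sum>i\<in>J. \<Sum>j\<in>D. s i (J - {i}) * s j (J - {i}) * (w i \<alpha> * c j i)))"
    unfolding first second by (simp only: sum.distrib add.assoc add.left_commute)
  also have "\<dots> = ((\<Sum>j\<in>D. w j \<alpha>) + (\<Sum>i\<in>J. w i \<alpha>)) * Poly_Mapping.lookup (a J) m"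
    by (simp only: cancel add_0_right sum_distrib_right distrib_right)
  also note weights
  finally show ?thesis unfolding \<alpha>_def .
qed

text \<open>
  The double sum over pairs \<open>i \<noteq> j\<close> is antisymmetric.  It is split into \<open>i < j\<close> and \<open>j < i\<close>, so that the two
  halves cancel in every characteristic.
\<close>

lemma koszul_diff_diff:
  fixes a :: "nat set \<Rightarrow> 'k::field mpoly"
  assumes "finite J"
  shows "koszul_diff n (koszul_diff n a) J = 0"
proof -
  define D where "D = {..<n} - J"
  define f where "f j i = koszul_sign j J * (monom_poly (unit_exp j) *
    (koszul_sign i (insert j J) * (monom_poly (unit_exp i) * a (insert i (insert j J)))))" for j i
  have anti: "f j i = - f i j" if "i \<in> D" "j \<in> D" "i \<noteq> j" for i j
  proof -
    have "f j i = koszul_sign j J * koszul_sign i (insert j J) *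
        (monom_poly (unit_exp j) * (monom_poly (unit_exp i) * a (insert i (insert j J))))"
      by (simp add: f_def ac_simps)
    also have "koszul_sign j J * koszul_sign i (insert j J) =
        - (koszul_sign i J * koszul_sign j (insert i J) :: 'k mpoly)"
      using that assms by (intro koszul_sign_swap) (auto simp: D_def)
    finally show ?thesis by (simp add: f_def ac_simps insert_commute)
  qed
  have fin: "finite D" by (simp add: D_def)
  have "koszul_diff n (koszul_diff n a) J = (\<Sum>j\<in>D. \<Sum>i\<in>{..<n} - insert j J. f j i)"
    unfolding koszul_diff_def f_def D_def by (simp only: sum_distrib_left)
  also have "\<dots> = (\<Sum>j\<in>D. (\<Sum>i\<in>{i \<in> D. i < j}. f j i) + (\<Sum>i\<in>{i \<in> D. j < i}. f j i))"
  proof (rule sum.cong[OF refl])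
    fix j assume "j \<in> D"
    have "{..<n} - insert j J = {i \<in> D. i < j} \<union> {i \<in> D. j < i}"
      by (auto simp: D_def)
    then show "(\<Sum>i\<in>{..<n} - insert j J. f j i) = (\<Sum>i\<in>{i \<in> D. i < j}. f j i) + (\<Sum>i\<in>{i \<in> D. j < i}. f j i)"
      using fin by (simp add: sum.union_disjoint[symmetric] disjoint_iff)
  qed
  also have "\<dots> = (\<Sum>j\<in>D. \<Sum>i\<in>{i \<in> D. i < j}. f j i) + (\<Sum>j\<in>D. \<Sum>i\<in>{i \<in> D. j < i}. f j i)"
    by (rule sum.distrib)
  also have "(\<Sum>j\<in>D. \<Sum>i\<in>{i \<in> D. j < i}. f j i) = (\<Sum>i\<in>D. \<Sum>j\<in>{j \<in> D. j < i}. f j i)"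
    using fin by (rule sum.swap_restrict[OF _ fin])
  also have "\<dots> = (\<Sum>i\<in>D. \<Sum>j\<in>{j \<in> D. j < i}. - f i j)"
    by (intro sum.cong refl anti) auto
  finally show ?thesis by (simp add: sum_negf)
qed

section \<open>The Koszul resolution\<close>

lemma koszul_sign_times_ideal:
  assumes "ideal A (mpoly_ring n)" "f \<in> A"
  shows "koszul_sign j J * f \<in> A"
  unfolding koszul_sign_def using assms ideal_mpolyD(4)[OF assms(1)]
  by (cases "even (card {i \<in> J. i < j})") auto

text \<open>
  The chains of degree \<open>i\<close> with coefficients in \<open>A\<close>.  For \<open>A = R\<close> these are the free modules of the
  Koszul complex, and for an ideal \<open>A\<close> they will turn out to be the tensor products of those modules
  with \<open>A\<close>.
\<close>

definition koszul_module :: "nat \<Rightarrow> 'k::field mpoly set \<Rightarrow> nat \<Rightarrow> ('k mpoly, nat set \<Rightarrow> 'k mpoly) module"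
  where "koszul_module n A i =
    \<lparr>carrier = {a. (\<forall>J. a J \<in> A) \<and> (\<forall>J. a J \<noteq> 0 \<longrightarrow> J \<subseteq> {..<n} \<and> card J = i)},
     monoid.mult = undefined, one = undefined, ring.zero = (\<lambda>_. 0), ring.add = (\<lambda>a b J. a J + b J),
     smult = (\<lambda>r a J. r * a J)\<rparr>"

lemma koszul_module_simps [simp]:
  "ring.zero (koszul_module n A i) = (\<lambda>_. 0)"
  "ring.add (koszul_module n A i) = (\<lambda>a b J. a J + b J)"
  "smult (koszul_module n A i) = (\<lambda>r a J. r * a J)"
  by (simp_all add: koszul_module_def)

lemma mem_koszul_module:
  "a \<in> carrier (koszul_module n A i) \<longleftrightarrow>
    (\<forall>J. a J \<in> A) \<and> (\<forall>J. a J \<noteq> 0 \<longrightarrow> J \<subseteq> {..<n} \<and> card J = i)"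
  by (simp add: koszul_module_def)

lemma koszul_moduleD:
  assumes "a \<in> carrier (koszul_module n A i)"
  shows "\<And>J. a J \<in> A" "\<And>J. \<not> J \<subseteq> {..<n} \<Longrightarrow> a J = 0" "\<And>J. card J \<noteq> i \<Longrightarrow> a J = 0"
  using assms by (auto simp: mem_koszul_module)

lemma module_koszul_module:
  assumes A: "ideal A (mpoly_ring n)"
  shows "module (mpoly_ring n) (koszul_module n A i)"
proof (rule moduleI)
  note A = ideal_mpolyD[OF A]
  show "abelian_group (koszul_module n A i)"
  proof (rule abelian_groupI)
    show "\<exists>b\<in>carrier (koszul_module n A i). b \<oplus>\<^bsub>koszul_module n A i\<^esub> a = \<zero>\<^bsub>koszul_module n A i\<^esub>"
      if "a \<in> carrier (koszul_module n A i)" for a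
      using that by (intro bexI[of _ "\<lambda>J. - a J"]) (auto simp: mem_koszul_module A)
  next
    show "a \<oplus>\<^bsub>koszul_module n A i\<^esub> b \<in> carrier (koszul_module n A i)"
      if "a \<in> carrier (koszul_module n A i)" "b \<in> carrier (koszul_module n A i)" for a b
      unfolding mem_koszul_module
    proof (intro conjI allI impI)
      fix J
      show "(a \<oplus>\<^bsub>koszul_module n A i\<^esub> b) J \<in> A"
        using that by (simp add: koszul_moduleD(1) A)
      assume "(a \<oplus>\<^bsub>koszul_module n A i\<^esub> b) J \<noteq> 0"
      then have "a J \<noteq> 0 \<or> b J \<noteq> 0" by auto
      then show "J \<subseteq> {..<n}" "card J = i" using that koszul_moduleD by blast+
    qed
  qed (auto simp: mem_koszul_module A ac_simps)
qed (auto simp: mem_koszul_module ideal_mpolyD[OF A] cring_mpoly_ring algebra_simps)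

lemma koszul_diff_hom:
  assumes A: "ideal A (mpoly_ring n)"
  shows "koszul_diff n \<in> mod_hom (mpoly_ring n) (koszul_module n A (Suc i)) (koszul_module n A i)"
proof (rule mod_homI)
  fix a assume a: "a \<in> carrier (koszul_module n A (Suc i))"
  show "koszul_diff n a \<in> carrier (koszul_module n A i)"
    unfolding mem_koszul_module
  proof (intro conjI allI impI)
    fix J
    show "koszul_diff n a J \<in> A"
      unfolding koszul_diff_def using koszul_moduleD(1)[OF a]
      by (intro ideal_sum_closed[OF A] koszul_sign_times_ideal[OF A] ideal_mpolyD(5)[OF A] monom_poly_carrier)
        auto
    assume "koszul_diff n a J \<noteq> 0"
    then obtain j where "j \<in> {..<n} - J" "a (insert j J) \<noteq> 0"
      unfolding koszul_diff_def by (auto elim!: sum.not_neutral_contains_not_neutral)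
    then have j: "j \<notin> J" "insert j J \<subseteq> {..<n}" "card (insert j J) = Suc i"
      using a by (auto simp: mem_koszul_module)
    moreover have "finite J" using j(2) finite_subset by auto
    ultimately show "J \<subseteq> {..<n}" "card J = i" by auto
  qed
next
  fix a b show "koszul_diff n (a \<oplus>\<^bsub>koszul_module n A (Suc i)\<^esub> b) = koszul_diff n a \<oplus>\<^bsub>koszul_module n A i\<^esub> koszul_diff n b"
    by (rule ext) (simp add: koszul_diff_def distrib_left sum.distrib)
next
  fix r a show "koszul_diff n (r \<odot>\<^bsub>koszul_module n A (Suc i)\<^esub> a) = r \<odot>\<^bsub>koszul_module n A i\<^esub> koszul_diff n a"
    by (rule ext) (simp add: koszul_diff_def sum_distrib_left ac_simps)
qed

lemma koszul_diff_degree_0: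
  assumes "a \<in> carrier (koszul_module n A 0)"
  shows "koszul_diff n a = (\<lambda>_. 0)"
proof -
  have "a (insert j J) = 0" for j J
  proof (cases "finite (insert j J)")
    case True
    then have "card (insert j J) \<noteq> 0" by simp
    then show ?thesis by (rule koszul_moduleD(3)[OF assms])
  next
    case False
    then have "\<not> insert j J \<subseteq> {..<n}" using finite_subset[OF _ finite_lessThan] by blast
    then show ?thesis by (rule koszul_moduleD(2)[OF assms])
  qed
  then show ?thesis by (simp add: koszul_diff_def fun_eq_iff)
qed

text \<open>
  The property of the coefficients that makes the homotopy with weights \<open>w\<close> map chains over \<open>A\<close> to chains
  over \<open>B\<close>.
\<close>

definition lowers_into ::
    "nat \<Rightarrow> (nat \<Rightarrow> (nat \<Rightarrow>\<^sub>0 nat) \<Rightarrow> 'k) \<Rightarrow> 'k::field mpoly set \<Rightarrow> 'k mpoly set \<Rightarrow> bool"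
  where "lowers_into n w A B \<longleftrightarrow>
    (\<forall>j J f. J \<subseteq> {..<n} \<longrightarrow> j < n \<longrightarrow> j \<notin> J \<longrightarrow> f \<in> A \<longrightarrow> divide_var (\<lambda>m. w j (m + subset_exp J)) j f \<in> B)"

definition homotopy_weights :: "nat \<Rightarrow> (nat \<Rightarrow> (nat \<Rightarrow>\<^sub>0 nat) \<Rightarrow> 'k::field) \<Rightarrow> bool"
  where "homotopy_weights n w \<longleftrightarrow>
    (\<forall>j \<alpha>. Poly_Mapping.lookup \<alpha> j = 0 \<longrightarrow> w j \<alpha> = 0) \<and>
    (\<forall>\<alpha>. \<alpha> \<noteq> 0 \<longrightarrow> Poly_Mapping.keys \<alpha> \<subseteq> {..<n} \<longrightarrow> (\<Sum>j<n. w j \<alpha>) = 1)"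

lemma koszul_homotopy_chain:
  assumes B: "ideal B (mpoly_ring n)" and low: "lowers_into n w A B"
    and a: "a \<in> carrier (koszul_module n A i)"
  shows "koszul_homotopy n w a \<in> carrier (koszul_module n B (Suc i))"
  unfolding mem_koszul_module
proof (intro conjI allI impI)
  fix J
  show "koszul_homotopy n w a J \<in> B"
  proof (cases "J \<subseteq> {..<n}")
    case True
    have "divide_var (\<lambda>m. w j (m + subset_exp (J - {j}))) j (a (J - {j})) \<in> B" if "j \<in> J" for j
      using low True that koszul_moduleD(1)[OF a] unfolding lowers_into_def by blast
    then show ?thesis
      using True by (simp add: koszul_homotopy_def ideal_sum_closed[OF B] koszul_sign_times_ideal[OF B])
  qed (simp add: koszul_homotopy_def ideal_mpolyD[OF B])
  assume nz: "koszul_homotopy n w a J \<noteq> 0"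
  then show J: "J \<subseteq> {..<n}" by (metis koszul_homotopy_def)
  obtain j where j: "j \<in> J" "koszul_sign j (J - {j}) *
      divide_var (\<lambda>m. w j (m + subset_exp (J - {j}))) j (a (J - {j})) \<noteq> 0"
    using nz J by (auto simp: koszul_homotopy_def elim!: sum.not_neutral_contains_not_neutral)
  have "a (J - {j}) \<noteq> 0"
  proof
    assume "a (J - {j}) = 0"
    with j(2) show False by (simp add: divide_var_zero)
  qed
  then have "card (J - {j}) = i" using koszul_moduleD(3)[OF a] by blast
  moreover have "finite J" using J finite_subset by auto
  ultimately show "card J = Suc i" using j(1) by (metis card.remove)
qed

text \<open>
  The homotopy contracts all multidegrees except \<open>0\<close>; the condition on \<open>a {}\<close> says that this component
  of \<open>a\<close> vanishes.
\<close>

lemma koszul_cycle_boundary: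
  assumes A: "A \<subseteq> carrier (mpoly_ring n)" and w: "homotopy_weights n w"
    and a: "a \<in> carrier (koszul_module n A i)"
    and cycle: "koszul_diff n a = (\<lambda>_. 0)" and const: "Poly_Mapping.lookup (a {}) 0 = 0"
  shows "koszul_diff n (koszul_homotopy n w a) = a"
proof
  fix J
  show "koszul_diff n (koszul_homotopy n w a) J = a J"
  proof (cases "J \<subseteq> {..<n}")
    case False
    then have "\<not> insert j J \<subseteq> {..<n}" for j by blast
    then show ?thesis
      using False koszul_moduleD(2)[OF a] by (simp add: koszul_diff_def koszul_homotopy_def)
  next
    case True
    show ?thesis
    proof (rule poly_mapping_eqI)
      fix m
      have "Poly_Mapping.lookup (koszul_homotopy n w (koszul_diff n a) J) m = 0"
        unfolding cycle by (simp add: koszul_homotopy_def divide_var_zero)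
      then have eq: "Poly_Mapping.lookup (koszul_diff n (koszul_homotopy n w a) J) m =
          (\<Sum>j<n. w j (m + subset_exp J)) * Poly_Mapping.lookup (a J) m"
        using koszul_homotopy_identity[OF True, of w a m] w unfolding homotopy_weights_def by simp
      have fin: "finite J" using True finite_subset by auto
      show "Poly_Mapping.lookup (koszul_diff n (koszul_homotopy n w a) J) m = Poly_Mapping.lookup (a J) m"
      proof (cases "Poly_Mapping.lookup (a J) m = 0")
        case False
        have "a J \<in> carrier (mpoly_ring n)" using koszul_moduleD(1)[OF a] A by blast
        then have "Poly_Mapping.keys m \<subseteq> {..<n}" using False by (simp add: mem_mpoly_ring)
        moreover have "Poly_Mapping.keys (subset_exp J) \<subseteq> {..<n}"
          using True keys_subset_exp[OF fin] by simp
        ultimately have keys: "Poly_Mapping.keys (m + subset_exp J) \<subseteq> {..<n}"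
          by (simp add: keys_add_nat)
        \<comment> \<open>Multidegree \<open>0\<close> would force \<open>J = {}\<close> and \<open>m = 0\<close>, where \<open>a\<close> has no coefficient.\<close>
        have "m + subset_exp J \<noteq> 0"
        proof
          assume zero: "m + subset_exp J = 0"
          have "Poly_Mapping.lookup m i + Poly_Mapping.lookup (subset_exp J) i = 0" for i
            using arg_cong[OF zero, of "\<lambda>x. Poly_Mapping.lookup x i"] by (simp add: lookup_add)
          then have coord: "Poly_Mapping.lookup m i = 0 \<and> Poly_Mapping.lookup (subset_exp J) i = 0" for i
            by (simp only: add_is_0)
          then have "i \<notin> J" for i
            using lookup_subset_exp[OF fin, of i] by (metis zero_neq_one)
          then have "J = {}" by blast
          moreover have "m = 0" by (rule poly_mapping_eqI) (simp add: coord)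
          ultimately have "m = 0" "J = {}" by blast+
          then show False using const False by simp
        qed
        then show ?thesis using eq keys w unfolding homotopy_weights_def by simp
      qed (simp add: eq)
    qed
  qed
qed

definition min_support_weights :: "nat \<Rightarrow> (nat \<Rightarrow>\<^sub>0 nat) \<Rightarrow> 'k::field"
  where "min_support_weights j \<alpha> = (if \<alpha> \<noteq> 0 \<and> j = Min (Poly_Mapping.keys \<alpha>) then 1 else 0)"

lemma homotopy_weights_min_support: "homotopy_weights n min_support_weights"
  unfolding homotopy_weights_def
proof (intro conjI allI impI)
  have Min: "Min (Poly_Mapping.keys \<alpha>) \<in> Poly_Mapping.keys \<alpha>" if "\<alpha> \<noteq> 0" for \<alpha> :: "nat \<Rightarrow>\<^sub>0 nat"
    using that by (intro Min_in) auto
  show "min_support_weights j \<alpha> = 0" if "Poly_Mapping.lookup \<alpha> j = 0" for j \<alpha>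
    using that Min[of \<alpha>] by (auto simp: min_support_weights_def in_keys_iff)
  show "(\<Sum>j<n. min_support_weights j \<alpha>) = 1" if "\<alpha> \<noteq> 0" "Poly_Mapping.keys \<alpha> \<subseteq> {..<n}" for \<alpha>
    using that(1) subsetD[OF that(2) Min[OF that(1)]] by (simp add: min_support_weights_def)
qed

lemma koszul_module_finsum:
  assumes A: "ideal A (mpoly_ring n)" and S: "finite S"
    and g: "\<And>x. x \<in> S \<Longrightarrow> g x \<in> carrier (koszul_module n A i)"
  shows "(\<Oplus>\<^bsub>koszul_module n A i\<^esub>x\<in>S. g x) J = (\<Sum>x\<in>S. g x J)"
proof -
  interpret module "mpoly_ring n" "koszul_module n A i" by (rule module_koszul_module[OF A])
  show ?thesis using S g
    by (induction S) (simp_all add: Pi_def)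
qed

definition koszul_basis :: "nat set \<Rightarrow> nat set \<Rightarrow> 'k::field mpoly"
  where "koszul_basis J J' = (if J' = J then 1 else 0)"

definition koszul_index :: "nat \<Rightarrow> nat \<Rightarrow> nat set set"
  where "koszul_index n i = {J. J \<subseteq> {..<n} \<and> card J = i}"

lemma finite_koszul_index: "finite (koszul_index n i)"
  unfolding koszul_index_def by (rule finite_subset[of _ "Pow {..<n}"]) auto

lemma koszul_basis_carrier:
  "J \<in> koszul_index n i \<Longrightarrow> koszul_basis J \<in> carrier (koszul_module n (carrier (mpoly_ring n)) i)"
  by (auto simp: mem_koszul_module koszul_basis_def koszul_index_def mpoly_ring_closed)

lemma projective_koszul_module:
  "projective_module TYPE(nat set) (mpoly_ring n :: 'k::field mpoly ring) (koszul_module n (carrier (mpoly_ring n)) i)"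
proof -
  let ?R = "mpoly_ring n :: 'k mpoly ring" and ?K = "koszul_module n (carrier (mpoly_ring n :: 'k mpoly ring)) i"
  note R = ideal_carrier_mpoly[where 'a = 'k, of n]
  interpret module ?R ?K by (rule module_koszul_module[OF R])
  have "dual_basis ?R ?K (koszul_index n i) koszul_basis (\<lambda>a. a)"
    unfolding dual_basis_def
  proof (intro conjI ballI)
    show "koszul_basis \<in> koszul_index n i \<rightarrow> carrier ?K"
      using koszul_basis_carrier by auto
    fix a assume a: "a \<in> carrier ?K"
    show "a \<in> koszul_index n i \<rightarrow> carrier ?R" using koszul_moduleD(1)[OF a] by simp
    show fin: "finite {J \<in> koszul_index n i. a J \<noteq> \<zero>\<^bsub>?R\<^esub>}" using finite_koszul_index by simp
    show "lincomb ?R ?K (koszul_index n i) koszul_basis a = a"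
    proof
      fix J
      let ?S = "{J \<in> koszul_index n i. a J \<noteq> \<zero>\<^bsub>?R\<^esub>}"
      have "lincomb ?R ?K (koszul_index n i) koszul_basis a J = (\<Sum>J'\<in>?S. (a J' \<odot>\<^bsub>?K\<^esub> koszul_basis J') J)"
        unfolding lincomb_def using koszul_moduleD(1)[OF a] koszul_basis_carrier[of _ n i] 
        by (intro koszul_module_finsum[OF R fin] smult_closed) auto
      also have "\<dots> = (\<Sum>J'\<in>?S. if J' = J then a J' else 0)"
        by (intro sum.cong refl) (simp add: koszul_basis_def)
      also have "\<dots> = a J"
        using a fin by (auto simp: koszul_index_def mem_koszul_module)
      finally show "lincomb ?R ?K (koszul_index n i) koszul_basis a J = a J" .
    qed
  qed simp_all
  then show ?thesis
    unfolding projective_module_def using module_axioms by blast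
qed

lemma lowers_into_carrier: "lowers_into n w (carrier (mpoly_ring n)) (carrier (mpoly_ring n))"
  unfolding lowers_into_def by (auto intro: divide_var_carrier)

text \<open>
  Exactness uses the homotopy with coefficients in \<open>R\<close> itself.  Its only defect, in multidegree \<open>0\<close>, is
  the residue field in degree \<open>0\<close>.
\<close>

theorem koszul_resolution:
  "resolution (mpoly_ring n :: 'k::field mpoly ring) (quotient_module (mpoly_ring n) (graded_max_ideal n))
    (koszul_module n (carrier (mpoly_ring n))) (\<lambda>_. koszul_diff n)
    (\<lambda>a. graded_max_ideal n +>\<^bsub>mpoly_ring n\<^esub> a {})"
proof -
  let ?R = "mpoly_ring n :: 'k mpoly ring" and ?m = "graded_max_ideal n :: 'k mpoly set"
  let ?K = "koszul_module n (carrier ?R)" and ?e = "\<lambda>a. ?m +>\<^bsub>?R\<^esub> a {}"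
  let ?k = "quotient_module ?R ?m"
  note RR = ideal_carrier_mpoly[where 'a = 'k, of n]
  interpret m: ideal ?m ?R by (rule graded_max_ideal_ideal)
  interpret Q: ring "?R Quot ?m" by (rule m.quotient_is_ring)
  interpret h: ring_hom_ring ?R "?R Quot ?m" "(+>\<^bsub>?R\<^esub>) ?m" by (rule m.rcos_ring_hom_ring)
  have quot: "carrier ?k = carrier (?R Quot ?m)" "ring.add ?k = ring.add (?R Quot ?m)"
    "\<zero>\<^bsub>?k\<^esub> = ?m" "smult ?k = (\<lambda>r A. (?m +>\<^bsub>?R\<^esub> r) \<otimes>\<^bsub>?R Quot ?m\<^esub> A)"
    by (simp_all add: quotient_module_def FactRing_def)
  have e_zero: "?e a = ?m \<longleftrightarrow> a {} \<in> ?m" if "a \<in> carrier (?K 0)" for a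
    using koszul_moduleD(1)[OF that, of "{}"] m.a_coset_join1[OF _ _ m.a_subgroup]
      m.a_coset_join2[OF _ m.a_subgroup] by blast
  have complex: "augmented_complex ?R ?k ?K (\<lambda>_. koszul_diff n) ?e"
  proof (rule augmented_complex.intro)
    show "module ?R ?k" by (rule module_quotient_module[OF graded_max_ideal_ideal cring_mpoly_ring])
    show "module ?R (?K i)" for i by (rule module_koszul_module[OF RR])
    show diff: "koszul_diff n \<in> mod_hom ?R (?K (Suc i)) (?K i)" for i by (rule koszul_diff_hom[OF RR])
    show "?e \<in> mod_hom ?R (?K 0) ?k"
    proof (rule mod_homI)
      fix a assume a: "a \<in> carrier (?K 0)"
      show "?e a \<in> carrier ?k" using h.hom_closed[OF koszul_moduleD(1)[OF a]] by (simp add: quot)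
      show "?e (a \<oplus>\<^bsub>?K 0\<^esub> b) = ?e a \<oplus>\<^bsub>?k\<^esub> ?e b" if b: "b \<in> carrier (?K 0)" for b
        using h.hom_add[OF koszul_moduleD(1)[OF a] koszul_moduleD(1)[OF b]] by (simp add: quot)
      show "?e (r \<odot>\<^bsub>?K 0\<^esub> a) = r \<odot>\<^bsub>?k\<^esub> ?e a" if r: "r \<in> carrier ?R" for r
        using h.hom_mult[OF r koszul_moduleD(1)[OF a]] by (simp add: quot)
    qed
    fix i a assume a: "a \<in> carrier (?K (Suc i))"
    have d: "koszul_diff n a \<in> carrier (?K i)" by (rule mod_homD(1)[OF diff a])
    show "koszul_diff n a \<in> augmented_cycles ?k ?K (\<lambda>_. koszul_diff n) ?e i"
    proof (cases i)
      case 0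
      have x: "monom_poly (unit_exp j) \<in> ?m" if "j < n" for j
        by (rule var_in_graded_max_ideal[OF that])
      have "koszul_diff n a {} \<in> ?m"
        unfolding koszul_diff_def
      proof (intro ideal_sum_closed[OF graded_max_ideal_ideal] koszul_sign_times_ideal[OF graded_max_ideal_ideal])
        fix j assume "j \<in> {..<n} - {}"
        then show "monom_poly (unit_exp j) * a {j} \<in> ?m"
          using ideal_mpolyD(5)[OF graded_max_ideal_ideal koszul_moduleD(1)[OF a] x[of j]] by (simp add: mult.commute)
      qed
      then have "?e (koszul_diff n a) = ?m" using e_zero[of "koszul_diff n a"] d 0 by blast
      with d show ?thesis
        unfolding 0 augmented_cycles_def a_kernel_def' nat.case quot by blast
    next
      case (Suc l)
      have "koszul_diff n (koszul_diff n a) J = 0" for J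
      proof (cases "finite J")
        case False
        then have "\<not> J \<subseteq> {..<n}" using finite_subset by blast
        then show ?thesis
          using koszul_moduleD(2)[OF mod_homD(1)[OF diff, of _ l]] d Suc by blast
      qed (rule koszul_diff_diff)
      then have "koszul_diff n (koszul_diff n a) = \<zero>\<^bsub>?K l\<^esub>" by (simp add: fun_eq_iff)
      with d show ?thesis
        unfolding Suc augmented_cycles_def a_kernel_def' nat.case by blast
    qed
  qed
  show ?thesis
  proof (rule resolution.intro[OF complex resolution_axioms.intro])
    show "carrier ?k \<subseteq> ?e ` carrier (?K 0)"
    proof
      fix A assume "A \<in> carrier ?k"
      then obtain r where r: "r \<in> carrier ?R" "A = ?m +>\<^bsub>?R\<^esub> r"
        unfolding quot FactRing_def A_RCOSETS_def' by auto
      define a where "a J = (if J = {} then r else 0)" for J :: "nat set"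
      have "a \<in> carrier (?K 0)"
        using r(1) by (auto simp: mem_koszul_module a_def mpoly_ring_closed)
      moreover have "A = ?e a" using r(2) by (simp add: a_def)
      ultimately show "A \<in> ?e ` carrier (?K 0)" by blast
    qed
    fix i
    show "augmented_cycles ?k ?K (\<lambda>_. koszul_diff n) ?e i \<subseteq> koszul_diff n ` carrier (?K (Suc i))"
    proof
      fix a assume a: "a \<in> augmented_cycles ?k ?K (\<lambda>_. koszul_diff n) ?e i"
      have carr: "a \<in> carrier (?K i)"
        by (rule augmented_complex.cycles_carrier[OF complex a])
      have "koszul_diff n a = (\<lambda>_. 0) \<and> Poly_Mapping.lookup (a {}) 0 = 0"
      proof (cases i)
        case 0
        then have diff0: "koszul_diff n a = (\<lambda>_. 0)" using koszul_diff_degree_0 carr by blast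
        have "a {} \<in> ?m"
          using a carr e_zero[of a] unfolding 0 augmented_cycles_def a_kernel_def' nat.case quot by blast
        then have "Poly_Mapping.lookup (a {}) 0 = 0" unfolding graded_max_ideal_eq by blast
        with diff0 show ?thesis by blast
      next
        case (Suc l)
        have "koszul_diff n a = \<zero>\<^bsub>?K l\<^esub>"
          using a unfolding Suc augmented_cycles_def a_kernel_def' nat.case by blast
        moreover have "a {} = 0" using koszul_moduleD(3)[OF carr, of "{}"] Suc by simp
        ultimately show ?thesis by simp
      qed
      then have bd: "koszul_diff n (koszul_homotopy n min_support_weights a) = a"
        by (intro koszul_cycle_boundary[OF subset_refl homotopy_weights_min_support carr]) blast+
      have "koszul_homotopy n min_support_weights a \<in> carrier (?K (Suc i))"
        by (rule koszul_homotopy_chain[OF RR lowers_into_carrier carr])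
      from imageI[OF this, of "koszul_diff n"] show "a \<in> koszul_diff n ` carrier (?K (Suc i))"
        unfolding bd .
    qed
  qed
qed

section \<open>Koszul homology with coefficients in an ideal\<close>

lemma hom_finprod:
  assumes "comm_group G" "comm_group H" and h: "h \<in> hom G H"
    and S: "finite S" and f: "\<And>x. x \<in> S \<Longrightarrow> f x \<in> carrier G"
  shows "h (finprod G f S) = finprod H (\<lambda>x. h (f x)) S"
proof -
  interpret G: comm_group G by fact
  interpret H: comm_group H by fact
  show ?thesis using S f
  proof (induction S)
    case empty
    show ?case using hom_one[OF h G.is_group H.is_group] by simp
  next
    case (insert x S)
    then show ?case
      using hom_in_carrier[OF h] by (simp add: Pi_def hom_mult[OF h])
  qed
qed

text \<open>
  The identification of \<open>K\<^sub>i \<otimes> A\<close> with chains with coefficients in \<open>A\<close>.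
\<close>

definition koszul_evaluation ::
    "nat \<Rightarrow> 'k::field mpoly set \<Rightarrow> nat \<Rightarrow> (((nat set \<Rightarrow> 'k mpoly) \<times> 'k mpoly \<Rightarrow>\<^sub>0 int) set \<Rightarrow> nat set \<Rightarrow> 'k mpoly) \<Rightarrow> bool"
  where "koszul_evaluation n A i ev \<longleftrightarrow>
    (let R = mpoly_ring n; K = koszul_module n (carrier R) i; T = tensor R K (ideal_module R A)
     in ev \<in> hom T (add_monoid (koszul_module n A i)) \<and>
       (\<forall>x\<in>carrier K. \<forall>y\<in>A. ev (pure_tensor R K (ideal_module R A) x y) = (\<lambda>J. x J * y)) \<and>
       bij_betw ev (carrier T) (carrier (koszul_module n A i)))"

lemma koszul_evaluationD:
  assumes "koszul_evaluation n A i ev"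
  defines "R \<equiv> mpoly_ring n"
  shows "ev \<in> hom (tensor R (koszul_module n (carrier R) i) (ideal_module R A)) (add_monoid (koszul_module n A i))"
    "\<And>x y. x \<in> carrier (koszul_module n (carrier R) i) \<Longrightarrow> y \<in> A \<Longrightarrow>
      ev (pure_tensor R (koszul_module n (carrier R) i) (ideal_module R A) x y) = (\<lambda>J. x J * y)"
    "bij_betw ev (carrier (tensor R (koszul_module n (carrier R) i) (ideal_module R A)))
      (carrier (koszul_module n A i))"
  using assms unfolding koszul_evaluation_def Let_def by auto

text \<open>
  The products \<open>x y\<close> depend on \<open>(x, y)\<close> in a balanced way, which gives the map.  The inverse sends \<open>a\<close> to
  \<open>\<Sum>\<^sub>J e\<^sub>J \<otimes> a\<^sub>J\<close>.
\<close>

lemma koszul_evaluation_exists: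
  fixes A :: "'k::field mpoly set"
  assumes A: "ideal A (mpoly_ring n)"
  shows "\<exists>ev. koszul_evaluation n A i ev"
proof -
  define R where "R = (mpoly_ring n :: 'k mpoly ring)"
  let ?K = "koszul_module n (carrier R) i" and ?M = "ideal_module R A"
  let ?T = "tensor R ?K ?M" and ?p = "pure_tensor R ?K ?M" and ?G = "add_monoid (koszul_module n A i)"
  have RR: "ideal (carrier R) (mpoly_ring n)" unfolding R_def by (rule ideal_carrier_mpoly)
  have modK: "module R ?K" and modM: "module R ?M" and modG: "module R (koszul_module n A i)"
    unfolding R_def by (intro module_koszul_module module_ideal_module A ideal_carrier_mpoly)+
  interpret KM: module_pair R ?K ?M by (rule module_pair.intro[OF modK modM])
  interpret KA: module R "koszul_module n A i" by (rule modG)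
  interpret T: comm_group ?T by (rule KM.comm_group_tensor)
  have G: "comm_group ?G" by (rule KA.M.a_comm_group)
  note bal = balanced_mapD[OF KM.balanced_pure]
  have chain: "(\<lambda>J. x J * y) \<in> carrier (koszul_module n A i)" if "x \<in> carrier ?K" "y \<in> A" for x y
    using that unfolding mem_koszul_module R_def by (auto simp: ideal_mpolyD(5)[OF A])
  have "balanced_map R ?K ?M ?G (\<lambda>x y J. x J * y)"
  proof (rule balanced_mapI)
    show "(\<lambda>J. x J * y) \<in> carrier ?G" if "x \<in> carrier ?K" "y \<in> carrier ?M" for x y
      using chain that by simp
  qed (simp_all add: R_def algebra_simps)
  then obtain ev where ev: "ev \<in> hom ?T ?G"
    and ev_pure: "\<And>x y. x \<in> carrier ?K \<Longrightarrow> y \<in> A \<Longrightarrow> ev (?p x y) = (\<lambda>J. x J * y)"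
    using KM.tensor_universal[OF G] by (metis ideal_module_simps(1))
  define sec where "sec a = finprod ?T (\<lambda>J. ?p (koszul_basis J) (a J)) (koszul_index n i)" for a
  have basis: "koszul_basis J \<in> carrier ?K" if "J \<in> koszul_index n i" for J
    using koszul_basis_carrier[OF that] unfolding R_def .
  have pure_closed: "?p (koszul_basis J) (a J) \<in> carrier ?T"
    if "a \<in> carrier (koszul_module n A i)" "J \<in> koszul_index n i" for a J
    using bal(1)[OF basis[OF that(2)]] koszul_moduleD(1)[OF that(1)] by simp
  have sec_closed: "sec a \<in> carrier ?T" if "a \<in> carrier (koszul_module n A i)" for a
    unfolding sec_def using pure_closed[OF that] by (intro T.finprod_closed) auto
  have sec: "sec \<in> hom ?G ?T"
  proof (rule homI)
    show "sec a \<in> carrier ?T" if "a \<in> carrier ?G" for a using sec_closed that by simp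
    fix a b assume a: "a \<in> carrier ?G" and b: "b \<in> carrier ?G"
    have "sec (a \<otimes>\<^bsub>?G\<^esub> b) =
        finprod ?T (\<lambda>J. ?p (koszul_basis J) (a J) \<otimes>\<^bsub>?T\<^esub> ?p (koszul_basis J) (b J)) (koszul_index n i)"
      unfolding sec_def
    proof (rule T.finprod_cong')
      fix J assume J: "J \<in> koszul_index n i"
      show "?p (koszul_basis J) ((a \<otimes>\<^bsub>?G\<^esub> b) J) = ?p (koszul_basis J) (a J) \<otimes>\<^bsub>?T\<^esub> ?p (koszul_basis J) (b J)"
        using bal(3)[OF basis[OF J], of "a J" "b J"] koszul_moduleD(1)[of a n A i J]
          koszul_moduleD(1)[of b n A i J] a b by (simp add: R_def)
    qed (use a b pure_closed in auto)
    also have "\<dots> = sec a \<otimes>\<^bsub>?T\<^esub> sec b"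
      unfolding sec_def using a b pure_closed by (intro T.finprod_multf) auto
    finally show "sec (a \<otimes>\<^bsub>?G\<^esub> b) = sec a \<otimes>\<^bsub>?T\<^esub> sec b" .
  qed
  have sum_basis: "(\<Sum>J'\<in>koszul_index n i. koszul_basis J' J * a J') = a J"
    if "a \<in> carrier (koszul_module n A' i)" for a J and A' :: "'k mpoly set"
  proof -
    have "(\<Sum>J'\<in>koszul_index n i. koszul_basis J' J * a J') = (\<Sum>J'\<in>koszul_index n i. if J' = J then a J' else 0)"
      by (intro sum.cong refl) (simp add: koszul_basis_def)
    also have "\<dots> = a J"
      using koszul_moduleD(2,3)[OF that, of J] finite_koszul_index[of n i] by (auto simp: koszul_index_def)
    finally show ?thesis .
  qed
  have ev_sec: "ev (sec a) = a" if a: "a \<in> carrier (koszul_module n A i)" for a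
  proof
    fix J
    have "ev (sec a) = finprod ?G (\<lambda>J. ev (?p (koszul_basis J) (a J))) (koszul_index n i)"
      unfolding sec_def
      by (rule hom_finprod[OF T.comm_group_axioms G ev finite_koszul_index pure_closed[OF a]])
    also have "\<dots> = finprod ?G (\<lambda>J J'. koszul_basis J J' * a J) (koszul_index n i)"
      using chain[OF basis koszul_moduleD(1)[OF a]] koszul_moduleD(1)[OF a] basis
      by (intro comm_monoid.finprod_cong'[OF comm_group.axioms(1)[OF G]]) (auto simp: ev_pure)
    also have "\<dots> = (\<Oplus>\<^bsub>koszul_module n A i\<^esub>J\<in>koszul_index n i. (\<lambda>J'. koszul_basis J J' * a J))"
      by (simp add: finsum_def)
    finally have "ev (sec a) J = (\<Oplus>\<^bsub>koszul_module n A i\<^esub>J\<in>koszul_index n i. (\<lambda>J'. koszul_basis J J' * a J)) J"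
      by (rule fun_cong)
    also have "\<dots> = (\<Sum>J'\<in>koszul_index n i. koszul_basis J' J * a J')"
      using chain[OF basis koszul_moduleD(1)[OF a]]
      by (rule koszul_module_finsum[OF A finite_koszul_index])
    also have "\<dots> = a J" by (rule sum_basis[OF a])
    finally show "ev (sec a) J = a J" .
  qed
  have sec_ev: "sec (ev z) = z" if z: "z \<in> carrier ?T" for z
  proof -
    have comp: "sec \<circ> ev \<in> hom ?T ?T" by (rule hom_compose[OF ev sec])
    have id: "(\<lambda>z. z) \<in> hom ?T ?T" by (rule homI) simp_all
    have "(sec \<circ> ev) z = z"
    proof (rule KM.tensor_ext[OF T.is_group comp id _ z])
      fix x y assume x: "x \<in> carrier ?K" and y: "y \<in> carrier ?M"
      have xJ: "x J \<in> carrier R" for J by (rule koszul_moduleD(1)[OF x])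
      have py: "(\<lambda>x. ?p x y) \<in> hom (add_monoid ?K) ?T"
        using bal(1,2) y by (intro homI) simp_all
      have "(sec \<circ> ev) (?p x y) = finprod ?T (\<lambda>J. ?p (koszul_basis J) (x J * y)) (koszul_index n i)"
        using ev_pure[OF x] y by (simp add: sec_def)
      also have "\<dots> = finprod ?T (\<lambda>J. ?p (x J \<odot>\<^bsub>?K\<^esub> koszul_basis J) y) (koszul_index n i)"
      proof (rule T.finprod_cong')
        fix J assume J: "J \<in> koszul_index n i"
        show "?p (koszul_basis J) (x J * y) = ?p (x J \<odot>\<^bsub>?K\<^esub> koszul_basis J) y"
          using bal(4)[OF xJ basis[OF J] y] by (simp add: R_def)
      qed (use bal(1)[OF module.smult_closed[OF modK xJ basis] y] in auto)
      also have "\<dots> = ?p (finprod (add_monoid ?K) (\<lambda>J. x J \<odot>\<^bsub>?K\<^esub> koszul_basis J) (koszul_index n i)) y"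
        by (rule hom_finprod[OF abelian_group.a_comm_group[OF module.axioms(2)[OF modK]] T.comm_group_axioms py finite_koszul_index, symmetric])
          (use module.smult_closed[OF modK xJ basis] in simp)
      also have "finprod (add_monoid ?K) (\<lambda>J. x J \<odot>\<^bsub>?K\<^esub> koszul_basis J) (koszul_index n i) = x"
      proof
        fix J
        have "finprod (add_monoid ?K) (\<lambda>J. x J \<odot>\<^bsub>?K\<^esub> koszul_basis J) (koszul_index n i) J =
            (\<Oplus>\<^bsub>?K\<^esub>J\<in>koszul_index n i. x J \<odot>\<^bsub>?K\<^esub> koszul_basis J) J"
          by (simp add: finsum_def)
        also have "\<dots> = (\<Sum>J'\<in>koszul_index n i. (x J' \<odot>\<^bsub>?K\<^esub> koszul_basis J') J)"
          by (rule koszul_module_finsum[OF RR finite_koszul_index module.smult_closed[OF modK xJ basis]])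
        also have "\<dots> = (\<Sum>J'\<in>koszul_index n i. koszul_basis J' J * x J')"
          by (simp add: mult.commute)
        also have "\<dots> = x J" by (rule sum_basis[OF x])
        finally show "finprod (add_monoid ?K) (\<lambda>J. x J \<odot>\<^bsub>?K\<^esub> koszul_basis J) (koszul_index n i) J = x J" .
      qed
      finally show "(sec \<circ> ev) (?p x y) = ?p x y" .
    qed
    then show ?thesis by simp
  qed
  have "bij_betw ev (carrier ?T) (carrier (koszul_module n A i))"
  proof (rule bij_betw_byWitness[where f' = sec])
    show "ev ` carrier ?T \<subseteq> carrier (koszul_module n A i)"
      using hom_in_carrier[OF ev] by auto
    show "sec ` carrier (koszul_module n A i) \<subseteq> carrier ?T" using sec_closed by blast
  qed (use sec_ev ev_sec in blast)+
  with ev ev_pure have "koszul_evaluation n A i ev"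
    unfolding koszul_evaluation_def Let_def R_def by simp
  then show ?thesis by (intro exI[of _ ev])
qed

lemma koszul_evaluation_diff:
  fixes A :: "'k::field mpoly set" and n i :: nat
  defines "R \<equiv> mpoly_ring n :: 'k mpoly ring"
  assumes A: "ideal A (mpoly_ring n)"
    and ev1: "koszul_evaluation n A (Suc i) ev1" and ev0: "koszul_evaluation n A i ev0"
    and z: "z \<in> carrier (tensor R (koszul_module n (carrier R) (Suc i)) (ideal_module R A))"
  shows "ev0 (tensor_map R (koszul_module n (carrier R) i) (ideal_module R A) (koszul_diff n) (\<lambda>x. x) z) =
    koszul_diff n (ev1 z)"
proof -
  let ?K = "\<lambda>i. koszul_module n (carrier R) i" and ?M = "ideal_module R A"
  let ?d = "tensor_map R (?K i) ?M (koszul_diff n) (\<lambda>x. x)"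
  have modK: "module R (?K i)" and modM: "module R ?M" and modG: "module R (koszul_module n A i)" for i
    unfolding R_def by (intro module_koszul_module module_ideal_module A ideal_carrier_mpoly)+
  interpret KA: module R "koszul_module n A i" by (rule modG)
  have diff: "koszul_diff n \<in> mod_hom R (?K (Suc i)) (?K i)"
    unfolding R_def by (rule koszul_diff_hom[OF ideal_carrier_mpoly])
  interpret m: tensor_maps R "?K (Suc i)" ?M "?K i" ?M "koszul_diff n" "\<lambda>x. x"
    by (intro tensor_mapsI modK modM diff mod_hom_id)
  note ev1 = koszul_evaluationD[OF ev1, folded R_def] and ev0 = koszul_evaluationD[OF ev0, folded R_def]
  have h1: "ev0 \<circ> ?d
      \<in> hom (tensor R (?K (Suc i)) ?M) (add_monoid (koszul_module n A i))"
    by (rule hom_compose[OF m.tensor_map_hom ev0(1)])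
  have "koszul_diff n \<in> hom (add_monoid (koszul_module n A (Suc i))) (add_monoid (koszul_module n A i))"
    using mod_homD[OF koszul_diff_hom[OF A, of i]] by (intro homI) simp_all
  from hom_compose[OF ev1(1) this]
  have h2: "koszul_diff n \<circ> ev1 \<in> hom (tensor R (?K (Suc i)) ?M) (add_monoid (koszul_module n A i))" .
  have "(ev0 \<circ> ?d) z = (koszul_diff n \<circ> ev1) z"
  proof (rule m.A.tensor_ext[OF KA.M.a_group h1 h2 _ z])
    fix x y assume x: "x \<in> carrier (?K (Suc i))" and y: "y \<in> carrier ?M"
    have "(ev0 \<circ> ?d) (pure_tensor R (?K (Suc i)) ?M x y) =
        (\<lambda>J. koszul_diff n x J * y)"
      using m.tensor_map_pure[OF x y] ev0(2)[OF mod_homD(1)[OF diff x], of y] y by simp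
    also have "\<dots> = koszul_diff n (\<lambda>J. x J * y)"
      by (rule ext) (simp add: koszul_diff_def sum_distrib_right mult.assoc)
    also have "\<dots> = (koszul_diff n \<circ> ev1) (pure_tensor R (?K (Suc i)) ?M x y)"
      using ev1(2)[OF x, of y] y by simp
    finally show "(ev0 \<circ> ?d) (pure_tensor R (?K (Suc i)) ?M x y) =
        (koszul_diff n \<circ> ev1) (pure_tensor R (?K (Suc i)) ?M x y)" .
  qed
  then show ?thesis by simp
qed

text \<open>
  A cycle of \<open>K \<otimes> A\<close> is a Koszul cycle \<open>a\<close> with coefficients in \<open>A\<close>, and the homotopy writes it as the
  boundary of a chain with coefficients in \<open>B\<close>.  The component of multidegree \<open>0\<close> is absent because
  \<open>A \<subseteq> \<mm>\<close>.
\<close>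

theorem tor_vanishing_by_weights:
  fixes A B :: "'k::field mpoly set"
  assumes A: "ideal A (mpoly_ring n)" and B: "ideal B (mpoly_ring n)" and AB: "A \<subseteq> B"
    and m: "A \<subseteq> graded_max_ideal n"
    and w: "homotopy_weights n w" and low: "lowers_into n w A B"
  shows "tor_vanishing TYPE('f) (mpoly_ring n) (graded_max_ideal n)
    (ideal_module (mpoly_ring n) A) (ideal_module (mpoly_ring n) B) (\<lambda>x. x)"
proof -
  define R where "R = (mpoly_ring n :: 'k mpoly ring)"
  let ?K = "koszul_module n (carrier R)" and ?A = "ideal_module R A" and ?B = "ideal_module R B"
  have modK: "module R (?K i)" and modA: "module R ?A" and modB: "module R ?B" for i
    unfolding R_def by (intro module_koszul_module module_ideal_module A B ideal_carrier_mpoly)+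
  have incl: "(\<lambda>x. x) \<in> mod_hom R ?A ?B"
    using AB by (intro mod_homI) auto
  have "kills_cycles R ?K (\<lambda>_. koszul_diff n) ?A ?B (\<lambda>x. x)"
    unfolding kills_cycles_def
  proof (intro allI ballI)
    fix i z
    let ?d = "\<lambda>i. tensor_map R (?K i) ?B (koszul_diff n) (\<lambda>x. x)"
    let ?j = "tensor_map R (?K i) ?B (\<lambda>x. x) (\<lambda>x. x)"
    assume z: "z \<in> carrier (cycles (\<lambda>i. tensor R (?K i) ?A)
      (\<lambda>i. tensor_map R (?K i) ?A (koszul_diff n) (\<lambda>x. x)) i)"
    then have zT: "z \<in> carrier (tensor R (?K i) ?A)" by (rule carrier_cycles_subset)
    obtain evA evB evB' where ev: "koszul_evaluation n A i evA" "koszul_evaluation n B i evB"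
      "koszul_evaluation n B (Suc i) evB'"
      using koszul_evaluation_exists A B by metis
    note evA = koszul_evaluationD[OF ev(1), folded R_def] and evB = koszul_evaluationD[OF ev(2), folded R_def]
      and evB' = koszul_evaluationD[OF ev(3), folded R_def]
    define a where "a = evA z"
    have a: "a \<in> carrier (koszul_module n A i)"
      using hom_in_carrier[OF evA(1) zT] by (simp add: a_def)
    have cycle: "koszul_diff n a = (\<lambda>_. 0)"
    proof (cases i)
      case 0
      then show ?thesis using koszul_diff_degree_0 a by blast
    next
      case (Suc l)
      obtain e where e: "koszul_evaluation n A l e" using koszul_evaluation_exists[OF A] ..
      note ev' = koszul_evaluationD[OF e, folded R_def]
      have "koszul_diff n a = e (tensor_map R (?K l) ?A (koszul_diff n) (\<lambda>x. x) z)"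
        unfolding a_def R_def
        using ev(1) e zT Suc by (intro koszul_evaluation_diff[OF A, symmetric]) (simp_all add: R_def)
      also have "tensor_map R (?K l) ?A (koszul_diff n) (\<lambda>x. x) z = \<one>\<^bsub>tensor R (?K l) ?A\<^esub>"
        using z Suc by (simp add: carrier_cycles_Suc)
      also have "e \<one>\<^bsub>tensor R (?K l) ?A\<^esub> = (\<lambda>_. 0)"
      proof -
        interpret KA: module R "koszul_module n A l" unfolding R_def by (rule module_koszul_module[OF A])
        show ?thesis
          using hom_one[OF ev'(1) comm_group.axioms(2)[OF module_pair.comm_group_tensor[OF module_pair.intro[OF modK modA]]] KA.M.a_group]
          by simp
      qed
      finally show ?thesis .
    qed
    have const: "Poly_Mapping.lookup (a {}) 0 = 0"
      using koszul_moduleD(1)[OF a, of "{}"] m unfolding graded_max_ideal_eq by blast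
    have sub: "A \<subseteq> carrier (mpoly_ring n)" using ideal_mpolyD(1)[OF A] by blast
    define b where "b = koszul_homotopy n w a"
    have b: "b \<in> carrier (koszul_module n B (Suc i))" "koszul_diff n b = a"
      unfolding b_def
      by (rule koszul_homotopy_chain[OF B low a], rule koszul_cycle_boundary[OF sub w a cycle const])
    have "b \<in> evB' ` carrier (tensor R (?K (Suc i)) ?B)"
      using b(1) bij_betw_imp_surj_on[OF evB'(3)] by simp
    then obtain y where y': "b = evB' y" and y: "y \<in> carrier (tensor R (?K (Suc i)) ?B)"
      by (rule imageE)
    have diff: "koszul_diff n \<in> mod_hom R (?K (Suc i)) (?K i)"
      unfolding R_def by (rule koszul_diff_hom[OF ideal_carrier_mpoly])
    have dy: "?d i y \<in> carrier (tensor R (?K i) ?B)"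
      by (rule hom_in_carrier[OF tensor_maps.tensor_map_hom y])
        (intro tensor_mapsI modK modB mod_hom_id diff)
    interpret j: tensor_maps R "?K i" ?A "?K i" ?B "\<lambda>x. x" "\<lambda>x. x"
      by (intro tensor_mapsI modK modA modB mod_hom_id incl)
    have jz: "?j z \<in> carrier (tensor R (?K i) ?B)"
      by (rule hom_in_carrier[OF j.tensor_map_hom zT])
    have "evB (?j z) = a"
    proof -
      interpret KB: module R "koszul_module n B i" unfolding R_def by (rule module_koszul_module[OF B])
      have "carrier (koszul_module n A i) \<subseteq> carrier (koszul_module n B i)"
      proof
        fix x assume x: "x \<in> carrier (koszul_module n A i)"
        have "x J \<in> B" for J using subsetD[OF AB koszul_moduleD(1)[OF x]] .
        then show "x \<in> carrier (koszul_module n B i)" using x by (simp add: mem_koszul_module)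
      qed
      then have evA': "evA \<in> hom (tensor R (?K i) ?A) (add_monoid (koszul_module n B i))"
        using evA(1) by (auto simp: hom_def Pi_def)
      have "(evB \<circ> ?j) z = evA z"
        by (rule j.A.tensor_ext[OF KB.M.a_group hom_compose[OF j.tensor_map_hom evB(1)] evA' _ zT])
          (use AB in \<open>auto simp: j.tensor_map_pure evA(2) evB(2)\<close>)
      then show ?thesis by (simp add: a_def)
    qed
    also have "\<dots> = evB (?d i y)"
      unfolding b(2)[symmetric] y' R_def
      using ev y by (intro koszul_evaluation_diff[OF B, symmetric]) (simp_all add: R_def)
    finally have "?j z = ?d i y"
      by (rule inj_onD[OF bij_betw_imp_inj_on[OF evB(3)] _ jz dy])
    then show "?j z \<in> boundaries (\<lambda>i. tensor R (?K i) ?B)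
        (\<lambda>i. ?d i) i"
      using y unfolding boundaries_iff by (intro bexI)
  qed
  then show ?thesis
    unfolding R_def
    by (intro tor_vanishing_by_resolution[OF koszul_resolution projective_koszul_module]
        module_ideal_module A B incl[unfolded R_def])
qed

section \<open>Derivations and products of ideals\<close>

inductive_set additive_span :: "'a::comm_monoid_add set \<Rightarrow> 'a set" for G where
  zero: "0 \<in> additive_span G"
| add: "x \<in> G \<Longrightarrow> y \<in> additive_span G \<Longrightarrow> x + y \<in> additive_span G"

lemma additive_span_incl: "x \<in> G \<Longrightarrow> x \<in> additive_span G"
  using additive_span.add[OF _ additive_span.zero] by simp

lemma additive_span_add: "x \<in> additive_span G \<Longrightarrow> y \<in> additive_span G \<Longrightarrow> x + y \<in> additive_span G"
  by (induction rule: additive_span.induct) (simp_all add: add.assoc additive_span.add)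

lemma additive_span_mono: "x \<in> additive_span G \<Longrightarrow> G \<subseteq> Y \<Longrightarrow> x \<in> additive_span Y"
  by (induction rule: additive_span.induct) (auto intro: additive_span.intros)

lemma additive_span_sum: "(\<And>i. i \<in> S \<Longrightarrow> f i \<in> additive_span G) \<Longrightarrow> sum f S \<in> additive_span G"
  by (induction S rule: infinite_finite_induct) (auto intro: additive_span.zero additive_span_add)

lemma additive_span_ideal:
  assumes G: "G \<subseteq> carrier (mpoly_ring n)"
    and mono: "\<And>x m c. x \<in> G \<Longrightarrow> Poly_Mapping.keys m \<subseteq> {..<n} \<Longrightarrow> Poly_Mapping.single m c * x \<in> G"
  shows "ideal (additive_span G) (mpoly_ring n)"
proof (rule ideal_mpolyI)
  show "additive_span G \<subseteq> carrier (mpoly_ring n)"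
  proof
    fix x assume "x \<in> additive_span G"
    then show "x \<in> carrier (mpoly_ring n)"
      by induction (use G in \<open>auto intro: mpoly_ring_closed\<close>)
  qed
  show "0 \<in> additive_span G" by (rule additive_span.zero)
  show "f + g \<in> additive_span G" if "f \<in> additive_span G" "g \<in> additive_span G" for f g
    using that by (rule additive_span_add)
  show "f * g \<in> additive_span G" if f: "f \<in> carrier (mpoly_ring n)" and g: "g \<in> additive_span G" for f g
  proof -
    have "Poly_Mapping.single k (Poly_Mapping.lookup f k) * g \<in> additive_span G"
      if k: "k \<in> Poly_Mapping.keys f" for k
    proof -
      have "Poly_Mapping.keys k \<subseteq> {..<n}" using f k by (auto simp: mem_mpoly_ring in_keys_iff)
      note single = mono[OF _ this]
      from g show ?thesis
        by induction (auto simp: distrib_left intro: additive_span.intros single)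
    qed
    then have "(\<Sum>k\<in>Poly_Mapping.keys f. Poly_Mapping.single k (Poly_Mapping.lookup f k) * g) \<in> additive_span G"
      by (rule additive_span_sum)
    then show ?thesis
      using poly_mapping_sum_single[of f] by (simp add: sum_distrib_right[symmetric])
  qed
qed

lemma ideal_prod_mono:
  assumes "A \<subseteq> A'" "B \<subseteq> B'"
  shows "A \<cdot>\<^bsub>R\<^esub> B \<subseteq> A' \<cdot>\<^bsub>R\<^esub> B'"
proof
  fix x assume "x \<in> A \<cdot>\<^bsub>R\<^esub> B"
  then show "x \<in> A' \<cdot>\<^bsub>R\<^esub> B'"
    by induction (use assms in \<open>auto intro: ideal_prod.intros\<close>)
qed

lemma ideals_set_simps [simp]:
  "carrier (ideals_set R) = {I. ideal I R}" "monoid.mult (ideals_set R) = ideal_prod R"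
  "one (ideals_set R) = carrier R"
  by (simp_all add: ideals_set_def)

lemma ideal_pow_simps [simp]:
  "ideal_pow R J 0 = carrier R" "ideal_pow R J (Suc a) = ideal_pow R J a \<cdot>\<^bsub>R\<^esub> J"
  by (simp_all add: nat_pow_def)

text \<open>
  The common features of a partial derivative, with \<open>P\<close> the homogeneous polynomials, and of the division by
  a variable, with \<open>P\<close> the scalar multiples of monomials.  The first obeys the Leibniz rule.  For the second,
  exactly one factor of a product is divided, as \<open>x\<^sub>j\<close> divides a product of monomials only if it divides a
  factor.
\<close>

locale monomial_derivation =
  fixes n :: nat and P :: "'k::field mpoly set" and D :: "'k mpoly \<Rightarrow> 'k mpoly"
  assumes P_mult: "\<And>p q. p \<in> P \<Longrightarrow> q \<in> P \<Longrightarrow> p * q \<in> P"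
    and P_single: "\<And>m c. Poly_Mapping.single m c \<in> P"
    and D_zero: "D 0 = 0" and D_add: "\<And>f g. D (f + g) = D f + D g"
    and D_carrier: "\<And>f. f \<in> carrier (mpoly_ring n) \<Longrightarrow> D f \<in> carrier (mpoly_ring n)"
    and D_mult: "\<And>p q. p \<in> P \<Longrightarrow> q \<in> P \<Longrightarrow> D (p * q) \<in> {D p * q + p * D q, D p * q, p * D q}"
begin

abbreviation "R \<equiv> mpoly_ring n :: 'k mpoly ring"
abbreviation "\<mm> \<equiv> graded_max_ideal n :: 'k mpoly set"

definition spanned :: "'k mpoly set \<Rightarrow> bool"
  where "spanned A \<longleftrightarrow> A \<subseteq> additive_span (A \<inter> P)"

sublocale R: cring R by (rule cring_mpoly_ring)
sublocale S: comm_monoid "ideals_set R" by (rule R.ideals_set_is_comm_monoid)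

lemma max_ideal: "ideal \<mm> R"
  by (rule graded_max_ideal_ideal)

lemma unit_ideal: "ideal (carrier R) R"
  by (rule ideal_carrier_mpoly)

lemma ideal_prod: "ideal A R \<Longrightarrow> ideal B R \<Longrightarrow> ideal (A \<cdot>\<^bsub>R\<^esub> B) R"
  by (rule R.ideal_prod_is_ideal)

lemma ideal_pow: "ideal A R \<Longrightarrow> ideal (ideal_pow R A a) R"
  using S.nat_pow_closed[of A a] by simp

text \<open>
  The sums of elements of \<open>P\<close> in the ideal form an ideal again, since \<open>P\<close> is stable under multiplication
  by terms; and this ideal contains the generators.
\<close>

lemma spanned_genideal:
  assumes S: "S \<subseteq> carrier R" "S \<subseteq> P"
  shows "spanned (Idl\<^bsub>R\<^esub> S)"
proof -
  have ideal: "ideal (Idl\<^bsub>R\<^esub> S) R" by (rule R.genideal_ideal[OF S(1)])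
  have "ideal (additive_span (Idl\<^bsub>R\<^esub> S \<inter> P)) R"
  proof (rule additive_span_ideal)
    show "Idl\<^bsub>R\<^esub> S \<inter> P \<subseteq> carrier R" using ideal_mpolyD(1)[OF ideal] by blast
    show "Poly_Mapping.single m c * x \<in> Idl\<^bsub>R\<^esub> S \<inter> P"
      if "x \<in> Idl\<^bsub>R\<^esub> S \<inter> P" "Poly_Mapping.keys m \<subseteq> {..<n}" for x m c
      using that ideal_mpolyD(5)[OF ideal, of "Poly_Mapping.single m c" x] P_mult P_single
      by (auto simp: mpoly_ring_def)
  qed
  moreover have "S \<subseteq> additive_span (Idl\<^bsub>R\<^esub> S \<inter> P)"
    using R.genideal_self[OF S(1)] S(2) by (auto intro: additive_span_incl)
  ultimately show ?thesis
    unfolding spanned_def by (rule R.genideal_minimal)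
qed

lemma spanned_carrier: "spanned (carrier R)"
proof -
  have "1 \<in> P" using P_single[of 0 1] by simp
  then have "spanned (Idl\<^bsub>R\<^esub> {1})"
    by (intro spanned_genideal) (auto intro: mpoly_ring_closed)
  then show ?thesis using R.genideal_one by simp
qed

lemma P_monom_poly: "monom_poly m \<in> P"
  unfolding monom_poly_def by (rule P_single)

lemma spanned_max_ideal: "spanned \<mm>"
  unfolding graded_max_ideal_def
  by (rule spanned_genideal) (auto intro!: monom_poly_carrier P_single simp: P_monom_poly)

lemma prod_span:
  assumes "spanned A" "spanned B" "f \<in> A \<cdot>\<^bsub>R\<^esub> B"
  shows "f \<in> additive_span {p * q | p q. p \<in> A \<inter> P \<and> q \<in> B \<inter> P}" (is "_ \<in> additive_span ?X")
  using assms(3)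
proof induction
  case (prod a b)
  have left: "p * b \<in> additive_span ?X" if "p \<in> A \<inter> P" for p
  proof -
    have "b \<in> additive_span (B \<inter> P)" using prod assms(2) unfolding spanned_def by blast
    then show ?thesis
    proof induction
      case zero
      show ?case by (simp add: additive_span.zero)
    next
      case (add x y)
      then have "p * x \<in> ?X" using that by blast
      then show ?case using add.IH by (simp add: distrib_left additive_span.add)
    qed
  qed
  have "a \<in> additive_span (A \<inter> P)" using prod assms(1) unfolding spanned_def by blast
  then have "a * b \<in> additive_span ?X"
  proof induction
    case zero
    show ?case by (simp add: additive_span.zero)
  next
    case (add x y)
    show ?case unfolding distrib_right by (rule additive_span_add[OF left[OF add.hyps(1)] add.IH])
  qed
  then show ?case by simp
next
  case (sum s1 s2)
  then show ?case by (simp add: additive_span_add)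
qed

lemma spanned_prod:
  assumes "spanned A" "spanned B"
  shows "spanned (A \<cdot>\<^bsub>R\<^esub> B)"
  unfolding spanned_def
proof
  fix f assume "f \<in> A \<cdot>\<^bsub>R\<^esub> B"
  note prod_span[OF assms this]
  moreover have "{p * q | p q. p \<in> A \<inter> P \<and> q \<in> B \<inter> P} \<subseteq> A \<cdot>\<^bsub>R\<^esub> B \<inter> P"
    using ideal_prod.prod[of _ A _ B R] P_mult by auto
  ultimately show "f \<in> additive_span (A \<cdot>\<^bsub>R\<^esub> B \<inter> P)" by (rule additive_span_mono)
qed

lemma spanned_pow: "spanned A \<Longrightarrow> spanned (ideal_pow R A a)"
  by (induction a) (simp_all add: spanned_carrier spanned_prod)

text \<open>
  The ideal form of the Leibniz rule: \<open>D (A B) \<subseteq> D(A) B + A D(B)\<close>.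
\<close>

lemma D_prod:
  assumes "spanned A" "spanned B" and C: "ideal C R"
    and DA: "D ` A \<subseteq> A'" and DB: "D ` B \<subseteq> B'"
    and AC: "A' \<cdot>\<^bsub>R\<^esub> B \<subseteq> C" and BC: "A \<cdot>\<^bsub>R\<^esub> B' \<subseteq> C"
  shows "D ` (A \<cdot>\<^bsub>R\<^esub> B) \<subseteq> C"
proof
  fix g assume "g \<in> D ` (A \<cdot>\<^bsub>R\<^esub> B)"
  then obtain f where f: "f \<in> A \<cdot>\<^bsub>R\<^esub> B" and g: "g = D f" by blast
  from prod_span[OF assms(1,2) f] have "D f \<in> C"
  proof induction
    case zero
    show ?case by (simp add: D_zero ideal_mpolyD(2)[OF C])
  next
    case (add x y)
    then obtain p q where pq: "x = p * q" "p \<in> A" "p \<in> P" "q \<in> B" "q \<in> P" by blast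
    have "D p * q \<in> C" using AC DA pq ideal_prod.prod[of "D p" A' q B R] by auto
    moreover have "p * D q \<in> C" using BC DB pq ideal_prod.prod[of p A "D q" B' R] by auto
    ultimately have "D x \<in> C"
      using D_mult[OF pq(3,5)] pq(1) ideal_mpolyD(3)[OF C] by auto
    then show ?case using add.IH by (simp add: D_add ideal_mpolyD(3)[OF C])
  qed
  then show "g \<in> C" using g by simp
qed

lemma D_max_ideal_pow: "D ` ideal_pow R \<mm> (Suc a) \<subseteq> ideal_pow R \<mm> a"
proof (induction a)
  case 0
  show ?case
    using D_carrier ideal_mpolyD(1)[OF ideal_pow[OF max_ideal, of "Suc 0"]]
    by (auto simp del: ideal_pow_simps(2))
next
  case (Suc a)
  let ?A = "ideal_pow R \<mm> (Suc a)"
  have A: "ideal ?A R" by (rule ideal_pow[OF max_ideal])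
  have "D ` (?A \<cdot>\<^bsub>R\<^esub> \<mm>) \<subseteq> ?A"
  proof (rule D_prod[OF _ spanned_max_ideal A Suc.IH, where B' = "carrier R"])
    show "spanned ?A" by (rule spanned_pow[OF spanned_max_ideal])
    show "D ` \<mm> \<subseteq> carrier R" using D_carrier ideal_mpolyD(1)[OF max_ideal] by auto
    show "?A \<cdot>\<^bsub>R\<^esub> carrier R \<subseteq> ?A" using R.ideal_prod_one[OF A] by simp
  qed simp
  then show ?case by simp
qed

end

text \<open>
  The ideal \<open>I\<close> of the theorem, together with one of the operators \<open>D\<close>.
\<close>

locale derivation_ideal = monomial_derivation n P D
  for n and P :: "'k::field mpoly set" and D +
  fixes I :: "'k mpoly set"
  assumes I: "ideal I R" and I_spanned: "spanned I"
    and I_square: "I \<subseteq> ideal_pow R \<mm> 2"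
begin

lemma max_ideal_pow_1: "ideal_pow R \<mm> (Suc 0) = \<mm>"
  using S.l_one[of \<mm>] max_ideal by simp

lemma I_square': "I \<subseteq> \<mm> \<cdot>\<^bsub>R\<^esub> \<mm>"
  using I_square max_ideal_pow_1 by (simp add: numeral_2_eq_2)

lemma I_max_ideal: "I \<subseteq> \<mm>"
  using I_square' R.ideal_prod_inter[OF max_ideal max_ideal] by blast

lemma D_I: "D ` I \<subseteq> \<mm>"
  using image_mono[OF I_square, of D] D_max_ideal_pow[of "Suc 0"]
  unfolding max_ideal_pow_1 numeral_2_eq_2 by (rule subset_trans)

lemma D_I_pow: "D ` ideal_pow R I (Suc t) \<subseteq> \<mm> \<cdot>\<^bsub>R\<^esub> ideal_pow R I t"
proof (induction t)
  case 0
  show ?case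
    using D_I S.l_one[of I] S.r_one[of \<mm>] I max_ideal by simp
next
  case (Suc t)
  let ?A = "ideal_pow R I (Suc t)"
  have A: "ideal ?A R" and It: "ideal (ideal_pow R I t) R" by (intro ideal_pow I)+
  have "D ` (?A \<cdot>\<^bsub>R\<^esub> I) \<subseteq> \<mm> \<cdot>\<^bsub>R\<^esub> ?A"
  proof (rule D_prod[OF spanned_pow[OF I_spanned] I_spanned _ Suc.IH D_I])
    show "ideal (\<mm> \<cdot>\<^bsub>R\<^esub> ?A) R" by (intro ideal_prod max_ideal A)
    show "\<mm> \<cdot>\<^bsub>R\<^esub> ideal_pow R I t \<cdot>\<^bsub>R\<^esub> I \<subseteq> \<mm> \<cdot>\<^bsub>R\<^esub> ?A"
      using S.m_assoc[of \<mm> "ideal_pow R I t" I] I It max_ideal by simp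
    show "?A \<cdot>\<^bsub>R\<^esub> \<mm> \<subseteq> \<mm> \<cdot>\<^bsub>R\<^esub> ?A"
      using S.m_comm[of ?A \<mm>] A max_ideal by simp
  qed
  then show ?case by simp
qed

text \<open>
  Differentiating a factor in \<open>I\<close> trades it for an element of \<open>\<mm>\<close>, which is what the right-hand side
  allows.  Differentiating a factor in \<open>\<mm>\<close> loses it, but one of the remaining factors in \<open>I\<close> counts as two
  factors in \<open>\<mm>\<close>.
\<close>

lemma D_mixed_pow:
  "D ` (ideal_pow R \<mm> a \<cdot>\<^bsub>R\<^esub> ideal_pow R I (Suc t)) \<subseteq> ideal_pow R \<mm> (Suc a) \<cdot>\<^bsub>R\<^esub> ideal_pow R I t"
proof (rule D_prod[OF spanned_pow[OF spanned_max_ideal] spanned_pow[OF I_spanned] _ subset_refl D_I_pow])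
  let ?N = "ideal_pow R \<mm> (Suc a) \<cdot>\<^bsub>R\<^esub> ideal_pow R I t"
  have m: "ideal \<mm> R" and ma: "ideal (ideal_pow R \<mm> b) R" and It: "ideal (ideal_pow R I t) R" for b
    by (intro max_ideal ideal_pow I)+
  show "ideal ?N R" by (intro ideal_prod ma It)
  show "ideal_pow R \<mm> a \<cdot>\<^bsub>R\<^esub> (\<mm> \<cdot>\<^bsub>R\<^esub> ideal_pow R I t) \<subseteq> ?N"
    using S.m_assoc[of "ideal_pow R \<mm> a" \<mm> "ideal_pow R I t"] m ma It by simp
  have "D ` ideal_pow R \<mm> a \<cdot>\<^bsub>R\<^esub> (ideal_pow R I t \<cdot>\<^bsub>R\<^esub> I) \<subseteq> ?N"
  proof (cases a)
    case 0
    have "D ` ideal_pow R \<mm> a \<cdot>\<^bsub>R\<^esub> (ideal_pow R I t \<cdot>\<^bsub>R\<^esub> I) \<subseteq> carrier R \<cdot>\<^bsub>R\<^esub> (ideal_pow R I t \<cdot>\<^bsub>R\<^esub> \<mm>)"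
      using 0 D_carrier I_max_ideal by (intro ideal_prod_mono) auto
    also have "\<dots> = carrier R \<cdot>\<^bsub>R\<^esub> \<mm> \<cdot>\<^bsub>R\<^esub> ideal_pow R I t"
      using S.m_comm[of "ideal_pow R I t" \<mm>] S.m_assoc[of "carrier R" \<mm> "ideal_pow R I t"]
        m It unit_ideal by simp
    finally show ?thesis using 0 by simp
  next
    case (Suc b)
    have "D ` ideal_pow R \<mm> a \<cdot>\<^bsub>R\<^esub> (ideal_pow R I t \<cdot>\<^bsub>R\<^esub> I) \<subseteq>
        ideal_pow R \<mm> b \<cdot>\<^bsub>R\<^esub> (ideal_pow R I t \<cdot>\<^bsub>R\<^esub> (\<mm> \<cdot>\<^bsub>R\<^esub> \<mm>))"
      unfolding Suc by (intro ideal_prod_mono D_max_ideal_pow I_square' subset_refl)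
    also have "\<dots> = ideal_pow R \<mm> b \<cdot>\<^bsub>R\<^esub> \<mm> \<cdot>\<^bsub>R\<^esub> \<mm> \<cdot>\<^bsub>R\<^esub> ideal_pow R I t"
      using S.m_comm[of "ideal_pow R I t" "\<mm> \<cdot>\<^bsub>R\<^esub> \<mm>"] m ma[of b] It ideal_prod[OF m m] ideal_prod[OF ma m]
        S.m_assoc[of "ideal_pow R \<mm> b" "\<mm> \<cdot>\<^bsub>R\<^esub> \<mm>" "ideal_pow R I t"]
        S.m_assoc[of "ideal_pow R \<mm> b" \<mm> \<mm>]
      by simp
    finally show ?thesis using Suc by simp
  qed
  then show "D ` ideal_pow R \<mm> a \<cdot>\<^bsub>R\<^esub> ideal_pow R I (Suc t) \<subseteq> ?N" by simp
qed

text \<open>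
  The component of the homotopy need not be a derivation, but on each element of \<open>P\<close> it is a scalar multiple of
  \<open>D\<close>.  As elements of \<open>P\<close> span the source, this is enough.
\<close>

lemma divide_var_mixed_pow:
  assumes eq: "\<And>p. p \<in> P \<Longrightarrow> \<exists>\<kappa>. divide_var c j p = Poly_Mapping.single 0 \<kappa> * D p"
    and f: "f \<in> ideal_pow R \<mm> a \<cdot>\<^bsub>R\<^esub> ideal_pow R I (Suc t)"
  shows "divide_var c j f \<in> ideal_pow R \<mm> (Suc a) \<cdot>\<^bsub>R\<^esub> ideal_pow R I t"
proof -
  let ?M = "ideal_pow R \<mm> a \<cdot>\<^bsub>R\<^esub> ideal_pow R I (Suc t)" and ?N = "ideal_pow R \<mm> (Suc a) \<cdot>\<^bsub>R\<^esub> ideal_pow R I t"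
  have N: "ideal ?N R" by (intro ideal_prod ideal_pow max_ideal I)
  have "spanned ?M" by (intro spanned_prod spanned_pow spanned_max_ideal I_spanned)
  then have "f \<in> additive_span (?M \<inter> P)" using f unfolding spanned_def by blast
  then show ?thesis
  proof induction
    case zero
    show ?case using ideal_mpolyD(2)[OF N] by (simp only: divide_var_zero)
  next
    case (add p g)
    obtain \<kappa> where \<kappa>: "divide_var c j p = Poly_Mapping.single 0 \<kappa> * D p" using eq add.hyps by blast
    have "Poly_Mapping.single 0 \<kappa> \<in> carrier R" by (simp add: mpoly_ring_def)
    moreover have "D p \<in> ?N" using D_mixed_pow add.hyps by blast
    ultimately have "divide_var c j p \<in> ?N" unfolding \<kappa> by (rule ideal_mpolyD(5)[OF N])
    then show ?case unfolding divide_var_add by (rule ideal_mpolyD(3)[OF N _ add.IH])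
  qed
qed

lemma mixed_pow_mono:
  "ideal_pow R \<mm> a \<cdot>\<^bsub>R\<^esub> ideal_pow R I (Suc t) \<subseteq> ideal_pow R \<mm> (Suc a) \<cdot>\<^bsub>R\<^esub> ideal_pow R I t"
proof -
  have m: "ideal \<mm> R" and ma: "ideal (ideal_pow R \<mm> a) R" and It: "ideal (ideal_pow R I t) R"
    by (intro max_ideal ideal_pow I)+
  have "ideal_pow R \<mm> a \<cdot>\<^bsub>R\<^esub> (ideal_pow R I t \<cdot>\<^bsub>R\<^esub> I) \<subseteq> ideal_pow R \<mm> a \<cdot>\<^bsub>R\<^esub> (ideal_pow R I t \<cdot>\<^bsub>R\<^esub> \<mm>)"
    by (intro ideal_prod_mono subset_refl I_max_ideal)
  also have "\<dots> = ideal_pow R \<mm> a \<cdot>\<^bsub>R\<^esub> \<mm> \<cdot>\<^bsub>R\<^esub> ideal_pow R I t"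
    using S.m_comm[of "ideal_pow R I t" \<mm>] S.m_assoc[of "ideal_pow R \<mm> a" \<mm> "ideal_pow R I t"] m ma It
    by simp
  finally show ?thesis by simp
qed

lemma mixed_pow_max_ideal: "ideal_pow R \<mm> a \<cdot>\<^bsub>R\<^esub> ideal_pow R I (Suc t) \<subseteq> \<mm>"
  using R.ideal_prod_inter[OF ideal_pow[OF max_ideal] ideal_pow[OF I], of a "Suc t"]
    R.ideal_prod_inter[OF ideal_pow[OF I] I, of t] I_max_ideal by auto

end

lemma tor_vanishing_mixed_pow:
  fixes I :: "'k::field mpoly set"
  assumes D: "\<And>j. derivation_ideal n P (D j) I"
    and w: "homotopy_weights n w"
    and eq: "\<And>j J p. J \<subseteq> {..<n} \<Longrightarrow> j \<notin> J \<Longrightarrow> p \<in> P \<Longrightarrow>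
      \<exists>\<kappa>. divide_var (\<lambda>m. w j (m + subset_exp J)) j p = Poly_Mapping.single 0 \<kappa> * D j p"
    and t: "1 \<le> t"
  shows "tor_vanishing TYPE('f) (mpoly_ring n) (graded_max_ideal n)
    (ideal_module (mpoly_ring n)
      (ideal_pow (mpoly_ring n) (graded_max_ideal n) a \<cdot>\<^bsub>mpoly_ring n\<^esub> ideal_pow (mpoly_ring n) I t))
    (ideal_module (mpoly_ring n)
      (ideal_pow (mpoly_ring n) (graded_max_ideal n) (a + 1) \<cdot>\<^bsub>mpoly_ring n\<^esub> ideal_pow (mpoly_ring n) I (t - 1)))
    (\<lambda>x. x)"
proof -
  interpret derivation_ideal n P "D 0" I by (rule D)
  obtain u where t: "t = Suc u" using t by (cases t) auto
  show ?thesis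
    unfolding t Suc_eq_plus1[symmetric] diff_Suc_1
  proof (rule tor_vanishing_by_weights[OF _ _ mixed_pow_mono mixed_pow_max_ideal w])
    show "lowers_into n w (ideal_pow R \<mm> a \<cdot>\<^bsub>R\<^esub> ideal_pow R I (Suc u)) (ideal_pow R \<mm> (Suc a) \<cdot>\<^bsub>R\<^esub> ideal_pow R I u)"
      unfolding lowers_into_def
      using derivation_ideal.divide_var_mixed_pow[OF D] eq by blast
  qed (intro ideal_prod ideal_pow graded_max_ideal_ideal I)+
qed

lemma divide_var_single:
  "divide_var c j (Poly_Mapping.single a d) =
    (if 0 < Poly_Mapping.lookup a j then Poly_Mapping.single (a - unit_exp j) (c a * d) else 0)"
proof (rule poly_mapping_eqI)
  fix m
  show "Poly_Mapping.lookup (divide_var c j (Poly_Mapping.single a d)) m = Poly_Mapping.lookup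
    (if 0 < Poly_Mapping.lookup a j then Poly_Mapping.single (a - unit_exp j) (c a * d) else 0) m"
  proof (cases "a = m + unit_exp j")
    case True
    then have "0 < Poly_Mapping.lookup a j" "a - unit_exp j = m"
      by (simp_all add: lookup_add)
    then show ?thesis using True by (simp add: lookup_divide_var)
  next
    case False
    then have "a - unit_exp j \<noteq> m" if "0 < Poly_Mapping.lookup a j"
      using unit_exp_split[OF that] by (auto simp: add.commute)
    then show ?thesis using False by (auto simp: lookup_divide_var lookup_single when_def)
  qed
qed

lemma lookup_scalar_times:
  "Poly_Mapping.lookup (Poly_Mapping.single 0 c * f) (m :: nat \<Rightarrow>\<^sub>0 nat) = c * Poly_Mapping.lookup f (m :: nat \<Rightarrow>\<^sub>0 nat)"
  using lookup_single_times_add[of 0 c f m] by simp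

definition monomials :: "'k::field mpoly set"
  where "monomials = {Poly_Mapping.single m c | m c. True}"

definition var_quotient :: "nat \<Rightarrow> 'k::field mpoly \<Rightarrow> 'k mpoly"
  where "var_quotient = divide_var (\<lambda>_. 1)"

text \<open>
  If \<open>x\<^sub>j\<close> divides \<open>p\<close>, it is cancelled there; otherwise it can only be cancelled in \<open>q\<close>.
\<close>

lemma monomial_derivation_var_quotient: "monomial_derivation n (monomials :: 'k::field mpoly set) (var_quotient j)"
proof
  fix p q :: "'k mpoly" assume "p \<in> monomials" "q \<in> monomials"
  then obtain a c b d where pq: "p = Poly_Mapping.single a c" "q = Poly_Mapping.single b d"
    unfolding monomials_def by blast
  show "p * q \<in> monomials" unfolding pq monomials_def mult_single by blast
  have sub: "a - unit_exp j + b = a + b - unit_exp j" if "0 < Poly_Mapping.lookup a j" for a b :: "nat \<Rightarrow>\<^sub>0 nat"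
    using that by (intro poly_mapping_eqI) (auto simp: lookup_add lookup_minus lookup_single when_def)
  show "var_quotient j (p * q) \<in> {var_quotient j p * q + p * var_quotient j q, var_quotient j p * q, p * var_quotient j q}"
  proof (cases "0 < Poly_Mapping.lookup a j")
    case True
    then have "var_quotient j (p * q) = var_quotient j p * q"
      unfolding pq var_quotient_def by (simp add: mult_single divide_var_single lookup_add sub del: One_nat_def)
    then show ?thesis by simp
  next
    case False
    then have "var_quotient j (p * q) = p * var_quotient j q"
      using sub[of b a] unfolding pq var_quotient_def
      by (simp add: mult_single divide_var_single lookup_add add.commute del: One_nat_def)
    then show ?thesis by simp
  qed
next
  show "Poly_Mapping.single m c \<in> monomials" for m c unfolding monomials_def by blast
qed (simp_all add: var_quotient_def divide_var_zero divide_var_add divide_var_carrier)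

definition partial_deriv :: "nat \<Rightarrow> 'k::field mpoly \<Rightarrow> 'k mpoly"
  where "partial_deriv j = divide_var (\<lambda>m. of_nat (Poly_Mapping.lookup m j)) j"

lemma partial_deriv_sum: "partial_deriv j (sum f S) = (\<Sum>i\<in>S. partial_deriv j (f i))"
  by (induction S rule: infinite_finite_induct) (simp_all add: partial_deriv_def divide_var_zero divide_var_add)

text \<open>
  Both sides are bilinear, so the Leibniz rule is reduced to products of two terms.
\<close>

lemma partial_deriv_mult:
  "partial_deriv j (f * g) = partial_deriv j f * g + f * partial_deriv j g"
proof -
  have sub: "a - unit_exp j + b = a + b - unit_exp j" if "0 < Poly_Mapping.lookup a j" for a b :: "nat \<Rightarrow>\<^sub>0 nat"
    using that by (intro poly_mapping_eqI) (auto simp: lookup_add lookup_minus lookup_single when_def)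
  have single: "partial_deriv j (Poly_Mapping.single a c * Poly_Mapping.single b d) =
      partial_deriv j (Poly_Mapping.single a c) * Poly_Mapping.single b d +
      Poly_Mapping.single a c * partial_deriv j (Poly_Mapping.single b d)" for a b and c d :: 'a
    using sub[of a b] sub[of b a] unfolding partial_deriv_def
    by (auto simp: mult_single divide_var_single lookup_add add.commute algebra_simps single_add[symmetric]
        simp del: One_nat_def)
  have left: "partial_deriv j (Poly_Mapping.single a c * g) =
      partial_deriv j (Poly_Mapping.single a c) * g + Poly_Mapping.single a c * partial_deriv j g" for a c
  proof -
    have g: "g = (\<Sum>k\<in>Poly_Mapping.keys g. Poly_Mapping.single k (Poly_Mapping.lookup g k))"
      by (rule poly_mapping_sum_single)
    show ?thesis
      by (subst (1 2 3) g) (simp add: sum_distrib_left partial_deriv_sum single sum.distrib)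
  qed
  have f: "f = (\<Sum>k\<in>Poly_Mapping.keys f. Poly_Mapping.single k (Poly_Mapping.lookup f k))"
    by (rule poly_mapping_sum_single)
  show ?thesis
    by (subst (1 2 3) f) (simp add: sum_distrib_right partial_deriv_sum left sum.distrib)
qed

lemma total_degree_superset:
  "finite S \<Longrightarrow> Poly_Mapping.keys m \<subseteq> S \<Longrightarrow> total_degree m = (\<Sum>i\<in>S. Poly_Mapping.lookup m i)"
  unfolding total_degree_def by (rule sum.mono_neutral_left) (auto simp: in_keys_iff)

lemma total_degree_add: "total_degree (a + b) = total_degree a + total_degree b"
proof -
  let ?S = "Poly_Mapping.keys a \<union> Poly_Mapping.keys b"
  have "total_degree (a + b) = (\<Sum>i\<in>?S. Poly_Mapping.lookup (a + b) i)"
    by (rule total_degree_superset) (auto simp: keys_add_nat)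
  then show ?thesis
    by (simp add: lookup_add sum.distrib total_degree_superset[of ?S])
qed

lemma total_degree_subset_exp: "finite J \<Longrightarrow> total_degree (subset_exp J) = card J"
proof -
  assume J: "finite J"
  then show ?thesis
    by (simp add: total_degree_superset[of J] keys_subset_exp lookup_subset_exp)
qed

lemma monomial_derivation_partial_deriv:
  "monomial_derivation n {f :: 'k::field mpoly. homogeneous_poly f} (partial_deriv j)"
proof
  show "p * q \<in> {f. homogeneous_poly f}" if pq: "p \<in> {f. homogeneous_poly f}" "q \<in> {f. homogeneous_poly f}"
    for p q :: "'k mpoly"
  proof -
    obtain d e where d: "\<forall>m\<in>Poly_Mapping.keys p. total_degree m = d"
      and e: "\<forall>m\<in>Poly_Mapping.keys q. total_degree m = e"
      using pq unfolding homogeneous_poly_def by auto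
    have "total_degree m = d + e" if "m \<in> Poly_Mapping.keys (p * q)" for m
      using that keys_mult[of p q] d e by (auto simp: total_degree_add)
    then show ?thesis unfolding homogeneous_poly_def by blast
  qed
  show "Poly_Mapping.single m c \<in> {f. homogeneous_poly f}" for m and c :: 'k
    by (auto simp: homogeneous_poly_def)
qed (simp_all add: partial_deriv_mult, simp_all add: partial_deriv_def divide_var_zero divide_var_add divide_var_carrier)

text \<open>
  With these weights the homotopy is the de Rham differential divided by the total degree.
\<close>

definition degree_weights :: "nat \<Rightarrow> (nat \<Rightarrow>\<^sub>0 nat) \<Rightarrow> 'k::field"
  where "degree_weights j \<alpha> = of_nat (Poly_Mapping.lookup \<alpha> j) / of_nat (total_degree \<alpha>)"

text \<open>
  The weights add up to \<open>|\<alpha>| / |\<alpha>|\<close>; characteristic \<open>0\<close> ensures that the denominator is nonzero in \<open>k\<close>.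
\<close>

lemma homotopy_weights_degree:
  assumes "CHAR('k::field) = 0"
  shows "homotopy_weights n (degree_weights :: nat \<Rightarrow> (nat \<Rightarrow>\<^sub>0 nat) \<Rightarrow> 'k)"
  unfolding homotopy_weights_def
proof (intro conjI allI impI)
  show "degree_weights j \<alpha> = (0 :: 'k)" if "Poly_Mapping.lookup \<alpha> j = 0" for j \<alpha>
    using that by (simp add: degree_weights_def)
  show "(\<Sum>j<n. degree_weights j \<alpha>) = (1 :: 'k)" if "\<alpha> \<noteq> 0" "Poly_Mapping.keys \<alpha> \<subseteq> {..<n}" for \<alpha>
  proof -
    have "Poly_Mapping.keys \<alpha> \<noteq> {}" using that(1) by simp
    then obtain i where "i \<in> Poly_Mapping.keys \<alpha>" by blast
    then have "total_degree \<alpha> \<noteq> 0" unfolding total_degree_def by (auto simp: in_keys_iff)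
    then have "(of_nat (total_degree \<alpha>) :: 'k) \<noteq> 0"
      using assms by (simp add: of_nat_eq_0_iff_char_dvd)
    moreover have "(\<Sum>j<n. degree_weights j \<alpha>) = (of_nat (total_degree \<alpha>) :: 'k) / of_nat (total_degree \<alpha>)"
      using total_degree_superset[OF _ that(2)]
      by (simp add: degree_weights_def sum_divide_distrib[symmetric])
    ultimately show ?thesis by simp
  qed
qed

theorem lemma1p5:
  fixes n s t :: nat
    and I :: "((nat \<Rightarrow>\<^sub>0 nat) \<Rightarrow>\<^sub>0 'k::field) set"
  assumes "homogeneous_ideal n I"
    and "I \<subseteq> ideal_pow (mpoly_ring n) (graded_max_ideal n) 2"
    and "CHAR('k) = 0 \<or> monomial_ideal n I"
    and "1 \<le> t" and "t \<le> s"
  shows "tor_vanishing TYPE('f) (mpoly_ring n) (graded_max_ideal n)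
    (ideal_module (mpoly_ring n)
      (ideal_pow (mpoly_ring n) (graded_max_ideal n) (s - t) \<cdot>\<^bsub>mpoly_ring n\<^esub>
       ideal_pow (mpoly_ring n) I t))
    (ideal_module (mpoly_ring n)
      (ideal_pow (mpoly_ring n) (graded_max_ideal n) (s - t + 1) \<cdot>\<^bsub>mpoly_ring n\<^esub>
       ideal_pow (mpoly_ring n) I (t - 1)))
    (\<lambda>x. x)"
proof -
  interpret R: cring "mpoly_ring n :: 'k mpoly ring" by (rule cring_mpoly_ring)
  show ?thesis
    using assms(3)
  proof
    assume char: "CHAR('k) = 0"
    obtain S where S: "S \<subseteq> carrier (mpoly_ring n)" "S \<subseteq> {f. homogeneous_poly f}" "I = Idl\<^bsub>mpoly_ring n\<^esub> S"
      using assms(1) unfolding homogeneous_ideal_def by blast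
    have D: "derivation_ideal n {f. homogeneous_poly f} (partial_deriv j) I" for j
    proof -
      interpret monomial_derivation n "{f :: 'k mpoly. homogeneous_poly f}" "partial_deriv j"
        by (rule monomial_derivation_partial_deriv)
      show ?thesis
        by (intro derivation_ideal.intro derivation_ideal_axioms.intro monomial_derivation_axioms assms(2)
            R.genideal_ideal[OF S(1), folded S(3)] spanned_genideal[OF S(1,2), folded S(3)])
    qed
    show ?thesis
    proof (rule tor_vanishing_mixed_pow[OF D homotopy_weights_degree[OF char] _ assms(4)])
      fix j J and p :: "'k mpoly"
      assume J: "J \<subseteq> {..<n}" "j \<notin> J" and p: "p \<in> {f. homogeneous_poly f}"
      have fin: "finite J" using J(1) finite_subset by auto
      obtain d where d: "\<And>m. m \<in> Poly_Mapping.keys p \<Longrightarrow> total_degree m = d"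
        using p unfolding homogeneous_poly_def by blast
      \<comment> \<open>As \<open>j \<notin> J\<close>, the exponent of \<open>x\<^sub>j\<close> in the multidegree is the one in the monomial, as for the partial
        derivative; and the total degree \<open>d + |J|\<close> is the same for all terms of \<open>p\<close>.\<close>
      have "divide_var (\<lambda>m. degree_weights j (m + subset_exp J)) j p =
          Poly_Mapping.single 0 (1 / of_nat (d + card J)) * partial_deriv j p"
      proof (rule poly_mapping_eqI)
        fix m
        show "Poly_Mapping.lookup (divide_var (\<lambda>m. degree_weights j (m + subset_exp J)) j p) m =
          Poly_Mapping.lookup (Poly_Mapping.single 0 (1 / of_nat (d + card J)) * partial_deriv j p) m"
        proof (cases "m + unit_exp j \<in> Poly_Mapping.keys p")
          case True
          then have "total_degree (m + unit_exp j + subset_exp J) = d + card J"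
            using d[OF True] fin by (simp add: total_degree_add total_degree_subset_exp)
          then show ?thesis
            using J(2) fin
            by (simp add: lookup_divide_var lookup_scalar_times partial_deriv_def degree_weights_def
                lookup_add lookup_subset_exp)
        next
          case False
          then have "Poly_Mapping.lookup p (m + unit_exp j) = 0" by (simp add: in_keys_iff)
          then show ?thesis by (simp add: lookup_divide_var lookup_scalar_times partial_deriv_def)
        qed
      qed
      then show "\<exists>\<kappa>. divide_var (\<lambda>m. degree_weights j (m + subset_exp J)) j p =
          Poly_Mapping.single 0 \<kappa> * partial_deriv j p" by blast
    qed
  next
    assume "monomial_ideal n I"
    then obtain S where S: "S \<subseteq> carrier (mpoly_ring n)" "S \<subseteq> range monom_poly" "I = Idl\<^bsub>mpoly_ring n\<^esub> S"
      unfolding monomial_ideal_def by blast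
    then have S': "S \<subseteq> monomials" unfolding monomials_def monom_poly_def by blast
    have D: "derivation_ideal n monomials (var_quotient j) I" for j
    proof -
      interpret monomial_derivation n "monomials :: 'k mpoly set" "var_quotient j"
        by (rule monomial_derivation_var_quotient)
      show ?thesis
        by (intro derivation_ideal.intro derivation_ideal_axioms.intro monomial_derivation_axioms assms(2)
            R.genideal_ideal[OF S(1), folded S(3)] spanned_genideal[OF S(1) S', folded S(3)])
    qed
    show ?thesis
    proof (rule tor_vanishing_mixed_pow[OF D homotopy_weights_min_support _ assms(4)])
      fix j J and p :: "'k mpoly"
      assume "p \<in> monomials"
      then obtain a c where p: "p = Poly_Mapping.single a c" unfolding monomials_def by blast
      have "divide_var (\<lambda>m. min_support_weights j (m + subset_exp J)) j p =
          Poly_Mapping.single 0 (min_support_weights j (a + subset_exp J)) * var_quotient j p"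
        unfolding p var_quotient_def by (simp add: divide_var_single mult_single)
      then show "\<exists>\<kappa>. divide_var (\<lambda>m. min_support_weights j (m + subset_exp J)) j p =
          Poly_Mapping.single 0 \<kappa> * var_quotient j p" by blast
    qed
  qed
qed

end
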